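(* Let $K$ be a semitopological semihypergroup and let $H\subseteq K$ be a sub-semihypergroup. Write $H^c=K\setminus H$. Then the following statements hold for any $\mu,\nu\in M(K)$. (1) $\displaystyle \|(\mu*\nu)_H-(\mu_H*\nu_H)\|\le\int_K|\mu|(H\tilde{y}\cap H^c)\,d|\nu|(y)+\int_K|\nu|(\tilde{x}H\cap H^c)\,d|\mu|(x)$. (2) If $\operatorname{supp}(\mu)\subseteq H$, then $\displaystyle \|(\mu*\nu)_H-(\mu_H*\nu_H)\|\le\int_H|\nu|(\tilde{y}H\cap H^c)\,d|\mu|(y)$. (3) If $\operatorname{supp}(\mu)\subseteq H$ and $\operatorname{supp}(\nu)\subseteq H$, then $(\mu*\nu)_H=\mu_H*\nu_H$. (4) If $K$ is a hypergroup and $H$ is a sub-hypergroup of $K$, then $(\mu*\nu)_H=\mu_H*\nu_H$ whenever $\operatorname{supp}(\mu)\subseteq H$.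
   Context: All topologies are Hausdorff. For a locally compact Hausdorff space $X$: $M(X)$ is the space of regular complex Borel measures on $X$ with total variation norm; $|\mu|$ is the total variation measure of $\mu$; $M^+(X)$ is the subset of finite non-negative measures; $p_x$ is the Dirac measure at $x$; $C_c^+(X)$ is the set of non-negative compactly supported continuous functions on $X$. The cone topology on $M^+(X)$ is the weakest topology making $\mu\mapsto\int_X f\,d\mu$ continuous for every $f\in C_c^+(X)\cup\{1_X\}$, where $1_X$ is the characteristic function of $X$. $\mathfrak{C}(X)$ is the set of compact subsets of $X$ with the Michael topology, generated by the sub-basis of sets $\{C\in\mathfrak{C}(X): C\cap U\neq\emptyset,\ C\subset V\}$, with $U,V$ open in $X$. Semitopological semihypergroup: a pair $(K,* )$ where (A1) $K$ is a locally compact Hausdorff space and $*$ is a binary operation on $M(K)$ making $(M(K),* )$ an associative algebra (so $*$ is bilinear); (A2$'$) $*$ is positive (it maps $M^+(K)\times M^+(K)$ into $M^+(K)$) and separately continuous on $M^+(K)\times M^+(K)$ for the cone topology; (A3) for all $x,y\in K$, $p_x*p_y$ is a probability measure with compact support; (A4$'$) the map $(x,y)\mapsto \operatorname{supp}(p_x*p_y)$ from $K\times K$ to $\mathfrak{C}(K)$ is separately continuous. It is a (topological) semihypergroup if in (A2$'$) and (A4$'$) separate continuity is replaced by joint continuity. For $A,B\subseteq K$, $A*B:=\bigcup_{x\in A,\,y\in B}\operatorname{supp}(p_x*p_y)$. A sub-semihypergroup of $K$ is a closed subset $H\subseteq K$ with $H*H\subseteq H$. Hypergroup: a (topological) semihypergroup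 $K$ with an element $e$ such that $p_x*p_e=p_e*p_x=p_x$ for all $x\in K$, and with a hypergroup involution $x\mapsto\tilde{x}$ such that $e\in\operatorname{supp}(p_x*p_y)$ if and only if $x=\tilde{y}$. Here a hypergroup involution is a homeomorphism $x\mapsto\tilde{x}$ of $K$ with $\tilde{\tilde{x}}=x$ and $(\mu*\nu)^{\sim}=\tilde{\nu}*\tilde{\mu}$ for all $\mu,\nu\in M(K)$, where $\tilde{\omega}(B)=\omega(\tilde{B})$ for $\omega\in M(K)$ and $B$ Borel, $\tilde B$ being the image of $B$ under the involution. A sub-hypergroup of a hypergroup $K$ is a closed subset $Q$ with $Q*Q\subseteq Q$ and $\tilde{Q}=Q$. Inverse sets: for $x\in K$ and $E\subseteq K$ Borel, in any semitopological semihypergroup $K$ (no involution is involved in this notation), $\tilde{x}E:=\{y\in K:(p_x*p_y)(E)>0\}$ and $E\tilde{x}:=\{y\in K:(p_y*p_x)(E)>0\}$. Restriction: for $E\subseteq K$ Borel and $\mu\in M(K)$, $\mu_E\in M(E)$ is the restriction, $\mu_E(B)=\mu(B)$ for Borel $B\subseteq E$. The sub-semihypergroup $H$ is itself regarded as a semitopological semihypergroup with the convolution inherited from $K$: for $\sigma,\tau\in M(H)$, $\sigma*\tau\in M(H)$ is determined by $\int_H f\,d(\sigma*\tau)=\int_H\int_H f(x*y)\,d\sigma(x)\,d\tau(y)$ for bounded continuous $f$ on $H$, where $f(x*y):=\int_H f\,d(p_x*p_y)$ for $x,y\in H$. The norms in the claim are total variation norms in $M(H)$. *)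

theory Defs
  imports "HOL-Analysis.Analysis"
begin

definition borel_of :: "'a topology \<Rightarrow> 'a measure" where
  "borel_of X = sigma (topspace X) {U. openin X U}"

text \<open>
  A complex Borel measure is represented by its set function, which is required to vanish on
  sets that are not Borel; thus two measures are equal as functions iff they agree on Borel sets.
\<close>

type_synonym 'a cmeas = "'a set \<Rightarrow> complex"

definition complex_borel_measure :: "'a topology \<Rightarrow> 'a cmeas \<Rightarrow> bool" where
  "complex_borel_measure X \<mu> \<longleftrightarrow>
     (\<forall>A. range A \<subseteq> sets (borel_of X) \<and> disjoint_family A \<longrightarrow>
        (\<lambda>n::nat. \<mu> (A n)) sums \<mu> (\<Union>n. A n)) \<and>
     (\<forall>B. B \<notin> sets (borel_of X) \<longrightarrow> \<mu> B = 0)"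

definition total_variation :: "'a topology \<Rightarrow> 'a cmeas \<Rightarrow> 'a measure" where
  "total_variation X \<mu> = measure_of (topspace X) {U. openin X U}
     (\<lambda>E. SUP A\<in>{A. range A \<subseteq> sets (borel_of X) \<and> disjoint_family A \<and> (\<Union>n. A n) = E}.
            (\<Sum>n::nat. ennreal (cmod (\<mu> (A n)))))"

definition tv_norm :: "'a topology \<Rightarrow> 'a cmeas \<Rightarrow> ennreal" where
  "tv_norm X \<mu> = emeasure (total_variation X \<mu>) (topspace X)"

definition regular_borel_measure :: "'a topology \<Rightarrow> 'a measure \<Rightarrow> bool" where
  "regular_borel_measure X M \<longleftrightarrow>
     (\<forall>E\<in>sets (borel_of X).
        emeasure M E = (INF U\<in>{U. openin X U \<and> E \<subseteq> U}. emeasure M U) \<and>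
        emeasure M E = (SUP C\<in>{C. compactin X C \<and> C \<subseteq> E}. emeasure M C))"

definition cmeasures :: "'a topology \<Rightarrow> 'a cmeas set" where
  "cmeasures X = {\<mu>. complex_borel_measure X \<mu> \<and> regular_borel_measure X (total_variation X \<mu>)}"

definition pos_measures :: "'a topology \<Rightarrow> 'a cmeas set" where
  "pos_measures X = {\<mu>\<in>cmeasures X. \<forall>B. \<mu> B \<in> nonneg_Reals}"

definition msupp :: "'a topology \<Rightarrow> 'a cmeas \<Rightarrow> 'a set" where
  "msupp X \<mu> = {x\<in>topspace X. \<forall>U. openin X U \<and> x \<in> U \<longrightarrow> 0 < emeasure (total_variation X \<mu>) U}"

definition dirac :: "'a topology \<Rightarrow> 'a \<Rightarrow> 'a cmeas" where
  "dirac X x = (\<lambda>B. if B \<in> sets (borel_of X) \<and> x \<in> B then 1 else 0)"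

definition mrestrict :: "'a topology \<Rightarrow> 'a set \<Rightarrow> 'a cmeas \<Rightarrow> 'a cmeas" where
  "mrestrict X E \<mu> = (\<lambda>B. if B \<in> sets (borel_of (subtopology X E)) then \<mu> B else 0)"

text \<open>
  \<open>var_part X c \<mu>\<close> is the positive part in the Jordan decomposition of the signed measure
  \<open>B \<mapsto> Re (c * \<mu> B)\<close>; negative values are truncated by \<open>ennreal\<close>, which is harmless as
  \<open>A = {}\<close> competes in the supremum. Hence
  \<open>\<mu> = var_part 1 - var_part (-1) + \<i> (var_part (-\<i>) - var_part \<i>)\<close>.
\<close>

definition var_part :: "'a topology \<Rightarrow> complex \<Rightarrow> 'a cmeas \<Rightarrow> 'a measure" where
  "var_part X c \<mu> = measure_of (topspace X) {U. openin X U}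
     (\<lambda>E. SUP A\<in>{A\<in>sets (borel_of X). A \<subseteq> E}. ennreal (Re (c * \<mu> A)))"

definition cintegral :: "'a topology \<Rightarrow> 'a cmeas \<Rightarrow> ('a \<Rightarrow> complex) \<Rightarrow> complex" where
  "cintegral X \<mu> f =
     (\<integral>x. f x \<partial>var_part X 1 \<mu>) - (\<integral>x. f x \<partial>var_part X (-1) \<mu>)
     + \<i> * ((\<integral>x. f x \<partial>var_part X (-\<i>) \<mu>) - (\<integral>x. f x \<partial>var_part X \<i> \<mu>))"

definition Cc_pos :: "'a topology \<Rightarrow> ('a \<Rightarrow> real) set" where
  "Cc_pos X = {f. continuous_map X euclideanreal f \<and> (\<forall>x\<in>topspace X. 0 \<le> f x) \<and>
                  compactin X (X closure_of {x\<in>topspace X. f x \<noteq> 0})}"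

definition cone_topology :: "'a topology \<Rightarrow> 'a cmeas topology" where
  "cone_topology X = topology_generated_by
     {{\<mu>\<in>pos_measures X. cintegral X \<mu> (\<lambda>x. complex_of_real (f x)) \<in> W} | f W.
        f \<in> insert (\<lambda>x. 1) (Cc_pos X) \<and> open W}"

text \<open>
  The set of all compact sets is added to the sub-basis because the empty set lies in none of the
  other members.
\<close>

definition michael_topology :: "'a topology \<Rightarrow> 'a set topology" where
  "michael_topology X = topology_generated_by
     (insert {C. compactin X C}
        {{C. compactin X C \<and> C \<inter> U \<noteq> {} \<and> C \<subseteq> V} | U V. openin X U \<and> openin X V})"

locale convolution_algebra =
  fixes X :: "'a topology"
    and conv :: "'a cmeas \<Rightarrow> 'a cmeas \<Rightarrow> 'a cmeas"  (infixl "\<star>" 70)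
  assumes locally_compact: "locally_compact_space X"
    and Hausdorff: "Hausdorff_space X"
    and closed: "\<lbrakk>\<mu> \<in> cmeasures X; \<nu> \<in> cmeasures X\<rbrakk> \<Longrightarrow> \<mu> \<star> \<nu> \<in> cmeasures X"
    and assoc: "\<lbrakk>\<mu> \<in> cmeasures X; \<nu> \<in> cmeasures X; \<rho> \<in> cmeasures X\<rbrakk>
                  \<Longrightarrow> (\<mu> \<star> \<nu>) \<star> \<rho> = \<mu> \<star> (\<nu> \<star> \<rho>)"
    and add_left: "\<lbrakk>\<mu> \<in> cmeasures X; \<nu> \<in> cmeasures X; \<rho> \<in> cmeasures X\<rbrakk>
                  \<Longrightarrow> (\<lambda>B. \<mu> B + \<nu> B) \<star> \<rho> = (\<lambda>B. (\<mu> \<star> \<rho>) B + (\<nu> \<star> \<rho>) B)"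
    and add_right: "\<lbrakk>\<mu> \<in> cmeasures X; \<nu> \<in> cmeasures X; \<rho> \<in> cmeasures X\<rbrakk>
                  \<Longrightarrow> \<rho> \<star> (\<lambda>B. \<mu> B + \<nu> B) = (\<lambda>B. (\<rho> \<star> \<mu>) B + (\<rho> \<star> \<nu>) B)"
    and scale_left: "\<lbrakk>\<mu> \<in> cmeasures X; \<nu> \<in> cmeasures X\<rbrakk>
                  \<Longrightarrow> (\<lambda>B. c * \<mu> B) \<star> \<nu> = (\<lambda>B. c * (\<mu> \<star> \<nu>) B)"
    and scale_right: "\<lbrakk>\<mu> \<in> cmeasures X; \<nu> \<in> cmeasures X\<rbrakk>
                  \<Longrightarrow> \<mu> \<star> (\<lambda>B. c * \<nu> B) = (\<lambda>B. c * (\<mu> \<star> \<nu>) B)"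
    and positive: "\<lbrakk>\<mu> \<in> pos_measures X; \<nu> \<in> pos_measures X\<rbrakk> \<Longrightarrow> \<mu> \<star> \<nu> \<in> pos_measures X"
    and dirac_probability: "\<lbrakk>x \<in> topspace X; y \<in> topspace X\<rbrakk>
                  \<Longrightarrow> dirac X x \<star> dirac X y \<in> pos_measures X
                      \<and> (dirac X x \<star> dirac X y) (topspace X) = 1"
    and dirac_compact_supp: "\<lbrakk>x \<in> topspace X; y \<in> topspace X\<rbrakk>
                  \<Longrightarrow> compactin X (msupp X (dirac X x \<star> dirac X y))"

locale semitopological_semihypergroup = convolution_algebra +
  assumes cone_continuous_left: "\<nu> \<in> pos_measures X
                  \<Longrightarrow> continuous_map (cone_topology X) (cone_topology X) (\<lambda>\<mu>. \<mu> \<star> \<nu>)"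
    and cone_continuous_right: "\<mu> \<in> pos_measures X
                  \<Longrightarrow> continuous_map (cone_topology X) (cone_topology X) (\<lambda>\<nu>. \<mu> \<star> \<nu>)"
    and supp_continuous_left: "y \<in> topspace X
                  \<Longrightarrow> continuous_map X (michael_topology X) (\<lambda>x. msupp X (dirac X x \<star> dirac X y))"
    and supp_continuous_right: "x \<in> topspace X
                  \<Longrightarrow> continuous_map X (michael_topology X) (\<lambda>y. msupp X (dirac X x \<star> dirac X y))"

locale semihypergroup = convolution_algebra +
  assumes cone_continuous:
      "continuous_map (prod_topology (cone_topology X) (cone_topology X)) (cone_topology X)
         (\<lambda>(\<mu>, \<nu>). \<mu> \<star> \<nu>)"
    and supp_continuous:
      "continuous_map (prod_topology X X) (michael_topology X)
         (\<lambda>(x, y). msupp X (dirac X x \<star> dirac X y))"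

definition minvol :: "'a topology \<Rightarrow> ('a \<Rightarrow> 'a) \<Rightarrow> 'a cmeas \<Rightarrow> 'a cmeas" where
  "minvol X invol \<omega> = (\<lambda>B. if B \<in> sets (borel_of X) then \<omega> (invol ` B) else 0)"

locale hypergroup = semihypergroup +
  fixes e :: 'a and invol :: "'a \<Rightarrow> 'a"
  assumes identity_in: "e \<in> topspace X"
    and identity_right: "x \<in> topspace X \<Longrightarrow> dirac X x \<star> dirac X e = dirac X x"
    and identity_left: "x \<in> topspace X \<Longrightarrow> dirac X e \<star> dirac X x = dirac X x"
    and invol_homeomorphism: "homeomorphic_map X X invol"
    and invol_invol: "x \<in> topspace X \<Longrightarrow> invol (invol x) = x"
    and invol_conv: "\<lbrakk>\<mu> \<in> cmeasures X; \<nu> \<in> cmeasures X\<rbrakk>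
                  \<Longrightarrow> minvol X invol (\<mu> \<star> \<nu>) = minvol X invol \<nu> \<star> minvol X invol \<mu>"
    and identity_in_supp_iff: "\<lbrakk>x \<in> topspace X; y \<in> topspace X\<rbrakk>
                  \<Longrightarrow> e \<in> msupp X (dirac X x \<star> dirac X y) \<longleftrightarrow> x = invol y"

definition set_conv ::
  "'a topology \<Rightarrow> ('a cmeas \<Rightarrow> 'a cmeas \<Rightarrow> 'a cmeas) \<Rightarrow> 'a set \<Rightarrow> 'a set \<Rightarrow> 'a set" where
  "set_conv X conv A B = (\<Union>x\<in>A. \<Union>y\<in>B. msupp X (conv (dirac X x) (dirac X y)))"

definition sub_semihypergroup ::
  "'a topology \<Rightarrow> ('a cmeas \<Rightarrow> 'a cmeas \<Rightarrow> 'a cmeas) \<Rightarrow> 'a set \<Rightarrow> bool" where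
  "sub_semihypergroup X conv H \<longleftrightarrow> closedin X H \<and> set_conv X conv H H \<subseteq> H"

definition sub_hypergroup ::
  "'a topology \<Rightarrow> ('a cmeas \<Rightarrow> 'a cmeas \<Rightarrow> 'a cmeas) \<Rightarrow> ('a \<Rightarrow> 'a) \<Rightarrow> 'a set \<Rightarrow> bool" where
  "sub_hypergroup X conv invol Q \<longleftrightarrow>
     closedin X Q \<and> set_conv X conv Q Q \<subseteq> Q \<and> invol ` Q = Q"

text \<open>
  \<open>left_inverse_set X conv x E\<close> is \<open>{y. (p\<^sub>x * p\<^sub>y)(E) > 0}\<close> and \<open>right_inverse_set X conv E x\<close>
  is \<open>{y. (p\<^sub>y * p\<^sub>x)(E) > 0}\<close>. Since these measures are non-negative, the condition on the
  complex value can be read off its real part.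
\<close>

definition left_inverse_set ::
  "'a topology \<Rightarrow> ('a cmeas \<Rightarrow> 'a cmeas \<Rightarrow> 'a cmeas) \<Rightarrow> 'a \<Rightarrow> 'a set \<Rightarrow> 'a set" where
  "left_inverse_set X conv x E = {y\<in>topspace X. 0 < Re (conv (dirac X x) (dirac X y) E)}"

definition right_inverse_set ::
  "'a topology \<Rightarrow> ('a cmeas \<Rightarrow> 'a cmeas \<Rightarrow> 'a cmeas) \<Rightarrow> 'a set \<Rightarrow> 'a \<Rightarrow> 'a set" where
  "right_inverse_set X conv E x = {y\<in>topspace X. 0 < Re (conv (dirac X y) (dirac X x) E)}"

text \<open>
  The convolution that a sub-semihypergroup \<open>H\<close> inherits; the inner integral
  \<open>f(x * y)\<close> is taken against \<open>p\<^sub>x * p\<^sub>y\<close> viewed as a measure on \<open>H\<close>.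
\<close>

definition sub_conv ::
  "'a topology \<Rightarrow> ('a cmeas \<Rightarrow> 'a cmeas \<Rightarrow> 'a cmeas) \<Rightarrow> 'a set \<Rightarrow> 'a cmeas \<Rightarrow> 'a cmeas \<Rightarrow> 'a cmeas" where
  "sub_conv X conv H \<sigma> \<tau> =
     (THE \<rho>. \<rho> \<in> cmeasures (subtopology X H) \<and>
       (\<forall>f. continuous_map (subtopology X H) euclidean f \<and> bounded (f ` H) \<longrightarrow>
          cintegral (subtopology X H) \<rho> f =
            cintegral (subtopology X H) \<tau> (\<lambda>y.
              cintegral (subtopology X H) \<sigma> (\<lambda>x.
                cintegral (subtopology X H) (mrestrict X H (conv (dirac X x) (dirac X y))) f))))"

end

theory Submission
  imports Defs
begin

text \<open>
  On regular measures convolution disintegrates over the point masses: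
  \<open>(\<mu> * \<nu>)(B) = \<integral>\<integral> (p\<^sub>x * p\<^sub>y)(B) d\<mu>(x) d\<nu>(y)\<close> for every Borel set \<open>B\<close>. Finitely supported measures are
  dense in the cone topology, so separate continuity gives this for integrals of functions in
  \<open>C\<^sub>c\<^sup>+\<close>; an open set is the directed supremum of such functions, and \<open>\<tau>\<close>-additivity of regular measures
  together with a Dynkin class argument extends it to Borel sets.

  Consequently \<open>\<mu>\<^sub>H * \<nu>\<^sub>H\<close> is the restriction to \<open>H\<close> of the convolution in \<open>K\<close> of the parts of \<open>\<mu>\<close> and \<open>\<nu>\<close>
  on \<open>H\<close>, and \<open>(\<mu> * \<nu>)\<^sub>H - \<mu>\<^sub>H * \<nu>\<^sub>H\<close> is the restriction of \<open>\<mu>|\<^sub>H * \<nu>|\<^sub>H\<^sub>c + \<mu>|\<^sub>H\<^sub>c * \<nu>\<close>. Each summand is bounded by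
  \<open>|\<alpha> * \<beta>| \<le> |\<alpha>| * |\<beta>|\<close> and \<open>(p\<^sub>x * p\<^sub>y)(H) \<le> 1\<close>, with value \<open>0\<close> off the inverse sets. In the hypergroup case
  \<open>supp(p\<^sub>x * p\<^sub>y)\<close> misses \<open>H\<close> for \<open>x \<in> H\<close> and \<open>y \<notin> H\<close>, so the bound in (2) vanishes.
\<close>

section \<open>Signed measures\<close>

text \<open>Three obstacles shape the argument. Continuity is only separate, so
  \<open>(x, y) \<mapsto> (p_x \<star> p_y)(B)\<close> is not known to be jointly measurable and
  iterated integrals cannot simply be exchanged; instead the same convolution is disintegrated along
  either factor, each time through a map of one variable. This is how one integral in (1) has
  \<open>y\<close> and the other has \<open>x\<close> as outer variable. Finally, the cone topology
  sees positive measures only, so complex measures enter through their four Jordan parts, and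
  estimates are stated for arbitrary dominating Radon measures, which spares computing the total
  variation of restrictions and convolutions.\<close>

lemma space_borel_of [simp]: "space (borel_of X) = topspace X"
  unfolding borel_of_def by (rule space_measure_of) (auto dest: openin_subset)

lemma openin_Pow: "{U. openin X U} \<subseteq> Pow (topspace X)"
  by (auto dest: openin_subset)

lemma sets_borel_of: "sets (borel_of X) = sigma_sets (topspace X) {U. openin X U}"
  unfolding borel_of_def by (rule sets_measure_of[OF openin_Pow])

lemma borel_of_open: "openin X U \<Longrightarrow> U \<in> sets (borel_of X)"
  by (auto simp: sets_borel_of)

lemma borel_of_closed: "closedin X C \<Longrightarrow> C \<in> sets (borel_of X)"
  by (metis borel_of_open closedin_def double_diff order_refl sets.compl_sets space_borel_of)

lemma borel_of_compact: "Hausdorff_space X \<Longrightarrow> compactin X C \<Longrightarrow> C \<in> sets (borel_of X)"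
  by (simp add: borel_of_closed compactin_imp_closedin)

lemma sets_borel_of_subtopology:
  assumes S: "S \<in> sets (borel_of X)"
  shows "B \<in> sets (borel_of (subtopology X S)) \<longleftrightarrow> B \<in> sets (borel_of X) \<and> B \<subseteq> S"
proof -
  have sub: "S \<subseteq> topspace X" using sets.sets_into_space[OF S] by simp
  have "(\<inter>) S ` {U. openin X U} = {U. openin (subtopology X S) U}"
    by (auto simp: openin_subtopology image_iff Int_commute)
  then have "sets (borel_of (subtopology X S)) = (\<inter>) S ` sets (borel_of X)"
    using sigma_sets_Int[of S "topspace X" "{U. openin X U}"] S sub
    by (simp add: sets_borel_of inf.absorb2)
  then show ?thesis using S by (auto simp: image_iff inf.absorb2)
qed

lemma borel_measurable_continuous_map:
  fixes f :: "'a \<Rightarrow> 'b::topological_space"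
  assumes "continuous_map X euclidean f"
  shows "f \<in> borel_measurable (borel_of X)"
proof (rule borel_measurableI)
  fix S :: "'b set" assume "open S"
  then have "openin X {x \<in> topspace X. f x \<in> S}"
    using assms by (simp add: openin_continuous_map_preimage)
  then show "f -` S \<inter> space (borel_of X) \<in> sets (borel_of X)"
    using borel_of_open by (simp add: vimage_def Int_def conj_commute)
qed

lemma emeasure_measure_of_borel_of:
  assumes "M = measure_of (topspace X) {U. openin X U} \<phi>"
    and "positive (sets (borel_of X)) \<phi>" "countably_additive (sets (borel_of X)) \<phi>"
  shows "sets M = sets (borel_of X)" "B \<in> sets (borel_of X) \<Longrightarrow> emeasure M B = \<phi> B"
proof -
  show *: "sets M = sets (borel_of X)"
    by (simp add: assms(1) sets_borel_of sets_measure_of[OF openin_Pow])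
  show "emeasure M B = \<phi> B" if "B \<in> sets (borel_of X)"
    using emeasure_measure_of[OF assms(1) openin_Pow] assms(2,3) that * by simp
qed

text \<open>Truncating negative terms to \<open>0\<close> only enlarges the partial sums, and the
  truncated partial sums stay below their series.\<close>

lemma ennreal_le_suminf_ennreal:
  fixes s :: "nat \<Rightarrow> real"
  assumes "s sums x"
  shows "ennreal x \<le> (\<Sum>n. ennreal (s n))"
proof (rule LIMSEQ_le_const2)
  show "(\<lambda>n. ennreal (\<Sum>i<n. s i)) \<longlonglongrightarrow> ennreal x"
    using assms by (intro tendsto_ennrealI) (simp add: sums_def)
  have "ennreal (\<Sum>i<n. s i) \<le> (\<Sum>n. ennreal (s n))" for n
  proof -
    have "ennreal (\<Sum>i<n. s i) \<le> ennreal (\<Sum>i<n. max 0 (s i))"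
      by (intro ennreal_leI sum_mono) simp
    also have "\<dots> = (\<Sum>i<n. ennreal (s i))"
      by (subst sum_ennreal[symmetric], simp, intro sum.cong) (auto simp: max_def ennreal_neg)
    also have "\<dots> \<le> (\<Sum>n. ennreal (s n))" by (intro sum_le_suminf) auto
    finally show ?thesis .
  qed
  then show "\<exists>N. \<forall>n\<ge>N. ennreal (\<Sum>i<n. s i) \<le> (\<Sum>n. ennreal (s n))" by blast
qed

locale signed_measure =
  fixes M :: "'a measure" and \<sigma> :: "'a set \<Rightarrow> real"
  assumes sums: "range A \<subseteq> sets M \<Longrightarrow> disjoint_family A \<Longrightarrow> (\<lambda>n. \<sigma> (A n)) sums \<sigma> (\<Union>n. A n)"
begin

text \<open>With \<open>\<sigma> A = Re (c * \<mu> A)\<close> this is the set function from which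
  \<open>var_part\<close> is built: the positive variation of \<open>\<sigma>\<close>.\<close>

definition upper :: "'a set \<Rightarrow> ennreal" where
  "upper E = (SUP A\<in>{A \<in> sets M. A \<subseteq> E}. ennreal (\<sigma> A))"

lemma empty [simp]: "\<sigma> {} = 0"
proof -
  have "(\<lambda>n::nat. \<sigma> {}) sums \<sigma> {}" using sums[of "\<lambda>n. {}"] by (simp add: disjoint_family_on_def)
  then have "summable (\<lambda>n::nat. \<sigma> {})" by (rule sums_summable)
  then show ?thesis by (simp add: summable_const_iff)
qed

lemma Un: 
  assumes "A \<in> sets M" "B \<in> sets M" "A \<inter> B = {}"
  shows "\<sigma> (A \<union> B) = \<sigma> A + \<sigma> B"
proof -
  have "(\<lambda>n. \<sigma> (binaryset A B n)) sums \<sigma> (\<Union>n. binaryset A B n)"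
    using assms by (intro sums) (auto simp: range_binaryset_eq disjoint_family_on_def binaryset_def)
  moreover have "(\<lambda>n. \<sigma> (binaryset A B n)) sums (\<sigma> A + \<sigma> B)"
    by (rule binaryset_sums) simp
  ultimately show ?thesis using sums_unique2 by (force simp: UN_binaryset_eq)
qed

lemma Diff:
  assumes "A \<in> sets M" "E \<in> sets M" "A \<subseteq> E"
  shows "\<sigma> (E - A) = \<sigma> E - \<sigma> A"
  using Un[of A "E - A"] assms by (auto simp: Un_absorb1 Diff_partition)

lemma upper_mono: "E \<subseteq> F \<Longrightarrow> upper E \<le> upper F"
  unfolding upper_def by (rule SUP_subset_mono) auto

lemma upper_ge: "A \<in> sets M \<Longrightarrow> A \<subseteq> E \<Longrightarrow> ennreal (\<sigma> A) \<le> upper E"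
  unfolding upper_def by (rule SUP_upper) auto

lemma upper_empty [simp]: "upper {} = 0"
  unfolding upper_def by (simp add: SUP_eq_const bot_ennreal cong: conj_cong)

lemma upper_superadditive:
  assumes "E \<in> sets M" "F \<in> sets M" "E \<inter> F = {}"
  shows "upper E + upper F \<le> upper (E \<union> F)"
proof -
  \<comment> \<open>\<open>ennreal\<close> is additive only on non-negative reals, so a competitor
    of negative value is first replaced by the empty set.\<close>
  have pos: "\<exists>B\<in>{A \<in> sets M. A \<subseteq> G}. 0 \<le> \<sigma> B \<and> ennreal (\<sigma> A) \<le> ennreal (\<sigma> B)"
    if "A \<in> {A \<in> sets M. A \<subseteq> G}" for A G
    using that by (cases "0 \<le> \<sigma> A") (auto intro: bexI[of _ A] bexI[of _ "{}"] simp: ennreal_neg)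
  have "ennreal (\<sigma> A) + ennreal (\<sigma> B) \<le> upper (E \<union> F)"
    if AB: "A \<in> {A \<in> sets M. A \<subseteq> E}" "B \<in> {A \<in> sets M. A \<subseteq> F}" for A B
  proof -
    obtain A' where A': "A' \<in> sets M" "A' \<subseteq> E" "0 \<le> \<sigma> A'" "ennreal (\<sigma> A) \<le> ennreal (\<sigma> A')"
      using pos[OF AB(1)] by auto
    obtain B' where B': "B' \<in> sets M" "B' \<subseteq> F" "0 \<le> \<sigma> B'" "ennreal (\<sigma> B) \<le> ennreal (\<sigma> B')"
      using pos[OF AB(2)] by auto
    have "ennreal (\<sigma> A) + ennreal (\<sigma> B) \<le> ennreal (\<sigma> A' + \<sigma> B')"
      using A' B' by (simp add: ennreal_plus add_mono)
    also have "\<sigma> A' + \<sigma> B' = \<sigma> (A' \<union> B')"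
      using A' B' assms(3) by (subst Un) auto
    also have "ennreal \<dots> \<le> upper (E \<union> F)" using A' B' by (intro upper_ge) auto
    finally show ?thesis .
  qed
  then have "(SUP A\<in>{A \<in> sets M. A \<subseteq> E}. SUP B\<in>{A \<in> sets M. A \<subseteq> F}. ennreal (\<sigma> A) + ennreal (\<sigma> B))
      \<le> upper (E \<union> F)"
    by (intro SUP_least)
  also have "(SUP A\<in>{A \<in> sets M. A \<subseteq> E}. SUP B\<in>{A \<in> sets M. A \<subseteq> F}. ennreal (\<sigma> A) + ennreal (\<sigma> B))
     = upper E + upper F"
    unfolding upper_def
    by (subst ennreal_SUP_add_right[symmetric]; (subst ennreal_SUP_add_left[symmetric])?) auto
  finally show ?thesis .
qed

lemma upper_countably_subadditive:
  assumes "range E \<subseteq> sets M" "disjoint_family E"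
  shows "upper (\<Union>n. E n) \<le> (\<Sum>n. upper (E n))"
  unfolding upper_def[of "\<Union>n. E n"]
proof (rule SUP_least)
  fix A assume A: "A \<in> {A \<in> sets M. A \<subseteq> (\<Union>n. E n)}"
  have "(\<lambda>n. \<sigma> (A \<inter> E n)) sums \<sigma> (\<Union>n. A \<inter> E n)"
    using assms A by (intro sums) (auto simp: disjoint_family_on_def)
  also have "(\<Union>n. A \<inter> E n) = A" using A by auto
  finally have "ennreal (\<sigma> A) \<le> (\<Sum>n. ennreal (\<sigma> (A \<inter> E n)))"
    by (rule ennreal_le_suminf_ennreal)
  also have "\<dots> \<le> (\<Sum>n. upper (E n))"
    using A assms by (intro suminf_le upper_ge) auto
  finally show "ennreal (\<sigma> A) \<le> (\<Sum>n. upper (E n))" .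
qed

end

text \<open>
  For set functions given by a supremum, countable additivity reduces to countable subadditivity and
  superadditivity on two sets.
\<close>

lemma countably_additiveI_superadditive:
  fixes P :: "'a set \<Rightarrow> ennreal"
  assumes mono: "\<And>E F. E \<in> sets M \<Longrightarrow> F \<in> sets M \<Longrightarrow> E \<subseteq> F \<Longrightarrow> P E \<le> P F"
    and super: "\<And>E F. E \<in> sets M \<Longrightarrow> F \<in> sets M \<Longrightarrow> E \<inter> F = {} \<Longrightarrow> P E + P F \<le> P (E \<union> F)"
    and sub: "\<And>E. range E \<subseteq> sets M \<Longrightarrow> disjoint_family E \<Longrightarrow> P (\<Union>n::nat. E n) \<le> (\<Sum>n. P (E n))"
  shows "countably_additive (sets M) P"
proof (rule countably_additiveI)
  fix E :: "nat \<Rightarrow> 'a set"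
  assume E: "range E \<subseteq> sets M" "disjoint_family E" "(\<Union>n. E n) \<in> sets M"
  have "(\<Sum>i<n. P (E i)) \<le> P (\<Union>i<n. E i)" for n
  proof (induction n)
    case (Suc n)
    have "(\<Sum>i<Suc n. P (E i)) \<le> P (\<Union>i<n. E i) + P (E n)" using Suc by (simp add: add_right_mono)
    also have "\<dots> \<le> P ((\<Union>i<n. E i) \<union> E n)"
      using E by (intro super) (auto simp: disjoint_family_on_def, metis IntI empty_iff less_irrefl)
    also have "(\<Union>i<n. E i) \<union> E n = (\<Union>i<Suc n. E i)" by (auto simp: less_Suc_eq)
    finally show ?case .
  qed simp
  also have "P (\<Union>i<n. E i) \<le> P (\<Union>n. E n)" for n
    using E by (intro mono) auto
  finally have "(\<Sum>n. P (E n)) \<le> P (\<Union>n. E n)" by (intro suminf_le_const) auto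
  with sub[OF E(1,2)] show "(\<Sum>n. P (E n)) = P (\<Union>n. E n)" by (rule antisym[rotated])
qed

context signed_measure
begin

lemma upper_measure: "positive (sets M) upper" "countably_additive (sets M) upper"
  by (auto simp: positive_def intro!: countably_additiveI_superadditive upper_mono upper_superadditive
      upper_countably_subadditive)

lemma upper_Un:
  assumes "A \<in> sets M" "B \<in> sets M" "A \<inter> B = {}"
  shows "upper (A \<union> B) = upper A + upper B"
  using sets.countably_additive_additive[OF upper_measure] assms unfolding additive_def by auto

text \<open>
  If \<open>upper E = \<infinity>\<close> then \<open>E\<close> splits into a piece of infinite upper variation and one with
  \<open>\<bar>\<sigma>\<bar> \<ge> 1\<close>; iterating gives a disjoint sequence along which \<open>\<sigma>\<close> is not summable.
\<close>

lemma upper_finite: "upper (space M) \<noteq> \<infinity>"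
proof
  assume inf: "upper (space M) = \<infinity>"
  have step: "\<exists>F. (F \<in> sets M \<and> upper F = \<infinity>) \<and> F \<subseteq> E \<and> 1 \<le> \<bar>\<sigma> (E - F)\<bar>"
    if E: "E \<in> sets M \<and> upper E = \<infinity>" for E
  proof -
    \<comment> \<open>The margin is chosen so that
      \<open>\<sigma> A > \<bar>\<sigma> E\<bar> + 1\<close> forces both
      \<open>\<sigma> A \<ge> 1\<close> and \<open>\<sigma> (E - A) \<le> -1\<close>; hence
      whichever of the two pieces has infinite upper variation may be kept.\<close>
    have "ennreal (\<bar>\<sigma> E\<bar> + 1) < upper E" using E by simp
    then obtain A where A: "A \<in> sets M" "A \<subseteq> E" "ennreal (\<bar>\<sigma> E\<bar> + 1) < ennreal (\<sigma> A)"
      unfolding upper_def less_SUP_iff by auto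
    then have a: "\<bar>\<sigma> E\<bar> + 1 < \<sigma> A" by (metis abs_ge_zero add_nonneg_nonneg ennreal_less_iff zero_le_one)
    have d: "\<sigma> (E - A) = \<sigma> E - \<sigma> A" using A E by (intro Diff) auto
    have "upper A + upper (E - A) = \<infinity>"
      using upper_Un[of A "E - A"] A E
      by (metis Diff_disjoint Diff_partition infinity_ennreal_def sets.Diff)
    then consider "upper A = \<infinity>" | "upper (E - A) = \<infinity>" by (metis ennreal_add_eq_top infinity_ennreal_def)
    then show ?thesis
    proof cases
      case 1 with a d A show ?thesis by (intro exI[of _ A]) auto
    next
      case 2
      have "E - (E - A) = A" using A by auto
      with 2 a A E show ?thesis by (intro exI[of _ "E - A"]) auto
    qed
  qed
  have start: "\<exists>E. E \<in> sets M \<and> upper E = \<infinity>" using inf by blast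
  obtain E where E: "\<And>n::nat. E n \<in> sets M \<and> upper (E n) = \<infinity>"
      "\<And>n. E (Suc n) \<subseteq> E n \<and> 1 \<le> \<bar>\<sigma> (E n - E (Suc n))\<bar>"
    using dependent_nat_choice[of "\<lambda>_ E. E \<in> sets M \<and> upper E = \<infinity>"
        "\<lambda>_ E F. F \<subseteq> E \<and> 1 \<le> \<bar>\<sigma> (E - F)\<bar>", OF start step] by blast
  have dec: "E n \<subseteq> E m" if "m \<le> n" for m n
    using that E(2) by (metis lift_Suc_antimono_le)
  have "disjoint_family (\<lambda>n. E n - E (Suc n))"
    unfolding disjoint_family_on_def
  proof (intro ballI impI)
    fix m n :: nat assume "m \<noteq> n"
    then consider "Suc m \<le> n" | "Suc n \<le> m" by linarith
    then show "(E m - E (Suc m)) \<inter> (E n - E (Suc n)) = {}" by cases (use dec in blast)+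
  qed
  moreover have "range (\<lambda>n. E n - E (Suc n)) \<subseteq> sets M" using E(1) by blast
  ultimately have "summable (\<lambda>n. \<sigma> (E n - E (Suc n)))"
    using sums[of "\<lambda>n. E n - E (Suc n)"] by (auto dest: sums_summable)
  then have "(\<lambda>n. \<bar>\<sigma> (E n - E (Suc n))\<bar>) \<longlonglongrightarrow> 0"
    by (intro tendsto_rabs_zero) (rule summable_LIMSEQ_zero)
  then have "1 \<le> (0::real)"
    by (rule LIMSEQ_le_const) (use E(2) in auto)
  then show False by simp
qed

lemma minus: "signed_measure M (\<lambda>A. - \<sigma> A)"
  by unfold_locales (use sums in \<open>auto intro: sums_minus\<close>)

text \<open>For \<open>A \<subseteq> E\<close> the identity
  \<open>\<sigma> A = \<sigma> E - \<sigma> (E - A)\<close> bounds \<open>\<sigma> A\<close> by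
  \<open>\<sigma> E\<close> plus the upper variation of \<open>- \<sigma>\<close> on
  \<open>E\<close>. The supremum over \<open>A\<close> gives one inequality, the same argument for
  \<open>- \<sigma>\<close> the other; \<open>upper_finite\<close> makes the difference
  meaningful.\<close>

lemma Jordan:
  assumes E: "E \<in> sets M"
  shows "\<sigma> E = enn2real (upper E) - enn2real (signed_measure.upper M (\<lambda>A. - \<sigma> A) E)"
proof -
  interpret m: signed_measure M "\<lambda>A. - \<sigma> A" by (rule minus)
  have fin: "upper E < top" "m.upper E < top"
    using upper_mono[of E "space M"] m.upper_mono[of E "space M"] upper_finite m.upper_finite
      sets.sets_into_space[OF E] by (auto simp: top.not_eq_extremum intro: le_less_trans)
  have 1: "\<sigma> A \<le> \<sigma> E + enn2real (m.upper E)" if "A \<in> sets M" "A \<subseteq> E" for A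
  proof -
    have "ennreal (- \<sigma> (E - A)) \<le> m.upper E" using that E by (intro m.upper_ge) auto
    then have "- \<sigma> (E - A) \<le> enn2real (m.upper E)"
      using fin by (cases "m.upper E") (auto simp: ennreal_le_iff2)
    then show ?thesis using Diff[OF that(1) E that(2)] by simp
  qed
  have 2: "- \<sigma> A \<le> - \<sigma> E + enn2real (upper E)" if "A \<in> sets M" "A \<subseteq> E" for A
  proof -
    have "ennreal (\<sigma> (E - A)) \<le> upper E" using that E by (intro upper_ge) auto
    then have "\<sigma> (E - A) \<le> enn2real (upper E)"
      using fin by (cases "upper E") (auto simp: ennreal_le_iff2)
    then show ?thesis using Diff[OF that(1) E that(2)] by simp
  qed
  have "upper E \<le> ennreal (\<sigma> E + enn2real (m.upper E))"
    unfolding upper_def using 1 by (intro SUP_least ennreal_leI) auto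
  \<comment> \<open>The case \<open>A = {}\<close> supplies the non-negativity of the bound, without
    which the truncation in \<open>ennreal\<close> would lose information.\<close>
  then have "enn2real (upper E) \<le> \<sigma> E + enn2real (m.upper E)"
    using 1[of "{}"] by (intro enn2real_leI) auto
  moreover have "m.upper E \<le> ennreal (- \<sigma> E + enn2real (upper E))"
    unfolding m.upper_def using 2 by (intro SUP_least ennreal_leI) auto
  then have "enn2real (m.upper E) \<le> - \<sigma> E + enn2real (upper E)"
    using 2[of "{}"] by (intro enn2real_leI) auto
  ultimately show ?thesis by simp
qed

end

section \<open>Total variation and Radon measures\<close>

lemma ennreal_norm_le_suminf:
  fixes s :: "nat \<Rightarrow> 'b::real_normed_vector"
  assumes "s sums x"
  shows "ennreal (norm x) \<le> (\<Sum>n. ennreal (norm (s n)))"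
proof (rule LIMSEQ_le_const2)
  show "(\<lambda>n. ennreal (norm (\<Sum>i<n. s i))) \<longlonglongrightarrow> ennreal (norm x)"
    using assms by (intro tendsto_ennrealI tendsto_norm) (simp add: sums_def)
  have "ennreal (norm (\<Sum>i<n. s i)) \<le> (\<Sum>n. ennreal (norm (s n)))" for n
  proof -
    have "ennreal (norm (\<Sum>i<n. s i)) \<le> ennreal (\<Sum>i<n. norm (s i))"
      by (intro ennreal_leI norm_sum)
    also have "\<dots> = (\<Sum>i<n. ennreal (norm (s i)))" by (subst sum_ennreal) auto
    also have "\<dots> \<le> (\<Sum>n. ennreal (norm (s n)))" by (intro sum_le_suminf) auto
    finally show ?thesis .
  qed
  then show "\<exists>N. \<forall>n\<ge>N. ennreal (norm (\<Sum>i<n. s i)) \<le> (\<Sum>n. ennreal (norm (s n)))" by blast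
qed

lemma suminf_swap_ennreal:
  fixes f :: "nat \<Rightarrow> nat \<Rightarrow> ennreal"
  shows "(\<Sum>i. \<Sum>j. f i j) = (\<Sum>j. \<Sum>i. f i j)"
  using nn_integral_suminf[of "\<lambda>j i. f i j" "count_space UNIV"]
  by (simp add: nn_integral_count_space_nat)

text \<open>Serves to merge two sequences of disjoint sets into one, placed at the even and the odd
  indices.\<close>

lemma suminf_ennreal_interleave_le:
  fixes c :: "nat \<Rightarrow> ennreal"
  shows "(\<Sum>n. c (2 * n)) + (\<Sum>n. c (2 * n + 1)) \<le> (\<Sum>n. c n)"
proof -
  have "(\<Sum>n. c (2 * n)) + (\<Sum>n. c (2 * n + 1)) = (\<Sum>n. c (2 * n) + c (2 * n + 1))"
    by (intro suminf_add) auto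
  also have "\<dots> \<le> (\<Sum>n. c n)"
  proof (rule suminf_le_const)
    fix N
    have "(\<Sum>n<N. c (2 * n) + c (2 * n + 1)) = (\<Sum>n<2 * N. c n)"
      by (induction N) (auto simp: add.assoc)
    also have "\<dots> \<le> (\<Sum>n. c n)" by (intro sum_le_suminf) auto
    finally show "(\<Sum>n<N. c (2 * n) + c (2 * n + 1)) \<le> (\<Sum>n. c n)" .
  qed simp
  finally show ?thesis .
qed

definition add_measure :: "'a measure \<Rightarrow> 'a measure \<Rightarrow> 'a measure" where
  "add_measure M N = measure_of (space M) (sets M) (\<lambda>A. emeasure M A + emeasure N A)"

lemma sets_add_measure [simp]: "sets (add_measure M N) = sets M"
  by (simp add: add_measure_def)

lemma emeasure_add_measure:
  assumes "sets N = sets M" "A \<in> sets M"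
  shows "emeasure (add_measure M N) A = emeasure M A + emeasure N A"
proof (rule emeasure_measure_of[OF add_measure_def])
  show "countably_additive (sets (add_measure M N)) (\<lambda>A. emeasure M A + emeasure N A)"
  proof (rule countably_additiveI)
    fix F :: "nat \<Rightarrow> 'a set"
    assume "range F \<subseteq> sets (add_measure M N)" "disjoint_family F"
    then show "(\<Sum>i. emeasure M (F i) + emeasure N (F i)) = emeasure M (\<Union>i. F i) + emeasure N (\<Union>i. F i)"
      using assms by (subst suminf_add[symmetric]) (auto simp: suminf_emeasure)
  qed
qed (use assms sets.sets_into_space in \<open>auto simp: positive_def\<close>)

lemma finite_add_measure:
  assumes "finite_measure M" "finite_measure N" "sets N = sets M"
  shows "finite_measure (add_measure M N)"
proof -
  have "space (add_measure M N) = space M" by (rule sets_eq_imp_space_eq) simp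
  with assms show ?thesis
    by (intro finite_measureI)
       (auto simp: emeasure_add_measure finite_measure.emeasure_finite)
qed

lemma measure_add_measure:
  assumes "finite_measure M" "finite_measure N" "sets N = sets M" "A \<in> sets M"
  shows "measure (add_measure M N) A = measure M A + measure N A"
  using assms by (auto simp: measure_def emeasure_add_measure enn2real_plus
      finite_measure.emeasure_finite top.not_eq_extremum[symmetric])

section \<open>Complex measures: Jordan parts and total variation\<close>

lemma complex_borel_measure_sums:
  assumes "complex_borel_measure X \<mu>" "range A \<subseteq> sets (borel_of X)" "disjoint_family A"
  shows "(\<lambda>n::nat. \<mu> (A n)) sums \<mu> (\<Union>n. A n)"
  using assms unfolding complex_borel_measure_def by blast

lemma complex_borel_measure_notin:
  "complex_borel_measure X \<mu> \<Longrightarrow> B \<notin> sets (borel_of X) \<Longrightarrow> \<mu> B = 0"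
  unfolding complex_borel_measure_def by blast

lemma signed_measure_Re:
  assumes "complex_borel_measure X \<mu>"
  shows "signed_measure (borel_of X) (\<lambda>A. Re (c * \<mu> A))"
  by unfold_locales (intro sums_Re sums_mult complex_borel_measure_sums[OF assms])

lemma complex_borel_measure_empty:
  assumes "complex_borel_measure X \<mu>" shows "\<mu> {} = 0"
  using signed_measure.empty[OF signed_measure_Re[OF assms, of 1]]
    signed_measure.empty[OF signed_measure_Re[OF assms, of "- \<i>"]]
  by (simp add: complex_eq_iff)

lemma complex_borel_measure_Un:
  assumes "complex_borel_measure X \<mu>" "A \<in> sets (borel_of X)" "B \<in> sets (borel_of X)" "A \<inter> B = {}"
  shows "\<mu> (A \<union> B) = \<mu> A + \<mu> B"
  using signed_measure.Un[OF signed_measure_Re[OF assms(1), of 1] assms(2-)]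
    signed_measure.Un[OF signed_measure_Re[OF assms(1), of "- \<i>"] assms(2-)]
  by (simp add: complex_eq_iff)

text \<open>\<open>measure_of\<close> returns the prescribed set function only if that function is a
  measure on the generated sigma-algebra; for the positive variation this is
  \<open>upper_measure\<close>.\<close>

lemma
  assumes "complex_borel_measure X \<mu>"
  shows sets_var_part: "sets (var_part X c \<mu>) = sets (borel_of X)"
    and emeasure_var_part: "B \<in> sets (borel_of X) \<Longrightarrow>
      emeasure (var_part X c \<mu>) B = (SUP A\<in>{A\<in>sets (borel_of X). A \<subseteq> B}. ennreal (Re (c * \<mu> A)))"
    and finite_var_part: "finite_measure (var_part X c \<mu>)"
proof -
  interpret signed_measure "borel_of X" "\<lambda>A. Re (c * \<mu> A)" by (rule signed_measure_Re[OF assms])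
  note * = emeasure_measure_of_borel_of[OF var_part_def, of X c \<mu>, folded upper_def, OF upper_measure]
  show "sets (var_part X c \<mu>) = sets (borel_of X)" by (rule *)
  then have sp: "space (var_part X c \<mu>) = space (borel_of X)" by (rule sets_eq_imp_space_eq)
  show "emeasure (var_part X c \<mu>) B = (SUP A\<in>{A\<in>sets (borel_of X). A \<subseteq> B}. ennreal (Re (c * \<mu> A)))"
    if "B \<in> sets (borel_of X)" for B using *(2)[OF that] unfolding upper_def .
  show "finite_measure (var_part X c \<mu>)"
    using upper_finite *(2)[OF sets.top] by (intro finite_measureI) (metis sp)
qed

lemma Re_eq_var_part_diff:
  assumes "complex_borel_measure X \<mu>" "B \<in> sets (borel_of X)"
  shows "Re (c * \<mu> B) = measure (var_part X c \<mu>) B - measure (var_part X (- c) \<mu>) B"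
proof -
  interpret signed_measure "borel_of X" "\<lambda>A. Re (c * \<mu> A)" by (rule signed_measure_Re[OF assms(1)])
  interpret m: signed_measure "borel_of X" "\<lambda>A. - Re (c * \<mu> A)" by (rule minus)
  have "upper B = emeasure (var_part X c \<mu>) B" "m.upper B = emeasure (var_part X (- c) \<mu>) B"
    using emeasure_var_part[OF assms, of c] emeasure_var_part[OF assms, of "- c"]
    unfolding upper_def m.upper_def by simp_all
  with Jordan[OF assms(2)] show ?thesis by (simp only: measure_def)
qed

lemma complex_measure_decomposition:
  assumes "complex_borel_measure X \<mu>" "B \<in> sets (borel_of X)"
  shows "\<mu> B = measure (var_part X 1 \<mu>) B - measure (var_part X (-1) \<mu>) B
    + \<i> * (measure (var_part X (-\<i>) \<mu>) B - measure (var_part X \<i> \<mu>) B)"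
  using Re_eq_var_part_diff[OF assms, of 1] Re_eq_var_part_diff[OF assms, of "-\<i>"]
  by (simp add: complex_eq_iff)

text \<open>Merging partitions of two disjoint sets makes the supremum over partitions
  superadditive; refining a partition of a union by the sets \<open>E k\<close> and exchanging the
  double series makes it countably subadditive. \<open>countably_additiveI_superadditive\<close>
  then applies.\<close>

lemma
  assumes \<mu>: "complex_borel_measure X \<mu>"
  shows sets_total_variation [simp]: "sets (total_variation X \<mu>) = sets (borel_of X)"
    and emeasure_total_variation: "B \<in> sets (borel_of X) \<Longrightarrow> emeasure (total_variation X \<mu>) B =
      (SUP A\<in>{A. range A \<subseteq> sets (borel_of X) \<and> disjoint_family A \<and> (\<Union>n. A n) = B}.
         (\<Sum>n::nat. ennreal (cmod (\<mu> (A n)))))"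
proof -
  define P where "P E = (SUP A\<in>{A. range A \<subseteq> sets (borel_of X) \<and> disjoint_family A \<and> (\<Union>n. A n) = E}.
    (\<Sum>n::nat. ennreal (cmod (\<mu> (A n)))))" for E
  let ?p = "\<lambda>E. {A. range A \<subseteq> sets (borel_of X) \<and> disjoint_family A \<and> (\<Union>n::nat. A n) = E}"
  have ne: "?p E \<noteq> {}" if "E \<in> sets (borel_of X)" for E
    using that by (auto simp: disjoint_family_on_def intro!: exI[of _ "\<lambda>n. if n = 0 then E else {}"] split: if_splits)
  have super: "P E + P F \<le> P (E \<union> F)"
    if E: "E \<in> sets (borel_of X)" "F \<in> sets (borel_of X)" "E \<inter> F = {}" for E F
  proof -
    have "(\<Sum>n. ennreal (cmod (\<mu> (A n)))) + (\<Sum>n. ennreal (cmod (\<mu> (B n)))) \<le> P (E \<union> F)"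
      if A: "A \<in> ?p E" and B: "B \<in> ?p F" for A B
    proof -
      define C where "C n = (if even n then A (n div 2) else B (n div 2))" for n
      have "(\<Sum>n. ennreal (cmod (\<mu> (A n)))) + (\<Sum>n. ennreal (cmod (\<mu> (B n))))
          \<le> (\<Sum>n. ennreal (cmod (\<mu> (C n))))"
        using suminf_ennreal_interleave_le[of "\<lambda>n. ennreal (cmod (\<mu> (C n)))"] by (simp add: C_def)
      also have "\<dots> \<le> P (E \<union> F)"
        unfolding P_def
      proof (rule SUP_upper, safe)
        show "C n \<in> sets (borel_of X)" for n using A B by (auto simp: C_def)
        have AB: "A i \<inter> B j = {}" for i j using A B E by auto
        have AA: "A i \<inter> A j = {}" "B i \<inter> B j = {}" if "i \<noteq> j" for i j
          using A B that by (auto simp: disjoint_family_on_def)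
        show "disjoint_family C"
          unfolding disjoint_family_on_def
        proof (intro ballI impI)
          fix m n :: nat assume "m \<noteq> n"
          then have "m div 2 \<noteq> n div 2 \<or> (even m \<noteq> even n)" by presburger
          then show "C m \<inter> C n = {}" using AB[of "m div 2" "n div 2"] AB[of "n div 2" "m div 2"]
              AA[of "m div 2" "n div 2"] by (auto simp: C_def)
        qed
        show "x \<in> E" if "x \<in> C n" "x \<notin> F" for x n
          using that A B by (auto simp: C_def split: if_splits)
        have "C (2 * n) = A n" "C (2 * n + 1) = B n" for n by (auto simp: C_def)
        then have "A n \<subseteq> \<Union> (range C)" "B n \<subseteq> \<Union> (range C)" for n by blast+
        then show "x \<in> \<Union> (range C)" if "x \<in> E" for x
          using that A by blast
        show "x \<in> \<Union> (range C)" if "x \<in> F" for x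
          using that B \<open>\<And>n. B n \<subseteq> \<Union> (range C)\<close> by blast
      qed
      finally show ?thesis .
    qed
    then have "(SUP A\<in>?p E. SUP B\<in>?p F. (\<Sum>n. ennreal (cmod (\<mu> (A n)))) + (\<Sum>n. ennreal (cmod (\<mu> (B n)))))
        \<le> P (E \<union> F)" by (intro SUP_least)
    also have "(SUP A\<in>?p E. SUP B\<in>?p F. (\<Sum>n. ennreal (cmod (\<mu> (A n)))) + (\<Sum>n. ennreal (cmod (\<mu> (B n)))))
       = P E + P F"
      unfolding P_def using ne[OF E(1)] ne[OF E(2)]
      by (simp add: ennreal_SUP_add_right[symmetric] ennreal_SUP_add_left)
    finally show ?thesis .
  qed
  have pos: "positive (sets (borel_of X)) P"
  proof -
    have "P {} \<le> 0"
      unfolding P_def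
    proof (rule SUP_least)
      fix A assume "A \<in> ?p {}"
      then have "A n = {}" for n by auto
      then show "(\<Sum>n. ennreal (cmod (\<mu> (A n)))) \<le> 0"
        using complex_borel_measure_empty[OF \<mu>] by simp
    qed
    then show ?thesis by (simp add: positive_def)
  qed
  have cadd: "countably_additive (sets (borel_of X)) P"
  proof (rule countably_additiveI_superadditive)
    fix E F assume E: "E \<in> sets (borel_of X)" "F \<in> sets (borel_of X)" "E \<subseteq> F"
    have "P E \<le> P E + P (F - E)" by simp
    also have "\<dots> \<le> P (E \<union> (F - E))" using E by (intro super) auto
    also have "E \<union> (F - E) = F" using E by auto
    finally show "P E \<le> P F" .
  next
    fix E :: "nat \<Rightarrow> 'a set" assume E: "range E \<subseteq> sets (borel_of X)" "disjoint_family E"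
    show "P (\<Union>n. E n) \<le> (\<Sum>n. P (E n))"
      unfolding P_def[of "\<Union>n. E n"]
    proof (rule SUP_least)
      fix A assume A: "A \<in> ?p (\<Union>n. E n)"
      have "ennreal (cmod (\<mu> (A n))) \<le> (\<Sum>k. ennreal (cmod (\<mu> (A n \<inter> E k))))" for n
      proof (rule ennreal_norm_le_suminf)
        have "(\<lambda>k. \<mu> (A n \<inter> E k)) sums \<mu> (\<Union>k. A n \<inter> E k)"
          using A E by (intro complex_borel_measure_sums[OF \<mu>]) (auto simp: disjoint_family_on_def)
        also have "(\<Union>k. A n \<inter> E k) = A n" using A by auto
        finally show "(\<lambda>k. \<mu> (A n \<inter> E k)) sums \<mu> (A n)" .
      qed
      then have "(\<Sum>n. ennreal (cmod (\<mu> (A n)))) \<le> (\<Sum>n. \<Sum>k. ennreal (cmod (\<mu> (A n \<inter> E k))))"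
        by (intro suminf_le) auto
      also have "\<dots> = (\<Sum>k. \<Sum>n. ennreal (cmod (\<mu> (A n \<inter> E k))))" by (rule suminf_swap_ennreal)
      also have "\<dots> \<le> (\<Sum>k. P (E k))"
      proof (intro suminf_le)
        fix k
        have "(\<lambda>n. A n \<inter> E k) \<in> ?p (E k)" using A E
          by (auto intro: disjoint_family_subset[of A])
        then show "(\<Sum>n. ennreal (cmod (\<mu> (A n \<inter> E k)))) \<le> P (E k)"
          unfolding P_def by (intro SUP_upper)
      qed auto
      finally show "(\<Sum>n. ennreal (cmod (\<mu> (A n)))) \<le> (\<Sum>n. P (E n))" .
    qed
  qed (rule super)
  note * = emeasure_measure_of_borel_of[OF total_variation_def, of X \<mu>, folded P_def, OF pos cadd]
  show "sets (total_variation X \<mu>) = sets (borel_of X)" by (rule *)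
  show "emeasure (total_variation X \<mu>) B = (SUP A\<in>?p B. (\<Sum>n. ennreal (cmod (\<mu> (A n)))))"
    if "B \<in> sets (borel_of X)" using *(2)[OF that] by (simp add: P_def)
qed

lemma emeasure_total_variation_ge:
  assumes "complex_borel_measure X \<mu>" "B \<in> sets (borel_of X)"
  shows "ennreal (cmod (\<mu> B)) \<le> emeasure (total_variation X \<mu>) B"
proof -
  let ?A = "\<lambda>n::nat. if n = 0 then B else {}"
  have "ennreal (cmod (\<mu> B)) = (\<Sum>n\<in>{0}. ennreal (cmod (\<mu> (?A n))))" by simp
  also have "\<dots> \<le> (\<Sum>n. ennreal (cmod (\<mu> (?A n))))" by (rule sum_le_suminf) auto
  also have "\<dots> \<le> emeasure (total_variation X \<mu>) B"
    unfolding emeasure_total_variation[OF assms]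
    using assms by (intro SUP_upper) (auto simp: disjoint_family_on_def split: if_splits)
  finally show ?thesis .
qed

text \<open>A dominating measure bounds every partition sum by its own countable additivity, so the
  total variation is the least dominating measure. The upper bounds for \<open>tv_norm\<close> below
  all rest on this.\<close>

lemma emeasure_total_variation_le:
  assumes "complex_borel_measure X \<mu>" "sets N = sets (borel_of X)"
    and "\<And>B. B \<in> sets (borel_of X) \<Longrightarrow> ennreal (cmod (\<mu> B)) \<le> emeasure N B"
    and "B \<in> sets (borel_of X)"
  shows "emeasure (total_variation X \<mu>) B \<le> emeasure N B"
  unfolding emeasure_total_variation[OF assms(1,4)]
proof (rule SUP_least, safe)
  fix A :: "nat \<Rightarrow> 'a set" assume A: "range A \<subseteq> sets (borel_of X)" "disjoint_family A" "B = (\<Union>n. A n)"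
  have "(\<Sum>n. ennreal (cmod (\<mu> (A n)))) \<le> (\<Sum>n. emeasure N (A n))"
    using A by (intro suminf_le assms(3)) auto
  also have "\<dots> = emeasure N (\<Union>n. A n)" using A assms(2) by (intro suminf_emeasure) auto
  finally show "(\<Sum>n. ennreal (cmod (\<mu> (A n)))) \<le> emeasure N (\<Union>n. A n)" .
qed

text \<open>The four variation parts are finite, and by
  \<open>cmod z \<le> \<bar>Re z\<bar> + \<bar>Im z\<bar>\<close> their sum dominates
  \<open>\<mu>\<close>.\<close>

lemma finite_total_variation:
  assumes \<mu>: "complex_borel_measure X \<mu>"
  shows "finite_measure (total_variation X \<mu>)"
proof -
  note fin = finite_var_part[OF \<mu>] and st = sets_var_part[OF \<mu>]
  let ?N1 = "add_measure (var_part X 1 \<mu>) (var_part X (-1) \<mu>)"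
  let ?N2 = "add_measure (var_part X (-\<i>) \<mu>) (var_part X \<i> \<mu>)"
  let ?N = "add_measure ?N1 ?N2"
  have f12: "finite_measure ?N1" "finite_measure ?N2" using fin st by (auto intro!: finite_add_measure)
  then have f: "finite_measure ?N" using st by (auto intro!: finite_add_measure)
  have s: "sets ?N = sets (borel_of X)" by (simp add: st)
  have "ennreal (cmod (\<mu> B)) \<le> emeasure ?N B" if B: "B \<in> sets (borel_of X)" for B
  proof -
    let ?m = "\<lambda>c. measure (var_part X c \<mu>) B"
    have "Re (\<mu> B) = ?m 1 - ?m (-1)" "Im (\<mu> B) = ?m (-\<i>) - ?m \<i>"
      using Re_eq_var_part_diff[OF \<mu> B, of 1] Re_eq_var_part_diff[OF \<mu> B, of "-\<i>"] by simp_all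
    moreover have "0 \<le> ?m 1" "0 \<le> ?m (-1)" "0 \<le> ?m (-\<i>)" "0 \<le> ?m \<i>" by simp_all
    moreover have "cmod (\<mu> B) \<le> \<bar>Re (\<mu> B)\<bar> + \<bar>Im (\<mu> B)\<bar>" by (rule cmod_le)
    ultimately have "cmod (\<mu> B) \<le> (?m 1 + ?m (-1)) + (?m (-\<i>) + ?m \<i>)" by linarith
    also have "\<dots> = measure ?N B"
      using B f12 fin st by (simp add: measure_add_measure)
    finally show ?thesis using f by (simp add: finite_measure.emeasure_eq_measure ennreal_leI)
  qed
  then have "emeasure (total_variation X \<mu>) (space (borel_of X)) \<le> emeasure ?N (space (borel_of X))"
    by (rule emeasure_total_variation_le[OF \<mu> s _ sets.top])
  moreover have "emeasure ?N (space (borel_of X)) < \<infinity>"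
    using finite_measure.emeasure_finite[OF f] by (simp add: top.not_eq_extremum)
  moreover have "space (total_variation X \<mu>) = space (borel_of X)"
    using \<mu> by (intro sets_eq_imp_space_eq) simp
  ultimately show ?thesis by (intro finite_measureI) (metis leD infinity_ennreal_def)
qed

text \<open>Inner regularity alone, in a form with \<open>\<epsilon>\<close> and real-valued masses
  that is easy to transfer between measures. On Hausdorff spaces \<open>radon_iff_regular\<close>
  identifies it with regularity of finite Borel measures.\<close>

definition radon :: "'a topology \<Rightarrow> 'a measure \<Rightarrow> bool" where
  "radon X M \<longleftrightarrow> finite_measure M \<and> sets M = sets (borel_of X) \<and>
     (\<forall>E\<in>sets (borel_of X). \<forall>\<epsilon>>0. \<exists>C. compactin X C \<and> C \<subseteq> E \<and> measure M (E - C) < \<epsilon>)"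

lemma
  assumes "radon X M"
  shows radon_finite: "finite_measure M" and radon_sets: "sets M = sets (borel_of X)"
    and radon_space: "space M = topspace X"
  using assms sets_eq_imp_space_eq[of M "borel_of X"] by (auto simp: radon_def)

lemma radon_inner:
  assumes "radon X M" "E \<in> sets (borel_of X)" "\<epsilon> > 0"
  obtains C where "compactin X C" "C \<subseteq> E" "measure M (E - C) < \<epsilon>"
  using assms unfolding radon_def by blast

text \<open>Outer regularity is inner regularity of the complement: a compact set in the complement
  of \<open>E\<close> is closed, so its own complement is open and contains
  \<open>E\<close>.\<close>

lemma radon_iff_regular:
  assumes X: "Hausdorff_space X"
  shows "radon X M \<longleftrightarrow> finite_measure M \<and> sets M = sets (borel_of X) \<and> regular_borel_measure X M"
proof (intro iffI conjI)
  assume M: "radon X M"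
  then interpret finite_measure M by (rule radon_finite)
  note st = radon_sets[OF M]
  show "finite_measure M" by (rule finite_measure_axioms)
  show "sets M = sets (borel_of X)" by (rule st)
  show "regular_borel_measure X M"
    unfolding regular_borel_measure_def
  proof (intro ballI conjI antisym)
    fix E assume E: "E \<in> sets (borel_of X)"
    show "emeasure M E \<le> (INF U\<in>{U. openin X U \<and> E \<subseteq> U}. emeasure M U)"
      using st by (intro INF_greatest emeasure_mono) (auto simp: borel_of_open)
    show "(SUP C\<in>{C. compactin X C \<and> C \<subseteq> E}. emeasure M C) \<le> emeasure M E"
      using st E by (intro SUP_least emeasure_mono) auto
    show "(INF U\<in>{U. openin X U \<and> E \<subseteq> U}. emeasure M U) \<le> emeasure M E"
    proof (rule ennreal_le_epsilon)
      fix e :: real assume "0 < e"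
      then obtain C where C: "compactin X C" "C \<subseteq> topspace X - E" "measure M (topspace X - E - C) < e"
        using radon_inner[OF M, of "topspace X - E" e] E sets.compl_sets[OF E] by auto
      let ?U = "topspace X - C"
      have U: "openin X ?U" "E \<subseteq> ?U"
        using compactin_imp_closedin[OF X C(1)] C(2) sets.sets_into_space[OF E] by auto
      then have Us: "?U \<in> sets M" using st by (auto simp: borel_of_open)
      have "(INF U\<in>{U. openin X U \<and> E \<subseteq> U}. emeasure M U) \<le> emeasure M ?U"
        using U by (intro INF_lower) auto
      also have "\<dots> = emeasure M (E \<union> (topspace X - E - C))" using U by (intro arg_cong2[of _ _ _ _ emeasure]) auto
      also have "\<dots> = emeasure M (E \<union> (?U - E))" by (intro arg_cong2[of _ _ _ _ emeasure]) auto
      also have "\<dots> \<le> emeasure M E + emeasure M (?U - E)"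
        using E Us st by (intro emeasure_subadditive) auto
      also have "?U - E = topspace X - E - C" by auto
      also have "emeasure M (topspace X - E - C) \<le> ennreal e"
        using C(3) \<open>0 < e\<close> by (simp add: emeasure_eq_measure ennreal_leI)
      finally show "(INF U\<in>{U. openin X U \<and> E \<subseteq> U}. emeasure M U) \<le> emeasure M E + ennreal e"
        by (simp add: add_left_mono)
    qed
    show "emeasure M E \<le> (SUP C\<in>{C. compactin X C \<and> C \<subseteq> E}. emeasure M C)"
    proof (rule ennreal_le_epsilon)
      fix e :: real assume "0 < e"
      then obtain C where C: "compactin X C" "C \<subseteq> E" "measure M (E - C) < e"
        using radon_inner[OF M E] by auto
      have Cs: "C \<in> sets M" using borel_of_compact[OF X C(1)] st by simp
      have "emeasure M E = emeasure M (C \<union> (E - C))" using C(2) by (simp add: Un_absorb1)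
      also have "\<dots> \<le> emeasure M C + emeasure M (E - C)"
        using E Cs st by (intro emeasure_subadditive) auto
      also have "\<dots> \<le> (SUP C\<in>{C. compactin X C \<and> C \<subseteq> E}. emeasure M C) + ennreal e"
        using C \<open>0 < e\<close> by (intro add_mono SUP_upper) (auto simp: emeasure_eq_measure ennreal_leI)
      finally show "emeasure M E \<le> (SUP C\<in>{C. compactin X C \<and> C \<subseteq> E}. emeasure M C) + ennreal e" .
    qed
  qed
next
  assume *: "finite_measure M \<and> sets M = sets (borel_of X) \<and> regular_borel_measure X M"
  then interpret finite_measure M by blast
  show "radon X M"
    unfolding radon_def
  proof (intro conjI ballI allI impI)
    fix E and \<epsilon> :: real assume E: "E \<in> sets (borel_of X)" and "\<epsilon> > 0"
    have "emeasure M E = (SUP C\<in>{C. compactin X C \<and> C \<subseteq> E}. emeasure M C)"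
      using * E unfolding regular_borel_measure_def by blast
    then have "\<exists>C\<in>{C. compactin X C \<and> C \<subseteq> E}. emeasure M E < emeasure M C + ennreal \<epsilon>"
      using \<open>\<epsilon> > 0\<close> emeasure_finite[of E] compactin_empty[of X]
      by (intro SUP_approx_ennreal) (simp_all, blast)
    then obtain C where C: "compactin X C" "C \<subseteq> E" "emeasure M E < emeasure M C + ennreal \<epsilon>" by auto
    have Cs: "C \<in> sets M" using borel_of_compact[OF X C(1)] * by simp
    have "measure M E < measure M C + \<epsilon>"
      using C(3) \<open>\<epsilon> > 0\<close> by (simp add: emeasure_eq_measure ennreal_less_iff flip: ennreal_plus)
    then show "\<exists>C. compactin X C \<and> C \<subseteq> E \<and> measure M (E - C) < \<epsilon>"
      using C Cs E * by (intro exI[of _ C]) (auto simp: finite_measure_Diff)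
  qed (use * in auto)
qed

text \<open>The compact set found for the larger measure serves the smaller one. Regularity of
  variation parts, of total variations and of measures cut down to a set is inherited in this
  way.\<close>

lemma radon_dominated:
  assumes X: "Hausdorff_space X" and M: "radon X M" and st: "sets N = sets (borel_of X)"
    and le: "\<And>B. B \<in> sets (borel_of X) \<Longrightarrow> emeasure N B \<le> emeasure M B"
  shows "radon X N"
proof -
  interpret M: finite_measure M using M by (rule radon_finite)
  have sp: "space N = topspace X" using sets_eq_imp_space_eq[OF st] by simp
  have "emeasure N (topspace X) \<noteq> \<infinity>"
    using le[of "topspace X"] M.emeasure_finite[of "topspace X"] sets.top[of "borel_of X"]
    by (auto simp: top_unique)
  then interpret N: finite_measure N by (intro finite_measureI) (simp add: sp)
  show ?thesis
    unfolding radon_def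
  proof (intro conjI ballI allI impI)
    fix E and \<epsilon> :: real assume E: "E \<in> sets (borel_of X)" and "\<epsilon> > 0"
    then obtain C where C: "compactin X C" "C \<subseteq> E" "measure M (E - C) < \<epsilon>"
      using radon_inner[OF M E] by blast
    have "emeasure N (E - C) \<le> emeasure M (E - C)"
      using borel_of_compact[OF X C(1)] E by (intro le) auto
    then have "measure N (E - C) \<le> measure M (E - C)"
      by (simp add: M.emeasure_eq_measure N.emeasure_eq_measure)
    with C show "\<exists>C. compactin X C \<and> C \<subseteq> E \<and> measure N (E - C) < \<epsilon>" by (intro exI[of _ C]) auto
  qed (use st N.finite_measure_axioms in auto)
qed

lemma radon_add_measure:
  assumes X: "Hausdorff_space X" and M: "radon X M" and N: "radon X N"
  shows "radon X (add_measure M N)"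
proof -
  interpret M: finite_measure M using M by (rule radon_finite)
  interpret N: finite_measure N using N by (rule radon_finite)
  note st = radon_sets[OF M] radon_sets[OF N]
  show ?thesis
    unfolding radon_def
  proof (intro conjI ballI allI impI)
    show "finite_measure (add_measure M N)"
      using st by (intro finite_add_measure M.finite_measure_axioms N.finite_measure_axioms) auto
    fix E and \<epsilon> :: real assume E: "E \<in> sets (borel_of X)" and "\<epsilon> > 0"
    then obtain C where C: "compactin X C" "C \<subseteq> E" "measure M (E - C) < \<epsilon> / 2"
      using radon_inner[OF M E, of "\<epsilon> / 2"] by auto
    obtain D where D: "compactin X D" "D \<subseteq> E" "measure N (E - D) < \<epsilon> / 2"
      using radon_inner[OF N E, of "\<epsilon> / 2"] \<open>\<epsilon> > 0\<close> by auto
    note CD = borel_of_compact[OF X C(1)] borel_of_compact[OF X D(1)]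
    have "measure M (E - (C \<union> D)) \<le> measure M (E - C)" "measure N (E - (C \<union> D)) \<le> measure N (E - D)"
      using CD E st by (auto intro!: M.finite_measure_mono N.finite_measure_mono)
    then have "measure (add_measure M N) (E - (C \<union> D)) < \<epsilon>"
      using C(3) D(3) CD E st
      by (simp add: measure_add_measure[OF M.finite_measure_axioms N.finite_measure_axioms])
    then show "\<exists>C. compactin X C \<and> C \<subseteq> E \<and> measure (add_measure M N) (E - C) < \<epsilon>"
      using C D by (intro exI[of _ "C \<union> D"]) (auto intro: compactin_Un)
  qed (use st in auto)
qed

section \<open>Regular complex measures and their integrals\<close>

lemma radon_total_variation:
  "Hausdorff_space X \<Longrightarrow> \<mu> \<in> cmeasures X \<Longrightarrow> radon X (total_variation X \<mu>)"
  by (simp add: cmeasures_def radon_iff_regular finite_total_variation)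

text \<open>Membership requires regularity of the total variation, which is rarely computable; any
  dominating Radon measure suffices because the total variation is the least one.\<close>

lemma cmeasures_dominated:
  assumes X: "Hausdorff_space X" and \<mu>: "complex_borel_measure X \<mu>" and M: "radon X M"
    and le: "\<And>B. B \<in> sets (borel_of X) \<Longrightarrow> cmod (\<mu> B) \<le> measure M B"
  shows "\<mu> \<in> cmeasures X"
proof -
  interpret finite_measure M using M by (rule radon_finite)
  have "emeasure (total_variation X \<mu>) B \<le> emeasure M B" if "B \<in> sets (borel_of X)" for B
    using le by (intro emeasure_total_variation_le[OF \<mu> radon_sets[OF M] _ that])
      (auto simp: emeasure_eq_measure intro: ennreal_leI)
  then have "radon X (total_variation X \<mu>)"
    by (intro radon_dominated[OF X M]) (use \<mu> in auto)
  then show ?thesis using \<mu> X by (simp add: cmeasures_def radon_iff_regular)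
qed

lemma cmeasures_complex_borel_measure: "\<mu> \<in> cmeasures X \<Longrightarrow> complex_borel_measure X \<mu>"
  by (simp add: cmeasures_def)

lemma cmod_le_total_variation:
  assumes "\<mu> \<in> cmeasures X" "B \<in> sets (borel_of X)"
  shows "cmod (\<mu> B) \<le> measure (total_variation X \<mu>) B"
proof -
  note \<mu> = cmeasures_complex_borel_measure[OF assms(1)]
  interpret finite_measure "total_variation X \<mu>" by (rule finite_total_variation[OF \<mu>])
  show ?thesis using emeasure_total_variation_ge[OF \<mu> assms(2)]
    by (simp add: emeasure_eq_measure)
qed

lemma complex_borel_measure_add:
  assumes "complex_borel_measure X \<mu>" "complex_borel_measure X \<nu>"
  shows "complex_borel_measure X (\<lambda>B. \<mu> B + \<nu> B)"
  using assms unfolding complex_borel_measure_def by (auto intro!: sums_add)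

lemma complex_borel_measure_scale:
  assumes "complex_borel_measure X \<mu>"
  shows "complex_borel_measure X (\<lambda>B. c * \<mu> B)"
  using assms unfolding complex_borel_measure_def by (auto intro!: sums_mult)

lemma cmeasures_add:
  assumes X: "Hausdorff_space X" and "\<mu> \<in> cmeasures X" "\<nu> \<in> cmeasures X"
  shows "(\<lambda>B. \<mu> B + \<nu> B) \<in> cmeasures X"
proof (rule cmeasures_dominated[OF X])
  note r = radon_total_variation[OF X assms(2)] radon_total_variation[OF X assms(3)]
  show "radon X (add_measure (total_variation X \<mu>) (total_variation X \<nu>))"
    by (intro radon_add_measure X r)
  show "complex_borel_measure X (\<lambda>B. \<mu> B + \<nu> B)"
    using assms by (intro complex_borel_measure_add cmeasures_complex_borel_measure)
  show "cmod (\<mu> B + \<nu> B) \<le> measure (add_measure (total_variation X \<mu>) (total_variation X \<nu>)) B"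
    if B: "B \<in> sets (borel_of X)" for B
    using cmod_le_total_variation[OF assms(2) B] cmod_le_total_variation[OF assms(3) B] B
    by (subst measure_add_measure) (use r in \<open>auto simp: radon_finite radon_sets intro: norm_triangle_le\<close>)
qed

lemma radon_scale_measure:
  assumes M: "radon X M" and "0 \<le> c"
  shows "radon X (scale_measure (ennreal c) M)"
proof -
  interpret M: finite_measure M using M by (rule radon_finite)
  have fin: "finite_measure (scale_measure (ennreal c) M)"
    by (intro finite_measureI) (simp add: ennreal_mult_eq_top_iff)
  show ?thesis
    unfolding radon_def
  proof (intro conjI ballI allI impI)
    fix E and \<epsilon> :: real assume E: "E \<in> sets (borel_of X)" and "\<epsilon> > 0"
    \<comment> \<open>Dividing by \<open>c + 1\<close> instead of \<open>c\<close> covers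
      \<open>c = 0\<close>.\<close>
    then obtain C where C: "compactin X C" "C \<subseteq> E" "measure M (E - C) < \<epsilon> / (c + 1)"
      using radon_inner[OF M E, of "\<epsilon> / (c + 1)"] \<open>0 \<le> c\<close> by auto
    have "c * measure M (E - C) \<le> (c + 1) * measure M (E - C)" by (simp add: algebra_simps)
    also have "\<dots> < \<epsilon>" using C(3) \<open>0 \<le> c\<close> by (simp add: field_simps)
    finally show "\<exists>C. compactin X C \<and> C \<subseteq> E \<and> measure (scale_measure (ennreal c) M) (E - C) < \<epsilon>"
      using C \<open>0 \<le> c\<close> by (intro exI[of _ C]) (simp add: measure_scale_measure)
  qed (use fin radon_sets[OF M] in auto)
qed

lemma cmeasures_scale:
  assumes X: "Hausdorff_space X" and "\<mu> \<in> cmeasures X"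
  shows "(\<lambda>B. c * \<mu> B) \<in> cmeasures X"
proof (rule cmeasures_dominated[OF X])
  note r = radon_total_variation[OF X assms(2)]
  show "radon X (scale_measure (ennreal (cmod c)) (total_variation X \<mu>))"
    by (intro radon_scale_measure r) simp
  show "complex_borel_measure X (\<lambda>B. c * \<mu> B)"
    using assms by (intro complex_borel_measure_scale cmeasures_complex_borel_measure)
  show "cmod (c * \<mu> B) \<le> measure (scale_measure (ennreal (cmod c)) (total_variation X \<mu>)) B"
    if B: "B \<in> sets (borel_of X)" for B
    using cmod_le_total_variation[OF assms(2) B]
    by (simp add: norm_mult mult_left_mono measure_scale_measure)
qed

text \<open>A left inverse of \<open>total_variation\<close> on positive measures.
  \<open>measure\<close> is \<open>0\<close> off the sigma-algebra, which matches the convention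
  that set functions vanish on sets that are not Borel.\<close>

definition cmeas_of :: "'a measure \<Rightarrow> 'a cmeas" where
  "cmeas_of M = (\<lambda>B. complex_of_real (measure M B))"

lemma complex_borel_measure_cmeas_of:
  assumes "finite_measure M" "sets M = sets (borel_of X)"
  shows "complex_borel_measure X (cmeas_of M)"
  unfolding complex_borel_measure_def cmeas_of_def
  using assms by (auto intro!: sums_of_real finite_measure.finite_measure_UNION simp: measure_notin_sets)

lemma cmeas_of_pos_measures:
  assumes X: "Hausdorff_space X" and M: "radon X M"
  shows "cmeas_of M \<in> pos_measures X"
proof -
  have "cmeas_of M \<in> cmeasures X"
    using radon_finite[OF M] radon_sets[OF M]
    by (intro cmeasures_dominated[OF X _ M] complex_borel_measure_cmeas_of) (auto simp: cmeas_of_def)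
  then show ?thesis by (simp add: pos_measures_def cmeas_of_def complex_nonneg_Reals_iff)
qed

lemma pos_measures_cmeasures: "\<mu> \<in> pos_measures X \<Longrightarrow> \<mu> \<in> cmeasures X"
  by (simp add: pos_measures_def)

text \<open>For non-negative values every partition sum already equals
  \<open>\<mu> B\<close>.\<close>

lemma emeasure_total_variation_pos:
  assumes "\<mu> \<in> pos_measures X" and B: "B \<in> sets (borel_of X)"
  shows "emeasure (total_variation X \<mu>) B = ennreal (Re (\<mu> B))"
proof -
  note \<mu> = cmeasures_complex_borel_measure[OF pos_measures_cmeasures[OF assms(1)]]
  have cm: "cmod (\<mu> A) = Re (\<mu> A)" "0 \<le> Re (\<mu> A)" for A
    using assms(1) by (auto simp: pos_measures_def complex_nonneg_Reals_iff cmod_eq_Re)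
  have "(\<Sum>n. ennreal (cmod (\<mu> (A n)))) = ennreal (Re (\<mu> B))"
    if "range A \<subseteq> sets (borel_of X)" "disjoint_family A" "(\<Union>n::nat. A n) = B" for A
    unfolding cm(1) using sums_Re[OF complex_borel_measure_sums[OF \<mu> that(1,2)]] that(3)
    by (intro suminf_ennreal_eq) (auto simp: cm)
  then have "emeasure (total_variation X \<mu>) B \<le> ennreal (Re (\<mu> B))"
    unfolding emeasure_total_variation[OF \<mu> B] by (intro SUP_least, safe) simp
  with emeasure_total_variation_ge[OF \<mu> B] show ?thesis by (simp add: cm antisym)
qed

lemma cmeas_of_total_variation:
  assumes "\<mu> \<in> pos_measures X"
  shows "cmeas_of (total_variation X \<mu>) = \<mu>"
proof
  note \<mu> = cmeasures_complex_borel_measure[OF pos_measures_cmeasures[OF assms]]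
  have cm: "0 \<le> Re (\<mu> A)" "Im (\<mu> A) = 0" for A
    using assms by (auto simp: pos_measures_def complex_nonneg_Reals_iff)
  fix B show "cmeas_of (total_variation X \<mu>) B = \<mu> B"
    using emeasure_total_variation_pos[OF assms, of B] complex_borel_measure_notin[OF \<mu>, of B]
    by (cases "B \<in> sets (borel_of X)")
       (auto simp: cmeas_of_def measure_def cm complex_eq_iff emeasure_notin_sets \<mu>)
qed

lemma pos_measures_add:
  assumes "Hausdorff_space X" "\<mu> \<in> pos_measures X" "\<nu> \<in> pos_measures X"
  shows "(\<lambda>B. \<mu> B + \<nu> B) \<in> pos_measures X"
  using assms by (auto simp: pos_measures_def cmeasures_add)

lemma pos_measures_scale:
  assumes "Hausdorff_space X" "\<mu> \<in> pos_measures X" "0 \<le> c"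
  shows "(\<lambda>B. complex_of_real c * \<mu> B) \<in> pos_measures X"
  using assms by (auto simp: pos_measures_def cmeasures_scale complex_nonneg_Reals_iff)

lemma radon_null_measure: "radon X (null_measure (borel_of X))"
  unfolding radon_def
  by (auto intro!: finite_measureI exI[of _ "{}"] simp: measure_def)

lemma pos_measures_zero:
  assumes "Hausdorff_space X" shows "(\<lambda>B. 0) \<in> pos_measures X"
  using cmeas_of_pos_measures[OF assms radon_null_measure] by (simp add: cmeas_of_def measure_def)

text \<open>The measure behind the set function \<open>dirac\<close>. As a push-forward from a
  one-point space it is a measure by construction, and \<open>cmeas_of_point_mass\<close> transfers
  regularity to \<open>dirac\<close>.\<close>

definition point_mass :: "'a topology \<Rightarrow> 'a \<Rightarrow> 'a measure" where
  "point_mass X y = distr (count_space (UNIV :: unit set)) (borel_of X) (\<lambda>_. y)"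

lemma emeasure_point_mass:
  assumes "y \<in> topspace X" "B \<in> sets (borel_of X)"
  shows "emeasure (point_mass X y) B = indicator B y"
proof -
  have "emeasure (point_mass X y) B = emeasure (count_space (UNIV :: unit set)) ((\<lambda>_. y) -` B)"
    unfolding point_mass_def using assms by (subst emeasure_distr) auto
  also have "\<dots> = indicator B y" by (cases "y \<in> B") (auto simp: UNIV_unit)
  finally show ?thesis .
qed

lemma radon_point_mass:
  assumes X: "Hausdorff_space X" and y: "y \<in> topspace X"
  shows "radon X (point_mass X y)"
  unfolding radon_def
proof (intro conjI ballI allI impI)
  have st: "sets (point_mass X y) = sets (borel_of X)" by (simp add: point_mass_def)
  then show "sets (point_mass X y) = sets (borel_of X)" .
  have sp: "space (point_mass X y) = topspace X" by (simp add: point_mass_def)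
  show "finite_measure (point_mass X y)"
    using y sets.top[of "borel_of X"] by (intro finite_measureI) (simp add: sp emeasure_point_mass)
  fix E and \<epsilon> :: real assume E: "E \<in> sets (borel_of X)" and "\<epsilon> > 0"
  have "E \<inter> {y} \<in> sets (borel_of X)"
    using borel_of_compact[OF X, of "{y}"] y E by (intro sets.Int) auto
  then have "measure (point_mass X y) (E - E \<inter> {y}) < \<epsilon>"
    using E y \<open>\<epsilon> > 0\<close> by (simp add: measure_def emeasure_point_mass)
  moreover have "compactin X (E \<inter> {y})" using y by (cases "y \<in> E") auto
  ultimately show "\<exists>C. compactin X C \<and> C \<subseteq> E \<and> measure (point_mass X y) (E - C) < \<epsilon>"
    by blast
qed

lemma cmeas_of_point_mass:
  assumes "y \<in> topspace X"
  shows "cmeas_of (point_mass X y) = dirac X y"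
proof
  fix B show "cmeas_of (point_mass X y) B = dirac X y B"
  proof (cases "B \<in> sets (borel_of X)")
    case True then show ?thesis
      using assms by (simp add: cmeas_of_def dirac_def measure_def emeasure_point_mass indicator_def)
  next
    case False then show ?thesis
      by (simp add: cmeas_of_def dirac_def measure_notin_sets point_mass_def)
  qed
qed

lemma dirac_pos_measures:
  "Hausdorff_space X \<Longrightarrow> y \<in> topspace X \<Longrightarrow> dirac X y \<in> pos_measures X"
  by (metis cmeas_of_point_mass cmeas_of_pos_measures radon_point_mass)

section \<open>Integration of bounded Borel functions against complex measures\<close>

definition bdd_borel :: "'a topology \<Rightarrow> ('a \<Rightarrow> complex) set" where
  "bdd_borel X = {f \<in> borel_measurable (borel_of X). \<exists>c. \<forall>x\<in>topspace X. cmod (f x) \<le> c}"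

lemma bdd_borelI:
  "f \<in> borel_measurable (borel_of X) \<Longrightarrow> (\<And>x. x \<in> topspace X \<Longrightarrow> cmod (f x) \<le> c) \<Longrightarrow> f \<in> bdd_borel X"
  unfolding bdd_borel_def by blast

lemma bdd_borel_measurable: "f \<in> bdd_borel X \<Longrightarrow> f \<in> borel_measurable (borel_of X)"
  unfolding bdd_borel_def by blast

lemma bdd_borel_integrable:
  assumes "f \<in> bdd_borel X" "finite_measure M" and st: "sets M = sets (borel_of X)"
  shows "integrable M f"
proof -
  obtain c where "\<And>x. x \<in> topspace X \<Longrightarrow> cmod (f x) \<le> c" using assms(1) unfolding bdd_borel_def by blast
  moreover have "space M = topspace X" using sets_eq_imp_space_eq[OF st] by simp
  ultimately show ?thesis
    using assms(2) bdd_borel_measurable[OF assms(1)]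
    by (intro finite_measure.integrable_const_bound[where B = c])
       (auto simp: measurable_cong_sets[OF st refl])
qed

lemma bdd_borel_simple:
  assumes "simple_function (borel_of X) s"
  shows "s \<in> bdd_borel X"
proof -
  have "finite (s ` topspace X)" using simple_functionD(1)[OF assms] by simp
  then have "bounded (s ` topspace X)" by (rule finite_imp_bounded)
  then show ?thesis
    using borel_measurable_simple_function[OF assms] by (auto simp: bdd_borel_def bounded_iff)
qed

lemma bdd_borel_approx:
  assumes "f \<in> bdd_borel X"
  obtains s c where "\<And>i::nat. simple_function (borel_of X) (s i)"
    "\<And>x. x \<in> topspace X \<Longrightarrow> (\<lambda>i. s i x) \<longlonglongrightarrow> f x"
    "\<And>i x. x \<in> topspace X \<Longrightarrow> cmod (s i x) \<le> c" "\<And>x. x \<in> topspace X \<Longrightarrow> cmod (f x) \<le> c"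
proof -
  obtain c where c: "\<And>x. x \<in> topspace X \<Longrightarrow> cmod (f x) \<le> c" using assms unfolding bdd_borel_def by blast
  obtain s where s: "\<And>i::nat. simple_function (borel_of X) (s i)"
    "\<And>x. x \<in> topspace X \<Longrightarrow> (\<lambda>i. s i x) \<longlonglongrightarrow> f x"
    "\<And>i x. x \<in> topspace X \<Longrightarrow> dist (s i x) 0 \<le> 2 * dist (f x) 0"
    using borel_measurable_implies_sequence_metric[OF bdd_borel_measurable[OF assms], of 0]
    unfolding space_borel_of by metis
  \<comment> \<open>The approximants may be twice as large as \<open>f\<close>, hence the doubled
    common bound.\<close>
  have "cmod (f x) \<le> 2 * c" if "x \<in> topspace X" for x
    using c[OF that] norm_ge_zero[of "f x"] by linarith
  moreover have "cmod (s i x) \<le> 2 * c" if "x \<in> topspace X" for i x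
    using s(3)[OF that, of i] c[OF that] by simp
  ultimately show thesis using that[OF s(1,2)] by blast
qed

text \<open>The outer function \<open>g\<close> lets one formula serve for \<open>s\<close> itself,
  for \<open>cmod\<close> of it, and for test functions evaluated at the nodes of a
  quadrature.\<close>

lemma integral_simple_function:
  fixes g :: "'b \<Rightarrow> 'c::{banach, second_countable_topology}"
  assumes "finite_measure M" and s: "simple_function M s"
  shows "(\<integral>x. g (s x) \<partial>M) = (\<Sum>v\<in>s ` space M. measure M {x\<in>space M. s x = v} *\<^sub>R g v)"
proof -
  interpret finite_measure M by fact
  let ?A = "\<lambda>v. {x\<in>space M. s x = v}"
  have fin: "finite (s ` space M)" by (rule simple_functionD[OF s])
  have A: "?A v \<in> sets M" for v
    using simple_functionD(2)[OF s, of "{v}"] by (simp add: vimage_def Int_def conj_commute)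
  have "(\<integral>x. g (s x) \<partial>M) = (\<integral>x. (\<Sum>v\<in>s ` space M. indicator (?A v) x *\<^sub>R g v) \<partial>M)"
  proof (rule Bochner_Integration.integral_cong)
    fix x assume x: "x \<in> space M"
    have "(\<Sum>v\<in>s ` space M. indicator (?A v) x *\<^sub>R g v) = (\<Sum>v\<in>s ` space M. if v = s x then g v else 0)"
      using x by (intro sum.cong) (auto simp: indicator_def)
    then show "g (s x) = (\<Sum>v\<in>s ` space M. indicator (?A v) x *\<^sub>R g v)" using fin x by simp
  qed simp
  also have "\<dots> = (\<Sum>v\<in>s ` space M. (\<integral>x. indicator (?A v) x *\<^sub>R g v \<partial>M))"
    using A by (intro Bochner_Integration.integral_sum integrable_scaleR_left)
      (auto simp: integrable_indicator_iff emeasure_eq_measure)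
  also have "\<dots> = (\<Sum>v\<in>s ` space M. measure M (?A v) *\<^sub>R g v)"
  proof (intro sum.cong refl)
    fix v
    have "integrable M (indicator (?A v) :: _ \<Rightarrow> real)"
      using A by (simp add: integrable_indicator_iff emeasure_eq_measure)
    then have "(\<integral>x. indicator (?A v) x *\<^sub>R g v \<partial>M) = (\<integral>x. indicator (?A v) x \<partial>M) *\<^sub>R g v" by simp
    also have "(\<integral>x. indicator (?A v) x \<partial>M) = measure M (?A v)"
      using A[of v] by (simp add: Int_absorb2)
    finally show "(\<integral>x. indicator (?A v) x *\<^sub>R g v \<partial>M) = measure M (?A v) *\<^sub>R g v" .
  qed
  finally show ?thesis .
qed

lemma integral_tendsto:
  fixes f :: "'a \<Rightarrow> 'b::{banach, second_countable_topology}"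
  assumes "finite_measure M" and st: "sets M = sets (borel_of X)"
    and "\<And>i. s i \<in> borel_measurable (borel_of X)" "f \<in> borel_measurable (borel_of X)"
    and "\<And>x. x \<in> topspace X \<Longrightarrow> (\<lambda>i. s i x) \<longlonglongrightarrow> f x"
    and "\<And>i x. x \<in> topspace X \<Longrightarrow> norm (s i x) \<le> c"
  shows "(\<lambda>i. \<integral>x. s i x \<partial>M) \<longlonglongrightarrow> (\<integral>x. f x \<partial>M)"
proof -
  interpret finite_measure M by fact
  have sp: "space M = topspace X" using sets_eq_imp_space_eq[OF st] by simp
  show ?thesis
    using assms by (intro integral_dominated_convergence[where w = "\<lambda>_. c"])
      (auto simp: measurable_cong_sets[OF st refl] sp)
qed

lemma cintegral_tendsto:
  assumes \<mu>: "complex_borel_measure X \<mu>"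
    and "\<And>i. s i \<in> borel_measurable (borel_of X)" "f \<in> borel_measurable (borel_of X)"
    and "\<And>x. x \<in> topspace X \<Longrightarrow> (\<lambda>i. s i x) \<longlonglongrightarrow> f x"
    and "\<And>i x. x \<in> topspace X \<Longrightarrow> cmod (s i x) \<le> c"
  shows "(\<lambda>i. cintegral X \<mu> (s i)) \<longlonglongrightarrow> cintegral X \<mu> f"
  unfolding cintegral_def
  by (intro tendsto_intros integral_tendsto[OF finite_var_part[OF \<mu>] sets_var_part[OF \<mu>] assms(2-)])

lemma cintegral_simple_function:
  assumes \<mu>: "complex_borel_measure X \<mu>" and s: "simple_function (borel_of X) s"
  shows "cintegral X \<mu> s = (\<Sum>v\<in>s ` topspace X. \<mu> {x\<in>topspace X. s x = v} * v)"
proof -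
  have sp: "space (var_part X c \<mu>) = topspace X" for c
    using sets_eq_imp_space_eq[OF sets_var_part[OF \<mu>]] by simp
  have "simple_function (var_part X c \<mu>) s" for c
    using s by (simp add: simple_function_def sp sets_var_part[OF \<mu>])
  then have *: "(\<integral>x. s x \<partial>var_part X c \<mu>)
      = (\<Sum>v\<in>s ` topspace X. measure (var_part X c \<mu>) {x\<in>topspace X. s x = v} *\<^sub>R v)" for c
    using integral_simple_function[OF finite_var_part[OF \<mu>], of c s "\<lambda>v. v"] by (simp add: sp)
  have A: "{x\<in>topspace X. s x = v} \<in> sets (borel_of X)" for v
    using simple_functionD(2)[OF s, of "{v}"] by (simp add: vimage_def Int_def conj_commute)
  show ?thesis
    unfolding cintegral_def * complex_measure_decomposition[OF \<mu> A]
    by (simp add: scaleR_conv_of_real algebra_simps sum.distrib sum_subtractf sum_distrib_left)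
qed

text \<open>\<open>cintegral\<close> is tied to the Jordan decomposition, which is not additive in
  \<open>\<mu>\<close>. On simple functions, however, it depends on the values of
  \<open>\<mu>\<close> only, so any representation of \<open>\<mu>\<close> by finite measures gives
  the same integral there, and dominated convergence extends this to bounded Borel
  functions.\<close>

lemma cintegral_linear_combination:
  fixes a :: "'b \<Rightarrow> complex"
  assumes \<mu>: "complex_borel_measure X \<mu>"
    and M: "\<And>i. i \<in> I \<Longrightarrow> finite_measure (M i)" "\<And>i. i \<in> I \<Longrightarrow> sets (M i) = sets (borel_of X)"
    and eq: "\<And>B. B \<in> sets (borel_of X) \<Longrightarrow> \<mu> B = (\<Sum>i\<in>I. a i * measure (M i) B)"
    and f: "f \<in> bdd_borel X"
  shows "cintegral X \<mu> f = (\<Sum>i\<in>I. a i * (\<integral>x. f x \<partial>M i))"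
proof -
  obtain s c where s: "\<And>i::nat. simple_function (borel_of X) (s i)"
    "\<And>x. x \<in> topspace X \<Longrightarrow> (\<lambda>i. s i x) \<longlonglongrightarrow> f x"
    "\<And>i x. x \<in> topspace X \<Longrightarrow> cmod (s i x) \<le> c"
    using bdd_borel_approx[OF f] by metis
  note meas = borel_measurable_simple_function[OF s(1)] bdd_borel_measurable[OF f]
  have sp: "space (M i) = topspace X" if "i \<in> I" for i
    using sets_eq_imp_space_eq[OF M(2)[OF that]] by simp
  have "cintegral X \<mu> (s n) = (\<Sum>i\<in>I. a i * (\<integral>x. s n x \<partial>M i))" for n
  proof -
    have A: "{x\<in>topspace X. s n x = v} \<in> sets (borel_of X)" for v
      using simple_functionD(2)[OF s(1)[of n], of "{v}"] by (simp add: vimage_def Int_def conj_commute)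
    have "simple_function (M i) (s n)" if "i \<in> I" for i
      using s(1)[of n] by (simp add: simple_function_def sp[OF that] M(2)[OF that])
    then have "(\<integral>x. s n x \<partial>M i) = (\<Sum>v\<in>s n ` topspace X. measure (M i) {x\<in>topspace X. s n x = v} *\<^sub>R v)"
      if "i \<in> I" for i
      using integral_simple_function[OF M(1)[OF that], of "s n" "\<lambda>v. v"] that by (simp add: sp[OF that])
    then have "(\<Sum>i\<in>I. a i * (\<integral>x. s n x \<partial>M i))
      = (\<Sum>i\<in>I. \<Sum>v\<in>s n ` topspace X. a i * (measure (M i) {x\<in>topspace X. s n x = v} * v))"
      by (simp add: sum_distrib_left scaleR_conv_of_real)
    also have "\<dots> = (\<Sum>v\<in>s n ` topspace X. \<Sum>i\<in>I. a i * (measure (M i) {x\<in>topspace X. s n x = v} * v))"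
      by (rule sum.swap)
    also have "\<dots> = cintegral X \<mu> (s n)"
      unfolding cintegral_simple_function[OF \<mu> s(1)] eq[OF A] sum_distrib_right
      by (simp only: mult.assoc)
    finally show ?thesis by simp
  qed
  moreover have "(\<lambda>n. cintegral X \<mu> (s n)) \<longlonglongrightarrow> cintegral X \<mu> f"
    by (rule cintegral_tendsto[OF \<mu> meas s(2,3)])
  moreover have "(\<lambda>n. \<Sum>i\<in>I. a i * (\<integral>x. s n x \<partial>M i)) \<longlonglongrightarrow> (\<Sum>i\<in>I. a i * (\<integral>x. f x \<partial>M i))"
    by (intro tendsto_sum tendsto_mult_left integral_tendsto[OF M meas s(2,3)])
  ultimately show ?thesis by (auto dest: LIMSEQ_unique)
qed

lemma cintegral_cmeas_of:
  assumes "finite_measure M" "sets M = sets (borel_of X)" "f \<in> bdd_borel X"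
  shows "cintegral X (cmeas_of M) f = (\<integral>x. f x \<partial>M)"
  using cintegral_linear_combination[OF complex_borel_measure_cmeas_of[OF assms(1,2)],
      of "{()}" "\<lambda>_. M" "\<lambda>_. 1" f] assms
  by (simp add: cmeas_of_def)

lemma norm_cintegral_le:
  assumes \<mu>: "complex_borel_measure X \<mu>"
    and M: "finite_measure M" "sets M = sets (borel_of X)"
    and le: "\<And>B. B \<in> sets (borel_of X) \<Longrightarrow> cmod (\<mu> B) \<le> measure M B"
    and f: "f \<in> bdd_borel X"
  shows "cmod (cintegral X \<mu> f) \<le> (\<integral>x. cmod (f x) \<partial>M)"
proof -
  obtain s c where s: "\<And>i::nat. simple_function (borel_of X) (s i)"
    "\<And>x. x \<in> topspace X \<Longrightarrow> (\<lambda>i. s i x) \<longlonglongrightarrow> f x"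
    "\<And>i x. x \<in> topspace X \<Longrightarrow> cmod (s i x) \<le> c"
    using bdd_borel_approx[OF f] by metis
  note meas = borel_measurable_simple_function[OF s(1)] bdd_borel_measurable[OF f]
  have sp: "space M = topspace X" using sets_eq_imp_space_eq[OF M(2)] by simp
  have "cmod (cintegral X \<mu> (s n)) \<le> (\<integral>x. cmod (s n x) \<partial>M)" for n
  proof -
    have A: "{x\<in>topspace X. s n x = v} \<in> sets (borel_of X)" for v
      using simple_functionD(2)[OF s(1)[of n], of "{v}"] by (simp add: vimage_def Int_def conj_commute)
    have sn: "simple_function M (s n)" using s(1)[of n] by (simp add: simple_function_def sp M(2))
    have "cmod (cintegral X \<mu> (s n)) \<le> (\<Sum>v\<in>s n ` topspace X. cmod (\<mu> {x\<in>topspace X. s n x = v} * v))"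
      unfolding cintegral_simple_function[OF \<mu> s(1)] by (rule norm_sum)
    also have "\<dots> \<le> (\<Sum>v\<in>s n ` topspace X. measure M {x\<in>topspace X. s n x = v} * cmod v)"
      by (intro sum_mono) (simp add: norm_mult mult_right_mono le[OF A])
    also have "\<dots> = (\<integral>x. cmod (s n x) \<partial>M)"
      using integral_simple_function[OF M(1) sn, of cmod] by (simp add: sp)
    finally show ?thesis .
  qed
  moreover have "(\<lambda>n. cmod (cintegral X \<mu> (s n))) \<longlonglongrightarrow> cmod (cintegral X \<mu> f)"
    by (intro tendsto_norm cintegral_tendsto[OF \<mu> meas s(2,3)])
  moreover have "(\<lambda>n. (\<integral>x. cmod (s n x) \<partial>M)) \<longlonglongrightarrow> (\<integral>x. cmod (f x) \<partial>M)"
    using meas s by (intro integral_tendsto[OF M]) (auto intro: tendsto_norm)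
  ultimately show ?thesis by (auto intro: LIMSEQ_le)
qed

text \<open>A mixture formula known on Borel sets passes to simple functions by linearity and to
  bounded Borel functions by dominated convergence, used once under each \<open>k y\<close> and once
  under \<open>N\<close>; the common mass bound \<open>d\<close> makes the second use
  legitimate.\<close>

lemma integral_mixture:
  assumes N: "finite_measure N" "sets N = sets (borel_of X)"
    and R: "finite_measure R" "sets R = sets (borel_of Y)"
    and k: "\<And>y. y \<in> topspace X \<Longrightarrow> finite_measure (k y)"
      "\<And>y. y \<in> topspace X \<Longrightarrow> sets (k y) = sets (borel_of Y)"
      "\<And>y. y \<in> topspace X \<Longrightarrow> measure (k y) (topspace Y) \<le> d"
      "\<And>B. B \<in> sets (borel_of Y) \<Longrightarrow> (\<lambda>y. measure (k y) B) \<in> borel_measurable (borel_of X)"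
    and eq: "\<And>B. B \<in> sets (borel_of Y) \<Longrightarrow> measure R B = (\<integral>y. measure (k y) B \<partial>N)"
    and f: "f \<in> bdd_borel Y"
  shows "(\<lambda>y. \<integral>x. f x \<partial>k y) \<in> bdd_borel X"
    and "(\<integral>x. f x \<partial>R) = (\<integral>y. \<integral>x. f x \<partial>k y \<partial>N)"
proof -
  obtain s c where s: "\<And>i::nat. simple_function (borel_of Y) (s i)"
    "\<And>x. x \<in> topspace Y \<Longrightarrow> (\<lambda>i. s i x) \<longlonglongrightarrow> f x"
    "\<And>i x. x \<in> topspace Y \<Longrightarrow> cmod (s i x) \<le> c" "\<And>x. x \<in> topspace Y \<Longrightarrow> cmod (f x) \<le> c"
    using bdd_borel_approx[OF f] by metis
  note meas = borel_measurable_simple_function[OF s(1)] bdd_borel_measurable[OF f]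
  have spN: "space N = topspace X" and spR: "space R = topspace Y"
    using sets_eq_imp_space_eq[OF N(2)] sets_eq_imp_space_eq[OF R(2)] by simp_all
  have spk: "space (k y) = topspace Y" if "y \<in> topspace X" for y
    using sets_eq_imp_space_eq[OF k(2)[OF that]] by simp
  have A: "{x\<in>topspace Y. s n x = v} \<in> sets (borel_of Y)" for n v
    using simple_functionD(2)[OF s(1)[of n], of "{v}"] by (simp add: vimage_def Int_def conj_commute)
  have sk: "(\<integral>x. s n x \<partial>k y) = (\<Sum>v\<in>s n ` topspace Y. measure (k y) {x\<in>topspace Y. s n x = v} *\<^sub>R v)"
    if "y \<in> topspace X" for y n
  proof -
    have "simple_function (k y) (s n)"
      using s(1)[of n] by (simp add: simple_function_def spk[OF that] k(2)[OF that])
    then show ?thesis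
      using integral_simple_function[OF k(1)[OF that], of "s n" "\<lambda>v. v"] by (simp add: spk[OF that])
  qed
  \<comment> \<open>\<open>c\<close> bounds norms only on \<open>topspace Y\<close> and could be
    negative if that set is empty, hence \<open>max 0 c\<close>.\<close>
  have bound: "cmod (\<integral>x. g x \<partial>k y) \<le> max 0 c * d"
    if y: "y \<in> topspace X" and g: "g \<in> bdd_borel Y" "\<And>x. x \<in> topspace Y \<Longrightarrow> cmod (g x) \<le> c" for y g
  proof -
    interpret k: finite_measure "k y" by (rule k(1)[OF y])
    have "cmod (\<integral>x. g x \<partial>k y) \<le> (\<integral>x. cmod (g x) \<partial>k y)" by (rule integral_norm_bound)
    also have "\<dots> \<le> (\<integral>x. max 0 c \<partial>k y)"
      using g bdd_borel_integrable[OF g(1) k(1,2)[OF y]]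
      by (intro integral_mono) (auto simp: spk[OF y] max.coboundedI2)
    also have "\<dots> = measure (k y) (topspace Y) * max 0 c" by (simp add: spk[OF y])
    also have "\<dots> \<le> max 0 c * d"
      unfolding mult.commute[of _ "max 0 c"] by (intro mult_left_mono k(3)[OF y]) simp
    finally show ?thesis .
  qed
  have sm: "(\<lambda>y. \<integral>x. s n x \<partial>k y) \<in> borel_measurable (borel_of X)" for n
    by (subst measurable_cong[OF sk]) (auto intro!: borel_measurable_sum borel_measurable_scaleR k(4) A)
  have lim: "(\<lambda>n. \<integral>x. s n x \<partial>k y) \<longlonglongrightarrow> (\<integral>x. f x \<partial>k y)" if "y \<in> topspace X" for y
    by (rule integral_tendsto[OF k(1,2)[OF that] meas s(2,3)])
  have fm: "(\<lambda>y. \<integral>x. f x \<partial>k y) \<in> borel_measurable (borel_of X)"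
    by (rule borel_measurable_LIMSEQ_metric[OF sm]) (use lim in auto)
  show "(\<lambda>y. \<integral>x. f x \<partial>k y) \<in> bdd_borel X"
    by (rule bdd_borelI[OF fm bound[OF _ f s(4)]])
  have "(\<integral>x. s n x \<partial>R) = (\<integral>y. \<integral>x. s n x \<partial>k y \<partial>N)" for n
  proof -
    interpret N: finite_measure N by fact
    have int: "integrable N (\<lambda>y. measure (k y) {x\<in>topspace Y. s n x = v})" for v
    proof -
      have "measure (k y) {x\<in>topspace Y. s n x = v} \<le> d" if y: "y \<in> topspace X" for y
      proof -
        have "measure (k y) {x\<in>topspace Y. s n x = v} \<le> measure (k y) (topspace Y)"
          using k(2)[OF y] spk[OF y] sets.top[of "k y"]
          by (intro finite_measure.finite_measure_mono[OF k(1)[OF y]]) auto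
        with k(3)[OF y] show ?thesis by simp
      qed
      then show ?thesis
        using k(4)[OF A]
        by (intro N.integrable_const_bound[where B = d])
           (auto simp: spN measurable_cong_sets[OF N(2) refl])
    qed
    have "simple_function R (s n)" using s(1)[of n] by (simp add: simple_function_def spR R(2))
    then have "(\<integral>x. s n x \<partial>R) = (\<Sum>v\<in>s n ` topspace Y. (\<integral>y. measure (k y) {x\<in>topspace Y. s n x = v} \<partial>N) *\<^sub>R v)"
      using integral_simple_function[OF R(1), of "s n" "\<lambda>v. v"] by (simp add: spR eq[OF A])
    also have "\<dots> = (\<Sum>v\<in>s n ` topspace Y. (\<integral>y. measure (k y) {x\<in>topspace Y. s n x = v} *\<^sub>R v \<partial>N))"
      using int by simp
    also have "\<dots> = (\<integral>y. (\<Sum>v\<in>s n ` topspace Y. measure (k y) {x\<in>topspace Y. s n x = v} *\<^sub>R v) \<partial>N)"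
      by (intro Bochner_Integration.integral_sum[symmetric] integrable_scaleR_left int)
    also have "\<dots> = (\<integral>y. \<integral>x. s n x \<partial>k y \<partial>N)"
      by (intro Bochner_Integration.integral_cong) (auto simp: sk spN)
    finally show ?thesis .
  qed
  moreover have "(\<lambda>n. \<integral>x. s n x \<partial>R) \<longlonglongrightarrow> (\<integral>x. f x \<partial>R)"
    by (rule integral_tendsto[OF R meas s(2,3)])
  moreover have "(\<lambda>n. \<integral>y. \<integral>x. s n x \<partial>k y \<partial>N) \<longlonglongrightarrow> (\<integral>y. \<integral>x. f x \<partial>k y \<partial>N)"
    by (rule integral_tendsto[OF N sm fm lim bound[OF _ bdd_borel_simple[OF s(1)] s(3)]])
  ultimately show "(\<integral>x. f x \<partial>R) = (\<integral>y. \<integral>x. f x \<partial>k y \<partial>N)" by (auto dest: LIMSEQ_unique)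
qed

section \<open>The cone topology\<close>

lemma pos_measures_integral:
  fixes f :: "'a \<Rightarrow> real"
  assumes X: "Hausdorff_space X" and \<mu>: "\<mu> \<in> pos_measures X" and f: "(\<lambda>x. complex_of_real (f x)) \<in> bdd_borel X"
  shows "cintegral X \<mu> (\<lambda>x. complex_of_real (f x)) = complex_of_real (\<integral>x. f x \<partial>total_variation X \<mu>)"
proof -
  note r = radon_total_variation[OF X pos_measures_cmeasures[OF \<mu>]]
  show ?thesis
    using cintegral_cmeas_of[OF radon_finite[OF r] radon_sets[OF r] f]
    by (simp add: cmeas_of_total_variation[OF \<mu>])
qed

definition test_functions :: "'a topology \<Rightarrow> ('a \<Rightarrow> real) set" where
  "test_functions X = insert (\<lambda>x. 1) (Cc_pos X)"

lemma test_functions_continuous: "f \<in> test_functions X \<Longrightarrow> continuous_map X euclideanreal f"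
  by (auto simp: test_functions_def Cc_pos_def)

lemma test_functions_bounded:
  assumes "f \<in> test_functions X"
  obtains c where "\<And>x. x \<in> topspace X \<Longrightarrow> \<bar>f x\<bar> \<le> c"
proof (cases "f = (\<lambda>x. 1)")
  case False
  then have f: "f \<in> Cc_pos X" using assms by (simp add: test_functions_def)
  let ?K = "X closure_of {x\<in>topspace X. f x \<noteq> 0}"
  have "compactin euclideanreal (f ` ?K)"
    using f by (intro image_compactin) (auto simp: Cc_pos_def)
  then have "bounded (f ` ?K)" by (simp add: compact_imp_bounded)
  then obtain c where c: "\<And>x. x \<in> ?K \<Longrightarrow> \<bar>f x\<bar> \<le> c" by (auto simp: bounded_iff)
  have "\<bar>f x\<bar> \<le> max 0 c" if "x \<in> topspace X" for x
  proof (cases "f x = 0")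
    case False
    then have "x \<in> ?K" using that closure_of_subset[of "{x\<in>topspace X. f x \<noteq> 0}" X] by auto
    then show ?thesis using c by (simp add: max.coboundedI2)
  qed simp
  then show thesis by (rule that)
qed (auto intro: that[of 1])

lemma test_functions_bdd_borel:
  assumes "f \<in> test_functions X" shows "(\<lambda>x. complex_of_real (f x)) \<in> bdd_borel X"
proof -
  obtain c where "\<And>x. x \<in> topspace X \<Longrightarrow> \<bar>f x\<bar> \<le> c" using test_functions_bounded[OF assms] by blast
  then show ?thesis
    using borel_measurable_continuous_map[OF test_functions_continuous[OF assms]]
    by (intro bdd_borelI[where c = c]) auto
qed

lemma cone_topology_test_functions:
  "cone_topology X = topology_generated_by
     {{\<mu>\<in>pos_measures X. cintegral X \<mu> (\<lambda>x. complex_of_real (f x)) \<in> W} | f W.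
        f \<in> test_functions X \<and> open W}"
  unfolding cone_topology_def test_functions_def ..

lemma topspace_cone_topology [simp]: "topspace (cone_topology X) = pos_measures X"
  unfolding cone_topology_def topology_generated_by_topspace
  by (auto intro!: exI[of _ "pos_measures X"] exI[of _ "\<lambda>x. 1"] exI[of _ UNIV])

text \<open>On positive measures \<open>cintegral\<close> of a real function is the real integral
  against the total variation, so a real open set is pulled back along \<open>Re\<close> to a
  sub-basic one.\<close>

lemma continuous_map_cone_integral:
  assumes X: "Hausdorff_space X" and f: "f \<in> test_functions X"
  shows "continuous_map (cone_topology X) euclideanreal (\<lambda>\<mu>. \<integral>x. f x \<partial>total_variation X \<mu>)"
  unfolding continuous_map_def
proof (intro conjI allI impI)
  fix U :: "real set" assume "openin euclideanreal U"
  then have "open (Re -` U)" by (intro open_vimage) (auto intro: continuous_intros)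
  moreover have "{\<mu>\<in>topspace (cone_topology X). (\<integral>x. f x \<partial>total_variation X \<mu>) \<in> U}
     = {\<mu>\<in>pos_measures X. cintegral X \<mu> (\<lambda>x. complex_of_real (f x)) \<in> Re -` U}"
    using pos_measures_integral[OF X _ test_functions_bdd_borel[OF f]] by auto
  ultimately show "openin (cone_topology X) {\<mu>\<in>topspace (cone_topology X). (\<integral>x. f x \<partial>total_variation X \<mu>) \<in> U}"
    using f by (simp only: cone_topology_test_functions) (rule topology_generated_by_Basis, blast)
qed simp

text \<open>A sub-basic set constrains a single integral, and generating a topology uses finite
  intersections only. Hence finitely many integrals control membership in an open set, which is what
  a finite quadrature can match.\<close>

lemma cone_neighbourhood:
  assumes X: "Hausdorff_space X" and V: "openin (cone_topology X) V" and "\<nu> \<in> V"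
  shows "\<exists>F \<delta>. finite F \<and> F \<subseteq> test_functions X \<and> \<delta> > 0 \<and>
    (\<forall>\<nu>'\<in>pos_measures X. (\<forall>\<phi>\<in>F. \<bar>(\<integral>x. \<phi> x \<partial>total_variation X \<nu>') - (\<integral>x. \<phi> x \<partial>total_variation X \<nu>)\<bar> < \<delta>)
       \<longrightarrow> \<nu>' \<in> V)"
  using V[unfolded cone_topology_test_functions openin_topology_generated_by_iff] \<open>\<nu> \<in> V\<close>
proof (induction rule: generate_topology_on.induct)
  case (Int a b)
  then obtain F \<delta> G \<epsilon> where
    "finite F" "F \<subseteq> test_functions X" "\<delta> > 0" and F: "\<forall>\<nu>'\<in>pos_measures X. (\<forall>\<phi>\<in>F. \<bar>(\<integral>x. \<phi> x \<partial>total_variation X \<nu>') - (\<integral>x. \<phi> x \<partial>total_variation X \<nu>)\<bar> < \<delta>) \<longrightarrow> \<nu>' \<in> a"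
    and "finite G" "G \<subseteq> test_functions X" "\<epsilon> > 0" and G: "\<forall>\<nu>'\<in>pos_measures X. (\<forall>\<phi>\<in>G. \<bar>(\<integral>x. \<phi> x \<partial>total_variation X \<nu>') - (\<integral>x. \<phi> x \<partial>total_variation X \<nu>)\<bar> < \<epsilon>) \<longrightarrow> \<nu>' \<in> b"
    by auto
  then show ?case
    by (intro exI[of _ "F \<union> G"] exI[of _ "min \<delta> \<epsilon>"]) auto
next
  case (UN K)
  then obtain k where k: "k \<in> K" "\<nu> \<in> k" by auto
  show ?case using UN.IH[OF k] k(1) by (meson UnionI)
next
  case (Basis s)
  then obtain f W where s: "s = {\<mu>\<in>pos_measures X. cintegral X \<mu> (\<lambda>x. complex_of_real (f x)) \<in> W}"
    and f: "f \<in> test_functions X" and W: "open W" by blast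
  note I = pos_measures_integral[OF X _ test_functions_bdd_borel[OF f]]
  have \<nu>: "\<nu> \<in> pos_measures X" "complex_of_real (\<integral>x. f x \<partial>total_variation X \<nu>) \<in> W"
    using Basis(2) I unfolding s by auto
  then obtain \<delta> where \<delta>: "\<delta> > 0" "\<And>z. dist z (complex_of_real (\<integral>x. f x \<partial>total_variation X \<nu>)) < \<delta> \<Longrightarrow> z \<in> W"
    using W unfolding open_dist by metis
  have "\<nu>' \<in> s" if "\<nu>' \<in> pos_measures X"
    "\<bar>(\<integral>x. f x \<partial>total_variation X \<nu>') - (\<integral>x. f x \<partial>total_variation X \<nu>)\<bar> < \<delta>" for \<nu>'
    using that I[of \<nu>'] \<delta>(2)[of "cintegral X \<nu>' (\<lambda>x. complex_of_real (f x))"]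
    unfolding s by (simp add: dist_norm flip: of_real_diff)
  then show ?case using f \<delta>(1) by (intro exI[of _ "{f}"] exI[of _ \<delta>]) auto
qed simp

lemma total_variation_dirac_integral:
  fixes f :: "'a \<Rightarrow> real"
  assumes X: "Hausdorff_space X" and y: "y \<in> topspace X" and f: "f \<in> borel_measurable (borel_of X)"
  shows "(\<integral>x. f x \<partial>total_variation X (dirac X y)) = f y"
proof -
  note d = dirac_pos_measures[OF X y]
  note r = radon_total_variation[OF X pos_measures_cmeasures[OF d]]
  interpret finite_measure "total_variation X (dirac X y)" by (rule radon_finite[OF r])
  have "{x\<in>topspace X. f x \<noteq> f y} \<in> sets (borel_of X)"
    using measurable_sets[OF f, of "- {f y}"] by (simp add: vimage_def Int_def conj_commute)
  then have "emeasure (total_variation X (dirac X y)) {x\<in>topspace X. f x \<noteq> f y} = 0"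
    using emeasure_total_variation_pos[OF d] by (simp add: dirac_def)
  then have "AE x in total_variation X (dirac X y). f x = f y"
    using \<open>{x\<in>topspace X. f x \<noteq> f y} \<in> sets (borel_of X)\<close>
    by (intro AE_I[where N = "{x\<in>topspace X. f x \<noteq> f y}"])
       (auto simp: radon_space[OF r] radon_sets[OF r])
  then have "(\<integral>x. f x \<partial>total_variation X (dirac X y)) = (\<integral>x. f y \<partial>total_variation X (dirac X y))"
    using f by (intro integral_cong_AE) (auto simp: measurable_cong_sets[OF radon_sets[OF r] refl])
  also have "\<dots> = measure (total_variation X (dirac X y)) (topspace X) * f y"
    by (simp add: radon_space[OF r])
  also have "dirac X y (topspace X) = 1" using y sets.top[of "borel_of X"] by (simp add: dirac_def)
  then have "measure (total_variation X (dirac X y)) (topspace X) = 1"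
    using emeasure_total_variation_pos[OF d sets.top] by (simp add: measure_def)
  then have "measure (total_variation X (dirac X y)) (topspace X) * f y = f y" by simp
  finally show ?thesis .
qed

text \<open>Integrating \<open>f\<close> against a point mass gives \<open>f y\<close>, so a
  sub-basic set pulls back to a preimage under \<open>f\<close>. Composed with a map continuous for
  the cone topology, this yields continuity of
  \<open>y \<mapsto> \<integral>f d\<K>(y)\<close>.\<close>

lemma continuous_map_dirac:
  assumes X: "Hausdorff_space X"
  shows "continuous_map X (cone_topology X) (dirac X)"
  unfolding cone_topology_test_functions
proof (rule continuous_on_generated_topo)
  have "dirac X ` topspace X \<subseteq> topspace (cone_topology X)" using dirac_pos_measures[OF X] by auto
  then show "dirac X ` topspace X \<subseteq> \<Union> {{\<mu>\<in>pos_measures X. cintegral X \<mu> (\<lambda>x. complex_of_real (f x)) \<in> W} | f W.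
        f \<in> test_functions X \<and> open W}"
    by (simp only: cone_topology_test_functions topology_generated_by_topspace)
  fix U assume "U \<in> {{\<mu>\<in>pos_measures X. cintegral X \<mu> (\<lambda>x. complex_of_real (f x)) \<in> W} | f W.
        f \<in> test_functions X \<and> open W}"
  then obtain f W where U: "U = {\<mu>\<in>pos_measures X. cintegral X \<mu> (\<lambda>x. complex_of_real (f x)) \<in> W}"
    and f: "f \<in> test_functions X" and W: "open W" by blast
  have cf: "continuous_map X euclideanreal f" by (rule test_functions_continuous[OF f])
  have "cintegral X (dirac X y) (\<lambda>x. complex_of_real (f x)) = complex_of_real (f y)" if "y \<in> topspace X" for y
    using pos_measures_integral[OF X dirac_pos_measures[OF X that] test_functions_bdd_borel[OF f]]
      total_variation_dirac_integral[OF X that borel_measurable_continuous_map[OF cf]] by simp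
  then have "dirac X -` U \<inter> topspace X = {y\<in>topspace X. f y \<in> of_real -` W}"
    using dirac_pos_measures[OF X] unfolding U by auto
  moreover have "open (of_real -` W :: real set)"
    using W by (intro open_vimage) (auto intro: continuous_intros)
  ultimately show "openin X (dirac X -` U \<inter> topspace X)"
    using openin_continuous_map_preimage[OF cf, of "of_real -` W"] by simp
qed

text \<open>The space is cut into finitely many measurable cells on which every member of
  \<open>F\<close> varies by at most \<open>\<eta>\<close>; each cell contributes one node weighted
  by its mass. This is the density of finitely supported measures in concrete form.\<close>

lemma finite_quadrature:
  fixes F :: "('a \<Rightarrow> real) set"
  assumes N: "finite_measure N" and "finite F" and "\<delta> > 0"
    and meas: "\<And>\<phi>. \<phi> \<in> F \<Longrightarrow> \<phi> \<in> borel_measurable N"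
    and bdd: "\<And>\<phi>. \<phi> \<in> F \<Longrightarrow> \<exists>c. \<forall>x\<in>space N. \<bar>\<phi> x\<bar> \<le> c"
  obtains Z a where "finite Z" "Z \<subseteq> space N" "\<And>z. 0 \<le> a z"
    "\<And>\<phi>. \<phi> \<in> F \<Longrightarrow> \<bar>(\<integral>x. \<phi> x \<partial>N) - (\<Sum>z\<in>Z. a z * \<phi> z)\<bar> < \<delta>"
proof -
  interpret finite_measure N by fact
  \<comment> \<open>The total error is at most \<open>\<eta>\<close> times the mass of
    \<open>N\<close>; adding \<open>1\<close> makes this strictly less than \<open>\<delta>\<close>
    and covers mass \<open>0\<close>.\<close>
  define \<eta> where "\<eta> = \<delta> / (measure N (space N) + 1)"
  have pos: "measure N (space N) + 1 > 0" by (simp add: add_nonneg_pos)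
  then have \<eta>: "\<eta> > 0" "\<eta> * measure N (space N) < \<delta>"
    using \<open>\<delta> > 0\<close> by (simp_all add: \<eta>_def pos_divide_less_eq)
  \<comment> \<open>\<open>\<kappa> y\<close> is the code of the cell of \<open>y\<close>. The
    default \<open>0\<close> off \<open>F\<close> keeps the set of codes finite, and
    \<open>s\<close> below sends each point to the chosen representative of its cell.\<close>
  define \<kappa> where "\<kappa> y = (\<lambda>\<phi>. if \<phi> \<in> F then \<lfloor>\<phi> y / \<eta>\<rfloor> else 0)" for y
  define s where "s y = inv_into (space N) \<kappa> (\<kappa> y)" for y
  have s: "s y \<in> space N" "\<kappa> (s y) = \<kappa> y" if "y \<in> space N" for y
    unfolding s_def using that by (auto intro: inv_into_into f_inv_into_f)
  obtain c where c: "\<And>\<phi> x. \<phi> \<in> F \<Longrightarrow> x \<in> space N \<Longrightarrow> \<bar>\<phi> x\<bar> \<le> c \<phi>" using bdd by metis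
  \<comment> \<open>A crude common bound for all entries of the codes: a sum of non-negative terms
    dominates each of them.\<close>
  define m where "m = (\<Sum>\<phi>\<in>F. \<lceil>\<bar>c \<phi>\<bar> / \<eta>\<rceil> + 1)"
  have nn: "0 \<le> \<lceil>\<bar>c x\<bar> / \<eta>\<rceil>" for x
    using ceiling_mono[of 0 "\<bar>c x\<bar> / \<eta>"] \<eta>(1) by simp
  have "\<lfloor>\<phi> y / \<eta>\<rfloor> \<in> {-m..m}" if \<phi>: "\<phi> \<in> F" "y \<in> space N" for \<phi> y
  proof -
    have "\<lceil>\<bar>c \<phi>\<bar> / \<eta>\<rceil> + 1 \<le> m"
      unfolding m_def using \<phi> \<open>finite F\<close> \<eta>(1)
      by (intro member_le_sum) (auto intro: add_nonneg_nonneg[OF nn])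
    moreover have "\<bar>\<phi> y / \<eta>\<bar> \<le> \<bar>c \<phi>\<bar> / \<eta>"
      using c[OF \<phi>] \<eta>(1) by (simp add: abs_divide divide_right_mono)
    then have "\<lfloor>\<phi> y / \<eta>\<rfloor> \<le> \<lceil>\<bar>c \<phi>\<bar> / \<eta>\<rceil>" "- \<lceil>\<bar>c \<phi>\<bar> / \<eta>\<rceil> - 1 \<le> \<lfloor>\<phi> y / \<eta>\<rfloor>" by linarith+
    ultimately show ?thesis by simp
  qed
  then have "\<kappa> ` space N \<subseteq> {g. \<forall>\<phi>. (\<phi> \<in> F \<longrightarrow> g \<phi> \<in> {-m..m}) \<and> (\<phi> \<notin> F \<longrightarrow> g \<phi> = 0)}"
    by (auto simp: \<kappa>_def)
  then have "finite (\<kappa> ` space N)"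
    by (rule finite_subset) (intro finite_set_of_finite_funs \<open>finite F\<close> finite_atLeastAtMost_int)
  moreover have "s ` space N = inv_into (space N) \<kappa> ` (\<kappa> ` space N)" by (auto simp: s_def)
  ultimately have fin: "finite (s ` space N)" by simp
  have close: "\<bar>\<phi> x - \<phi> (s x)\<bar> \<le> \<eta>" if "\<phi> \<in> F" "x \<in> space N" for \<phi> x
  proof -
    have "\<lfloor>\<phi> (s x) / \<eta>\<rfloor> = \<lfloor>\<phi> x / \<eta>\<rfloor>" using fun_cong[OF s(2)[OF that(2)], of \<phi>] that by (simp add: \<kappa>_def)
    then have "\<bar>\<phi> x / \<eta> - \<phi> (s x) / \<eta>\<bar> \<le> 1" by linarith
    then have "\<bar>(\<phi> x - \<phi> (s x)) / \<eta>\<bar> \<le> 1" by (simp add: diff_divide_distrib)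
    then show ?thesis using \<eta>(1) by (simp add: abs_divide)
  qed
  have "simple_function N s"
    unfolding simple_function_def
  proof (intro conjI ballI fin)
    fix z assume "z \<in> s ` space N"
    then obtain y where y: "y \<in> space N" "z = s y" by auto
    have "s -` {z} \<inter> space N = {x\<in>space N. \<forall>\<phi>\<in>F. \<lfloor>\<phi> x / \<eta>\<rfloor> = \<lfloor>\<phi> z / \<eta>\<rfloor>}"
    proof (intro set_eqI iffI)
      fix x assume x: "x \<in> s -` {z} \<inter> space N"
      then have eq: "\<kappa> x = \<kappa> z" using s(2)[of x] by auto
      have "\<lfloor>\<phi> x / \<eta>\<rfloor> = \<lfloor>\<phi> z / \<eta>\<rfloor>" if "\<phi> \<in> F" for \<phi>
        using fun_cong[OF eq, of \<phi>] that by (simp add: \<kappa>_def)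
      then show "x \<in> {x\<in>space N. \<forall>\<phi>\<in>F. \<lfloor>\<phi> x / \<eta>\<rfloor> = \<lfloor>\<phi> z / \<eta>\<rfloor>}"
        using x by auto
    next
      fix x assume x: "x \<in> {x\<in>space N. \<forall>\<phi>\<in>F. \<lfloor>\<phi> x / \<eta>\<rfloor> = \<lfloor>\<phi> z / \<eta>\<rfloor>}"
      then have "\<kappa> x = \<kappa> z" by (intro ext) (simp add: \<kappa>_def)
      also have "\<kappa> z = \<kappa> y" using s(2)[OF y(1)] y(2) by simp
      finally show "x \<in> s -` {z} \<inter> space N" using x y(2) by (simp add: s_def)
    qed
    also have "\<dots> \<in> sets N"
    proof (intro sets.sets_Collect_finite_All \<open>finite F\<close>)
      fix \<phi> assume "\<phi> \<in> F"
      note meas[OF this, measurable]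
      show "{x\<in>space N. \<lfloor>\<phi> x / \<eta>\<rfloor> = \<lfloor>\<phi> z / \<eta>\<rfloor>} \<in> sets N" by measurable
    qed
    finally show "s -` {z} \<inter> space N \<in> sets N" .
  qed
  note int = integral_simple_function[OF N this, folded real_scaleR_def]
  define a where "a z = measure N {x\<in>space N. s x = z}" for z
  show thesis
  proof (rule that[of "s ` space N" a])
    fix \<phi> assume \<phi>: "\<phi> \<in> F"
    have i1: "integrable N \<phi>" using c[OF \<phi>] meas[OF \<phi>] by (intro integrable_const_bound[where B = "c \<phi>"]) auto
    have "(\<lambda>x. \<phi> (s x)) \<in> borel_measurable N"
      using borel_measurable_simple_function[OF simple_function_compose1[OF \<open>simple_function N s\<close>, of \<phi>]] .
    then have i2: "integrable N (\<lambda>x. \<phi> (s x))"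
      using c[OF \<phi>] s(1) by (intro integrable_const_bound[where B = "c \<phi>"]) auto
    have "\<bar>(\<integral>x. \<phi> x \<partial>N) - (\<Sum>z\<in>s ` space N. a z * \<phi> z)\<bar> = \<bar>\<integral>x. \<phi> x - \<phi> (s x) \<partial>N\<bar>"
      using int[of \<phi>] i1 i2 by (simp add: a_def)
    also have "\<dots> \<le> (\<integral>x. \<bar>\<phi> x - \<phi> (s x)\<bar> \<partial>N)" by (rule integral_abs_bound)
    also have "\<dots> \<le> (\<integral>x. \<eta> \<partial>N)"
      using i1 i2 close[OF \<phi>] by (intro integral_mono) auto
    also have "\<dots> < \<delta>" using \<eta>(2) by (simp add: mult.commute)
    finally show "\<bar>(\<integral>x. \<phi> x \<partial>N) - (\<Sum>z\<in>s ` space N. a z * \<phi> z)\<bar> < \<delta>" .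
  qed (use fin s(1) in \<open>auto simp: a_def\<close>)
qed

section \<open>Compactly supported functions below the indicator of an open set\<close>

lemma Cc_pos_max:
  assumes "f \<in> Cc_pos X" "g \<in> Cc_pos X"
  shows "(\<lambda>x. max (f x) (g x)) \<in> Cc_pos X"
proof -
  have "X closure_of {x\<in>topspace X. max (f x) (g x) \<noteq> 0}
      \<subseteq> X closure_of ({x\<in>topspace X. f x \<noteq> 0} \<union> {x\<in>topspace X. g x \<noteq> 0})"
    by (rule closure_of_mono) (auto simp: max_def)
  also have "\<dots> = X closure_of {x\<in>topspace X. f x \<noteq> 0} \<union> X closure_of {x\<in>topspace X. g x \<noteq> 0}"
    by (rule closure_of_Un)
  finally have "compactin X (X closure_of {x\<in>topspace X. max (f x) (g x) \<noteq> 0})"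
    by (rule closed_compactin[rotated]) (use assms in \<open>simp_all add: Cc_pos_def compactin_Un\<close>)
  moreover have "continuous_map X euclideanreal (\<lambda>x. max (f x) (g x))"
    using assms by (intro continuous_map_real_max) (auto simp: Cc_pos_def)
  moreover have "\<forall>x\<in>topspace X. 0 \<le> max (f x) (g x)"
    using assms by (simp add: Cc_pos_def le_max_iff_disj)
  ultimately show ?thesis unfolding Cc_pos_def by blast
qed

lemma Cc_pos_zero: "(\<lambda>x. 0) \<in> Cc_pos X"
  by (simp add: Cc_pos_def)

text \<open>Local compactness provides an open \<open>V\<close> around \<open>C\<close> inside a
  compact closed \<open>L\<close>. A Urysohn function that vanishes off \<open>V \<inter> U\<close>
  is then dominated by the indicator of \<open>U\<close>, and its support lies in
  \<open>L\<close>.\<close>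

lemma Urysohn_Cc_pos:
  assumes lc: "locally_compact_space X" and X: "Hausdorff_space X"
    and C: "compactin X C" and U: "openin X U" "C \<subseteq> U"
  obtains f where "f \<in> Cc_pos X" "\<And>x. x \<in> C \<Longrightarrow> f x = 1"
    "\<And>x. x \<in> topspace X \<Longrightarrow> 0 \<le> f x" "\<And>x. x \<in> topspace X \<Longrightarrow> f x \<le> indicator U x"
proof -
  obtain V L where V: "openin X V" "compactin X L" "closedin X L" "C \<subseteq> V" "V \<subseteq> L"
    using lc C locally_compact_space_compact_closed_compact[of X] X by blast
  have "completely_regular_space X"
    using lc X by (intro locally_compact_regular_imp_completely_regular_space) auto
  moreover have "closedin X (topspace X - V \<inter> U)" using V(1) U(1) by auto
  moreover have "disjnt (topspace X - V \<inter> U) C" using U(2) V(4) by (auto simp: disjnt_def)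
  ultimately obtain f where f: "continuous_map X (subtopology euclidean {0..1::real}) f"
      "f ` C \<subseteq> {1}" "f ` (topspace X - V \<inter> U) \<subseteq> {0}"
    using Urysohn_completely_regular_closed_compact[of 0 1 X "topspace X - V \<inter> U" C]
      Urysohn_completely_regular_compact_closed[of 0 1 X C "topspace X - V \<inter> U"] C
    by (metis disjnt_sym zero_le_one)
  have r: "f x \<in> {0..1}" if "x \<in> topspace X" for x
    using f(1) that by (auto simp: continuous_map_in_subtopology)
  have "X closure_of {x\<in>topspace X. f x \<noteq> 0} \<subseteq> L"
    using f(3) V by (intro closure_of_minimal) auto
  then have "compactin X (X closure_of {x\<in>topspace X. f x \<noteq> 0})"
    using V(2) by (intro closed_compactin[OF V(2)]) auto
  moreover have "continuous_map X euclideanreal f" using f(1) by (simp add: continuous_map_in_subtopology)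
  ultimately have "f \<in> Cc_pos X" using r by (auto simp: Cc_pos_def)
  moreover have "f x \<le> indicator U x" if "x \<in> topspace X" for x
    using f(3) r[OF that] that by (cases "x \<in> V \<inter> U") (auto simp: indicator_def)
  ultimately show thesis using f(2) r by (intro that[of f]) auto
qed

text \<open>The usual approximants of \<open>U\<close> from below. The set where \<open>f\<close> is
  non-zero lies in \<open>U\<close>, whereas its closure may leave \<open>U\<close>.\<close>

definition subordinate :: "'a topology \<Rightarrow> 'a set \<Rightarrow> ('a \<Rightarrow> real) set" where
  "subordinate X U = {f \<in> Cc_pos X. \<forall>x\<in>topspace X. f x \<le> indicator U x}"

lemma subordinate_test_functions: "f \<in> subordinate X U \<Longrightarrow> f \<in> test_functions X"
  by (simp add: subordinate_def test_functions_def)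

text \<open>Pointwise maxima stay in the family. Compactness arguments produce finitely many
  members, and these are replaced by a single one.\<close>

lemma subordinate_directed:
  assumes "finite G" "G \<subseteq> subordinate X U"
  shows "\<exists>f\<in>subordinate X U. \<forall>g\<in>G. \<forall>x\<in>topspace X. g x \<le> f x"
  using assms
proof (induction G rule: finite_induct)
  case empty
  then show ?case by (auto simp: subordinate_def intro!: bexI[of _ "\<lambda>x. 0"] Cc_pos_zero)
next
  case (insert h G)
  then obtain f where "f \<in> subordinate X U" "\<forall>g\<in>G. \<forall>x\<in>topspace X. g x \<le> f x" by auto
  with insert.prems show ?case
    by (intro bexI[of _ "\<lambda>x. max (h x) (f x)"]) (auto simp: subordinate_def Cc_pos_max intro: max.coboundedI2)
qed

lemma test_functions_integrable:
  fixes f :: "'a \<Rightarrow> real"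
  assumes "f \<in> test_functions X" "radon X M" shows "integrable M f"
proof -
  obtain c where c: "\<And>x. x \<in> topspace X \<Longrightarrow> \<bar>f x\<bar> \<le> c" using test_functions_bounded[OF assms(1)] by blast
  note r = assms(2)
  show ?thesis
    using borel_measurable_continuous_map[OF test_functions_continuous[OF assms(1)]] c
    by (intro finite_measure.integrable_const_bound[OF radon_finite[OF r], of _ c])
       (auto simp: measurable_cong_sets[OF radon_sets[OF r] refl] radon_space[OF r])
qed

lemma integral_subordinate_le:
  assumes f: "f \<in> subordinate X U" and M: "radon X M" and U: "openin X U"
  shows "(\<integral>x. f x \<partial>M) \<le> measure M U"
proof -
  interpret finite_measure M by (rule radon_finite[OF M])
  have Us: "U \<in> sets M" using borel_of_open[OF U] radon_sets[OF M] by simp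
  have "(\<integral>x. f x \<partial>M) \<le> (\<integral>x. indicator U x \<partial>M)"
    using f Us test_functions_integrable[OF subordinate_test_functions[OF f] M]
    by (intro integral_mono)
      (auto simp: subordinate_def radon_space[OF M] emeasure_eq_measure intro: integrable_real_indicator)
  then show ?thesis using Us sets.sets_into_space[OF Us] by (simp add: Int_absorb2)
qed

text \<open>Inner regularity puts almost all mass of \<open>U\<close> on a compact \<open>C\<close>,
  and a Urysohn function equal to \<open>1\<close> on \<open>C\<close> has integral at least the
  mass of \<open>C\<close>.\<close>

lemma integral_subordinate_approx:
  assumes lc: "locally_compact_space X" and X: "Hausdorff_space X"
    and M: "radon X M" and U: "openin X U" and a: "a < measure M U"
  obtains f where "f \<in> subordinate X U" "a < (\<integral>x. f x \<partial>M)"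
proof -
  interpret finite_measure M by (rule radon_finite[OF M])
  have Us: "U \<in> sets M" using borel_of_open[OF U] radon_sets[OF M] by simp
  obtain C where C: "compactin X C" "C \<subseteq> U" "measure M (U - C) < measure M U - a"
    using radon_inner[OF M borel_of_open[OF U], of "measure M U - a"] a by auto
  have Cs: "C \<in> sets M" using borel_of_compact[OF X C(1)] radon_sets[OF M] by simp
  obtain f where f: "f \<in> Cc_pos X" "\<And>x. x \<in> C \<Longrightarrow> f x = 1"
    "\<And>x. x \<in> topspace X \<Longrightarrow> 0 \<le> f x" "\<And>x. x \<in> topspace X \<Longrightarrow> f x \<le> indicator U x"
    using Urysohn_Cc_pos[OF lc X C(1) U C(2)] by blast
  have fU: "f \<in> subordinate X U" using f by (simp add: subordinate_def)
  have "a < measure M C" using C(2,3) Us Cs by (simp add: finite_measure_Diff)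
  also have "measure M C = (\<integral>x. indicator C x \<partial>M)"
    using sets.sets_into_space[OF Cs] by (simp add: Int_absorb2)
  also have "\<dots> \<le> (\<integral>x. f x \<partial>M)"
    using f Cs test_functions_integrable[OF subordinate_test_functions[OF fU] M]
    by (intro integral_mono)
       (auto simp: radon_space[OF M] emeasure_eq_measure indicator_eq_0_iff
          intro: integrable_real_indicator split: split_indicator)
  finally show thesis using fU that by blast
qed

section \<open>Additive maps that are continuous for the cone topology\<close>

text \<open>
  The maps \<open>\<mu> \<mapsto> \<mu> * \<nu>\<close> and \<open>\<nu> \<mapsto> \<mu> * \<nu>\<close> of a semitopological semihypergroup are instances; \<open>c\<close> is the
  common mass of the images of the point masses.
\<close>

locale cone_map =
  fixes X :: "'a topology" and T :: "'a cmeas \<Rightarrow> 'a cmeas" and c :: real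
  assumes lc: "locally_compact_space X" and Hausdorff: "Hausdorff_space X"
    and T_pos: "\<mu> \<in> pos_measures X \<Longrightarrow> T \<mu> \<in> pos_measures X"
    and T_add: "\<mu> \<in> pos_measures X \<Longrightarrow> \<nu> \<in> pos_measures X \<Longrightarrow> T (\<lambda>B. \<mu> B + \<nu> B) = (\<lambda>B. T \<mu> B + T \<nu> B)"
    and T_scale: "\<mu> \<in> pos_measures X \<Longrightarrow> 0 \<le> a \<Longrightarrow>
      T (\<lambda>B. complex_of_real a * \<mu> B) = (\<lambda>B. complex_of_real a * T \<mu> B)"
    and T_cont: "continuous_map (cone_topology X) (cone_topology X) T"
    and T_mass: "y \<in> topspace X \<Longrightarrow> T (dirac X y) (topspace X) = complex_of_real c"
begin

text \<open>Images under \<open>T\<close> are non-negative set functions, so passing to the total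
  variation loses nothing and yields measures that can be integrated against.\<close>

abbreviation \<K> :: "'a \<Rightarrow> 'a measure" where "\<K> y \<equiv> total_variation X (T (dirac X y))"

abbreviation \<R> :: "'a measure \<Rightarrow> 'a measure" where "\<R> N \<equiv> total_variation X (T (cmeas_of N))"

lemma radon_kernel: "y \<in> topspace X \<Longrightarrow> radon X (\<K> y)"
  by (intro radon_total_variation Hausdorff pos_measures_cmeasures T_pos dirac_pos_measures)

lemma radon_image: "radon X N \<Longrightarrow> radon X (\<R> N)"
  by (intro radon_total_variation Hausdorff pos_measures_cmeasures T_pos cmeas_of_pos_measures)

lemma measure_kernel_space: "y \<in> topspace X \<Longrightarrow> measure (\<K> y) (topspace X) = c"
  using T_mass[of y] fun_cong[OF cmeas_of_total_variation[OF T_pos[OF dirac_pos_measures[OF Hausdorff]]], of y "topspace X"]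
  by (simp add: cmeas_of_def)

lemma measure_kernel_le: "y \<in> topspace X \<Longrightarrow> measure (\<K> y) B \<le> c"
  using finite_measure.bounded_measure[OF radon_finite[OF radon_kernel], of y B]
  by (simp add: radon_space[OF radon_kernel] measure_kernel_space)

lemma continuous_map_kernel_integral:
  assumes "f \<in> test_functions X"
  shows "continuous_map X euclideanreal (\<lambda>y. \<integral>x. f x \<partial>\<K> y)"
  using continuous_map_compose[OF continuous_map_compose[OF continuous_map_dirac[OF Hausdorff] T_cont]
      continuous_map_cone_integral[OF Hausdorff assms]]
  by (simp add: o_def)

lemma kernel_integral_bounded:
  assumes f: "f \<in> test_functions X"
  obtains d where "\<And>y. y \<in> topspace X \<Longrightarrow> \<bar>\<integral>x. f x \<partial>\<K> y\<bar> \<le> d"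
proof -
  obtain d where d: "\<And>x. x \<in> topspace X \<Longrightarrow> \<bar>f x\<bar> \<le> d" using test_functions_bounded[OF f] by blast
  have "\<bar>\<integral>x. f x \<partial>\<K> y\<bar> \<le> c * d" if y: "y \<in> topspace X" for y
  proof -
    note r = radon_kernel[OF y]
    interpret finite_measure "\<K> y" by (rule radon_finite[OF r])
    have "\<bar>\<integral>x. f x \<partial>\<K> y\<bar> \<le> (\<integral>x. \<bar>f x\<bar> \<partial>\<K> y)" by (rule integral_abs_bound)
    also have "\<dots> \<le> (\<integral>x. d \<partial>\<K> y)"
      using test_functions_integrable[OF f r] d by (intro integral_mono) (auto simp: radon_space[OF r])
    also have "\<dots> = c * d" by (simp add: radon_space[OF r] measure_kernel_space[OF y])
    finally show ?thesis .
  qed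
  then show thesis by (rule that)
qed

lemma finite_combination:
  assumes "finite Z" "Z \<subseteq> topspace X" and a: "\<And>z. 0 \<le> a z"
  shows "(\<lambda>B. \<Sum>z\<in>Z. complex_of_real (a z) * dirac X z B) \<in> pos_measures X \<and>
    T (\<lambda>B. \<Sum>z\<in>Z. complex_of_real (a z) * dirac X z B) = (\<lambda>B. \<Sum>z\<in>Z. complex_of_real (a z) * T (dirac X z) B)"
  using assms(1,2)
proof (induction Z rule: finite_induct)
  case empty
  \<comment> \<open>Homogeneity with factor \<open>0\<close> says that \<open>T\<close> maps the
    zero measure to itself.\<close>
  show ?case using T_scale[OF pos_measures_zero[OF Hausdorff], of 0] pos_measures_zero[OF Hausdorff] by simp
next
  case (insert z Z)
  then have z: "dirac X z \<in> pos_measures X" by (intro dirac_pos_measures Hausdorff) auto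
  note az = pos_measures_scale[OF Hausdorff z a[of z]]
  from insert show ?case
    using pos_measures_add[OF Hausdorff az] T_add[OF az] T_scale[OF z a[of z]] by simp
qed

lemma integral_total_variation_combination:
  assumes \<mu>: "\<mu> \<in> pos_measures X" and f: "f \<in> test_functions X" and "finite Z"
    and M: "\<And>z. z \<in> Z \<Longrightarrow> radon X (M z)"
    and eq: "\<And>B. \<mu> B = (\<Sum>z\<in>Z. complex_of_real (a z) * cmeas_of (M z) B)"
  shows "(\<integral>x. f x \<partial>total_variation X \<mu>) = (\<Sum>z\<in>Z. a z * (\<integral>x. f x \<partial>M z))"
proof -
  have "complex_of_real (\<integral>x. f x \<partial>total_variation X \<mu>) = cintegral X \<mu> (\<lambda>x. complex_of_real (f x))"
    using pos_measures_integral[OF Hausdorff \<mu> test_functions_bdd_borel[OF f]] by simp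
  also have "\<dots> = (\<Sum>z\<in>Z. complex_of_real (a z) * (\<integral>x. complex_of_real (f x) \<partial>M z))"
    using eq by (intro cintegral_linear_combination test_functions_bdd_borel f
        cmeasures_complex_borel_measure pos_measures_cmeasures \<mu> radon_finite[OF M] radon_sets[OF M])
      (auto simp: cmeas_of_def)
  also have "\<dots> = complex_of_real (\<Sum>z\<in>Z. a z * (\<integral>x. f x \<partial>M z))" by simp
  finally show ?thesis using of_real_eq_iff by blast
qed

text \<open>
  Both sides are continuous along finitely supported approximations of \<open>N\<close> that are chosen so as to
  test also against \<open>y \<mapsto> \<integral>f d\<K>\<^sub>y\<close>, and they agree on finitely supported measures.
\<close>

lemma integral_image:
  assumes N: "radon X N" and f: "f \<in> test_functions X"
  shows "(\<integral>x. f x \<partial>\<R> N) = (\<integral>y. \<integral>x. f x \<partial>\<K> y \<partial>N)"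
proof -
  define \<psi> where "\<psi> y = (\<integral>x. f x \<partial>\<K> y)" for y
  let ?\<nu> = "cmeas_of N"
  have \<nu>: "?\<nu> \<in> pos_measures X" by (rule cmeas_of_pos_measures[OF Hausdorff N])
  \<comment> \<open>A combination with one term: the total variation of \<open>cmeas_of N\<close>
    integrates test functions as \<open>N\<close> does.\<close>
  have tv: "(\<integral>x. g x \<partial>total_variation X ?\<nu>) = (\<integral>x. g x \<partial>N)" if g: "g \<in> test_functions X" for g :: "'a \<Rightarrow> real"
    using integral_total_variation_combination[OF \<nu> g, of "{()}" "\<lambda>_. N" "\<lambda>_. 1"] N by simp
  have "\<bar>(\<integral>x. f x \<partial>\<R> N) - (\<integral>y. \<psi> y \<partial>N)\<bar> \<le> \<epsilon>" if "\<epsilon> > 0" for \<epsilon>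
  proof -
    let ?I = "\<lambda>\<mu>. \<integral>x. f x \<partial>total_variation X \<mu>"
    let ?V = "{\<mu>\<in>topspace (cone_topology X). ?I (T \<mu>) \<in> ball (?I (T ?\<nu>)) (\<epsilon> / 2)}"
    have "continuous_map (cone_topology X) euclideanreal (\<lambda>\<mu>. ?I (T \<mu>))"
      using continuous_map_compose[OF T_cont continuous_map_cone_integral[OF Hausdorff f]] by (simp add: o_def)
    then have "openin (cone_topology X) ?V" by (intro openin_continuous_map_preimage) auto
    moreover have "?\<nu> \<in> ?V" using \<nu> \<open>\<epsilon> > 0\<close> by simp
    ultimately obtain F \<delta> where F: "finite F" "F \<subseteq> test_functions X" "\<delta> > 0"
      "\<And>\<nu>'. \<nu>' \<in> pos_measures X \<Longrightarrow> (\<forall>\<phi>\<in>F. \<bar>(\<integral>x. \<phi> x \<partial>total_variation X \<nu>') - (\<integral>x. \<phi> x \<partial>total_variation X ?\<nu>)\<bar> < \<delta>)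
       \<Longrightarrow> \<nu>' \<in> ?V"
      using cone_neighbourhood[OF Hausdorff] by meson
    \<comment> \<open>The tolerance \<open>\<delta>\<close> on \<open>F\<close> places the
      quadrature measure in \<open>?V\<close>, where the integral after applying \<open>T\<close> is
      off by less than \<open>\<epsilon> / 2\<close>; the other \<open>\<epsilon> / 2\<close> is
      spent on \<open>\<psi>\<close>.\<close>
    obtain Z a where Z: "finite Z" "Z \<subseteq> space N" "\<And>z. 0 \<le> a z"
      "\<And>\<phi>. \<phi> \<in> insert \<psi> F \<Longrightarrow> \<bar>(\<integral>x. \<phi> x \<partial>N) - (\<Sum>z\<in>Z. a z * \<phi> z)\<bar> < min \<delta> (\<epsilon> / 2)"
    proof (rule finite_quadrature[OF radon_finite[OF N], of "insert \<psi> F" "min \<delta> (\<epsilon> / 2)"])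
      show "\<phi> \<in> borel_measurable N" if "\<phi> \<in> insert \<psi> F" for \<phi>
        using that continuous_map_kernel_integral[OF f] F(2) test_functions_continuous
        unfolding \<psi>_def[abs_def] measurable_cong_sets[OF radon_sets[OF N] refl]
        by (auto intro: borel_measurable_continuous_map)
      show "\<exists>d. \<forall>x\<in>space N. \<bar>\<phi> x\<bar> \<le> d" if "\<phi> \<in> insert \<psi> F" for \<phi>
      proof (cases "\<phi> = \<psi>")
        case True
        then show ?thesis using kernel_integral_bounded[OF f] unfolding \<psi>_def radon_space[OF N] by metis
      next
        case False
        then have "\<phi> \<in> test_functions X" using that F(2) by auto
        then show ?thesis using test_functions_bounded unfolding radon_space[OF N] by metis
      qed
    qed (use F \<open>\<epsilon> > 0\<close> in auto)
    have ZX: "Z \<subseteq> topspace X" using Z(2) radon_space[OF N] by simp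
    define \<nu>' where "\<nu>' = (\<lambda>B. \<Sum>z\<in>Z. complex_of_real (a z) * dirac X z B)"
    have \<nu>': "\<nu>' \<in> pos_measures X" "T \<nu>' = (\<lambda>B. \<Sum>z\<in>Z. complex_of_real (a z) * T (dirac X z) B)"
      using finite_combination[OF Z(1) ZX, of a] Z(3) unfolding \<nu>'_def by auto
    have "(\<integral>x. \<phi> x \<partial>total_variation X \<nu>') = (\<Sum>z\<in>Z. a z * \<phi> z)" if \<phi>: "\<phi> \<in> F" for \<phi>
    proof -
      have t: "\<phi> \<in> test_functions X" using \<phi> F(2) by auto
      have "(\<integral>x. \<phi> x \<partial>total_variation X \<nu>') = (\<Sum>z\<in>Z. a z * (\<integral>x. \<phi> x \<partial>total_variation X (dirac X z)))"
        using ZX cmeas_of_total_variation[OF dirac_pos_measures[OF Hausdorff]]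
        by (intro integral_total_variation_combination \<nu>' t Z(1) radon_total_variation Hausdorff
            pos_measures_cmeasures dirac_pos_measures) (auto simp: \<nu>'_def intro!: sum.cong)
      then show ?thesis
        using ZX total_variation_dirac_integral[OF Hausdorff _ borel_measurable_continuous_map[OF test_functions_continuous[OF t]]]
        by (auto intro!: sum.cong)
    qed
    then have "\<nu>' \<in> ?V"
      using Z(4) F(2) tv by (intro F(4) \<nu>'(1)) (auto simp: abs_minus_commute subset_eq)
    then have "\<bar>?I (T ?\<nu>) - ?I (T \<nu>')\<bar> < \<epsilon> / 2" by (simp add: dist_real_def)
    moreover have "?I (T \<nu>') = (\<Sum>z\<in>Z. a z * \<psi> z)"
      unfolding \<psi>_def
      using ZX cmeas_of_total_variation[OF T_pos[OF dirac_pos_measures[OF Hausdorff]]]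
      by (intro integral_total_variation_combination T_pos \<nu>'(1) f Z(1) radon_kernel)
        (auto simp: \<nu>'(2) intro!: sum.cong)
    moreover have "\<bar>(\<integral>y. \<psi> y \<partial>N) - (\<Sum>z\<in>Z. a z * \<psi> z)\<bar> < \<epsilon> / 2" using Z(4)[of \<psi>] by simp
    ultimately show ?thesis by linarith
  qed
  then have "\<bar>(\<integral>x. f x \<partial>\<R> N) - (\<integral>y. \<psi> y \<partial>N)\<bar> \<le> 0" by (metis field_le_epsilon add_0)
  then show ?thesis by (simp add: \<psi>_def)
qed

text \<open>\<open>y \<mapsto> measure (\<K> y) U\<close> is the supremum of the continuous
  functions \<open>y \<mapsto> \<integral>f d\<K>(y)\<close> over subordinate \<open>f\<close>,
  hence lower semicontinuous. Borel measurability for open \<open>U\<close> follows.\<close>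

lemma openin_measure_kernel:
  assumes U: "openin X U"
  shows "openin X {y\<in>topspace X. a < measure (\<K> y) U}"
proof -
  have "{y\<in>topspace X. a < measure (\<K> y) U}
      = (\<Union>f\<in>subordinate X U. {y\<in>topspace X. (\<integral>x. f x \<partial>\<K> y) \<in> {a<..}})"
  proof (intro set_eqI iffI)
    fix y assume y: "y \<in> {y\<in>topspace X. a < measure (\<K> y) U}"
    then obtain f where "f \<in> subordinate X U" "a < (\<integral>x. f x \<partial>\<K> y)"
      using integral_subordinate_approx[OF lc Hausdorff radon_kernel U, of y a] by blast
    with y show "y \<in> (\<Union>f\<in>subordinate X U. {y\<in>topspace X. (\<integral>x. f x \<partial>\<K> y) \<in> {a<..}})" by auto
  next
    fix y assume "y \<in> (\<Union>f\<in>subordinate X U. {y\<in>topspace X. (\<integral>x. f x \<partial>\<K> y) \<in> {a<..}})"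
    then show "y \<in> {y\<in>topspace X. a < measure (\<K> y) U}"
      using integral_subordinate_le[OF _ radon_kernel U] by fastforce
  qed
  moreover have "openin X {y\<in>topspace X. (\<integral>x. f x \<partial>\<K> y) \<in> {a<..}}" if "f \<in> subordinate X U" for f
    using continuous_map_kernel_integral[OF subordinate_test_functions[OF that]]
    by (intro openin_continuous_map_preimage) auto
  ultimately show ?thesis by auto
qed

lemma measurable_measure_kernel_open:
  assumes U: "openin X U"
  shows "(\<lambda>y. measure (\<K> y) U) \<in> borel_measurable (borel_of X)"
  unfolding borel_measurable_iff_greater
  using borel_of_open[OF openin_measure_kernel[OF U]] by simp

text \<open>Each point of \<open>C\<close> has its own subordinate function that works on a
  neighbourhood; compactness leaves finitely many, and a common majorant works on all of
  \<open>C\<close>.\<close>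

lemma kernel_compact_subordinate:
  assumes U: "openin X U" and C: "compactin X C" and a: "\<And>y. y \<in> C \<Longrightarrow> a < measure (\<K> y) U"
  shows "\<exists>f\<in>subordinate X U. \<forall>y\<in>C. a < (\<integral>x. f x \<partial>\<K> y)"
proof -
  have CX: "C \<subseteq> topspace X" using compactin_subset_topspace[OF C] .
  define W where "W f = {y\<in>topspace X. (\<integral>x. f x \<partial>\<K> y) \<in> {a<..}}" for f
  have "openin X (W f)" if "f \<in> subordinate X U" for f
    unfolding W_def using continuous_map_kernel_integral[OF subordinate_test_functions[OF that]]
    by (intro openin_continuous_map_preimage) auto
  moreover have "C \<subseteq> \<Union> (W ` subordinate X U)"
  proof
    fix y assume y: "y \<in> C"
    then obtain f where "f \<in> subordinate X U" "a < (\<integral>x. f x \<partial>\<K> y)"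
      using integral_subordinate_approx[OF lc Hausdorff radon_kernel U a] CX by blast
    then show "y \<in> \<Union> (W ` subordinate X U)" using y CX by (auto simp: W_def)
  qed
  ultimately have "\<exists>\<F>. finite \<F> \<and> \<F> \<subseteq> W ` subordinate X U \<and> C \<subseteq> \<Union>\<F>"
    using C[unfolded compactin_def, THEN conjunct2, rule_format, of "W ` subordinate X U"] by blast
  then obtain G where G: "finite G" "G \<subseteq> subordinate X U" "C \<subseteq> \<Union> (W ` G)"
    by (metis finite_subset_image)
  obtain f where f: "f \<in> subordinate X U" "\<And>g x. g \<in> G \<Longrightarrow> x \<in> topspace X \<Longrightarrow> g x \<le> f x"
    using subordinate_directed[OF G(1,2)] by blast
  have "a < (\<integral>x. f x \<partial>\<K> y)" if y: "y \<in> C" for y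
  proof -
    obtain g where g: "g \<in> G" "y \<in> W g" using G(3) y by auto
    note r = radon_kernel[of y]
    have yX: "y \<in> topspace X" using y CX by auto
    have "(\<integral>x. g x \<partial>\<K> y) \<le> (\<integral>x. f x \<partial>\<K> y)"
      using f g G(2) r[OF yX]
      by (intro integral_mono test_functions_integrable[OF subordinate_test_functions])
        (auto simp: radon_space)
    then show ?thesis using g(2) by (simp add: W_def)
  qed
  with f(1) show ?thesis by blast
qed

lemma c_nonneg: "topspace X \<noteq> {} \<Longrightarrow> 0 \<le> c"
  using measure_kernel_space by (metis ex_in_conv measure_nonneg)

lemma integrable_measure_kernel:
  assumes N: "radon X N" and "(\<lambda>y. measure (\<K> y) B) \<in> borel_measurable (borel_of X)"
  shows "integrable N (\<lambda>y. measure (\<K> y) B)"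
  using assms(2) measure_kernel_le
  by (intro finite_measure.integrable_const_bound[OF radon_finite[OF N], where B = c])
     (auto simp: radon_space[OF N] measurable_cong_sets[OF radon_sets[OF N] refl])

text \<open>
  The integrand is the supremum of an upward directed, in general uncountable, family of continuous
  functions; up to \<open>\<epsilon>\<close> it is dominated by one member of the family on a compact set of almost full
  measure.
\<close>

lemma measure_image_open:
  assumes N: "radon X N" and U: "openin X U"
  shows "measure (\<R> N) U = (\<integral>y. measure (\<K> y) U \<partial>N)"
proof (rule antisym)
  interpret N: finite_measure N by (rule radon_finite[OF N])
  have sp: "space N = topspace X" by (rule radon_space[OF N])
  let ?\<phi> = "\<lambda>y. measure (\<K> y) U"
  have meas: "?\<phi> \<in> borel_measurable (borel_of X)" by (rule measurable_measure_kernel_open[OF U])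
  have int: "integrable N ?\<phi>" by (rule integrable_measure_kernel[OF N meas])
  have intf: "integrable N (\<lambda>y. \<integral>x. f x \<partial>\<K> y)" if f: "f \<in> test_functions X" for f
  proof -
    obtain d where "\<And>y. y \<in> topspace X \<Longrightarrow> \<bar>\<integral>x. f x \<partial>\<K> y\<bar> \<le> d" using kernel_integral_bounded[OF f] by blast
    then show ?thesis
      using borel_measurable_continuous_map[OF continuous_map_kernel_integral[OF f]]
      by (intro N.integrable_const_bound[where B = d])
         (auto simp: sp measurable_cong_sets[OF radon_sets[OF N] refl])
  qed
  show "measure (\<R> N) U \<le> (\<integral>y. ?\<phi> y \<partial>N)"
  proof (rule dense_le)
    fix a assume "a < measure (\<R> N) U"
    then obtain f where f: "f \<in> subordinate X U" "a < (\<integral>x. f x \<partial>\<R> N)"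
      using integral_subordinate_approx[OF lc Hausdorff radon_image[OF N] U] by blast
    note f(2)
    also have "(\<integral>x. f x \<partial>\<R> N) = (\<integral>y. \<integral>x. f x \<partial>\<K> y \<partial>N)"
      by (rule integral_image[OF N subordinate_test_functions[OF f(1)]])
    also have "\<dots> \<le> (\<integral>y. ?\<phi> y \<partial>N)"
      using integral_subordinate_le[OF f(1) radon_kernel U]
      by (intro integral_mono intf int subordinate_test_functions[OF f(1)]) (auto simp: sp)
    finally show "a \<le> (\<integral>y. ?\<phi> y \<partial>N)" by simp
  qed
  show "(\<integral>y. ?\<phi> y \<partial>N) \<le> measure (\<R> N) U"
  \<comment> \<open>That \<open>c\<close> is non-negative is read off from the mass of some kernel,
    so the empty space is treated apart.\<close>
  proof (cases "topspace X = {}")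
    case True
    then have "(\<integral>y. ?\<phi> y \<partial>N) = (\<integral>y. 0 \<partial>N)" by (intro Bochner_Integration.integral_cong) (auto simp: sp)
    then show ?thesis by simp
  next
    case False
    \<comment> \<open>A loss of \<open>2 * \<eta>\<close> per unit of mass comes from the good set
      \<open>D\<close> below; off \<open>D\<close>, a set of measure at most \<open>\<eta>\<close>,
      the integrand is only bounded by \<open>c\<close>.\<close>
    have "(\<integral>y. ?\<phi> y \<partial>N) \<le> measure (\<R> N) U + \<eta> * (2 * measure N (topspace X) + c)" if \<eta>: "\<eta> > 0" for \<eta>
    proof -
      define m where "m = nat \<lfloor>c / \<eta>\<rfloor>"
      \<comment> \<open>On a level set of width \<open>\<eta>\<close> the integrand has a constant
        lower bound that is nearly sharp, which is the form that
        \<open>kernel_compact_subordinate\<close> can use.\<close>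
      define E where "E k = {y\<in>topspace X. \<lfloor>?\<phi> y / \<eta>\<rfloor> = int k}" for k
      have Es: "E k \<in> sets (borel_of X)" for k
      proof -
        note meas[measurable]
        have "{y\<in>space (borel_of X). \<lfloor>?\<phi> y / \<eta>\<rfloor> = int k} \<in> sets (borel_of X)" by measurable
        then show ?thesis by (simp add: E_def)
      qed
      have E_cover: "topspace X \<subseteq> (\<Union>k\<le>m. E k)"
      proof
        fix y assume y: "y \<in> topspace X"
        have "0 \<le> \<lfloor>?\<phi> y / \<eta>\<rfloor>" using \<eta> by simp
        moreover have "\<lfloor>?\<phi> y / \<eta>\<rfloor> \<le> \<lfloor>c / \<eta>\<rfloor>"
          using measure_kernel_le[OF y] \<eta> by (intro floor_mono divide_right_mono) auto
        ultimately show "y \<in> (\<Union>k\<le>m. E k)"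
          using y by (auto simp: E_def m_def intro!: bexI[of _ "nat \<lfloor>?\<phi> y / \<eta>\<rfloor>"])
      qed
      \<comment> \<open>There are \<open>m + 1\<close> levels, so the exceptional sets have total
        measure at most \<open>\<eta>\<close>.\<close>
      have "\<exists>C. compactin X C \<and> C \<subseteq> E k \<and> measure N (E k - C) < \<eta> / (real m + 1)" for k
        using radon_inner[OF N Es, of "\<eta> / (real m + 1)" k] \<eta> by (metis add_nonneg_pos divide_pos_pos of_nat_0_le_iff zero_less_one)
      then obtain C where C: "\<And>k. compactin X (C k)" "\<And>k. C k \<subseteq> E k"
          "\<And>k. measure N (E k - C k) < \<eta> / (real m + 1)" by metis
      have Cs: "C k \<in> sets N" for k using borel_of_compact[OF Hausdorff C(1)] radon_sets[OF N] by simp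
      \<comment> \<open>On level \<open>k\<close> the integrand is at least
        \<open>\<eta> * real k\<close>, possibly with equality; going one step lower gives the
        strict inequality that is required. Together with the width of the level this accounts for
        \<open>2 * \<eta>\<close>.\<close>
      have "\<exists>f\<in>subordinate X U. \<forall>y\<in>C k. \<eta> * (real k - 1) < (\<integral>x. f x \<partial>\<K> y)" for k
      proof (rule kernel_compact_subordinate[OF U C(1)])
        fix y assume "y \<in> C k"
        then have "real_of_int \<lfloor>?\<phi> y / \<eta>\<rfloor> = real k" using C(2)[of k] by (auto simp: E_def)
        then have "real k \<le> ?\<phi> y / \<eta>" by linarith
        then have "\<eta> * real k \<le> ?\<phi> y" using \<eta> by (simp add: field_simps)
        then show "\<eta> * (real k - 1) < ?\<phi> y" using \<eta> by (simp add: algebra_simps)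
      qed
      then obtain g where g: "\<And>k. g k \<in> subordinate X U" "\<And>k y. y \<in> C k \<Longrightarrow> \<eta> * (real k - 1) < (\<integral>x. g k x \<partial>\<K> y)"
        by metis
      obtain f where f: "f \<in> subordinate X U" "\<And>k x. k \<le> m \<Longrightarrow> x \<in> topspace X \<Longrightarrow> g k x \<le> f x"
        using subordinate_directed[of "g ` {..m}" X U] g(1) by (auto simp: image_subset_iff)
      define D where "D = (\<Union>k\<le>m. C k)"
      have Ds: "D \<in> sets N" unfolding D_def using Cs by auto
      have onD: "?\<phi> y \<le> (\<integral>x. f x \<partial>\<K> y) + 2 * \<eta>" if yD: "y \<in> D" for y
      proof -
        obtain k where k: "k \<le> m" "y \<in> C k" using yD by (auto simp: D_def)
        then have y: "y \<in> topspace X" and "real_of_int \<lfloor>?\<phi> y / \<eta>\<rfloor> = real k" using C(2)[of k] by (auto simp: E_def)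
        then have "?\<phi> y / \<eta> \<le> real k + 1" by linarith
        then have "?\<phi> y \<le> \<eta> * (real k + 1)" using \<eta> by (simp add: field_simps)
        also have "\<dots> = \<eta> * (real k - 1) + 2 * \<eta>" by (simp add: algebra_simps)
        also have "\<eta> * (real k - 1) \<le> (\<integral>x. g k x \<partial>\<K> y)" using g(2)[OF k(2)] by simp
        also have "\<dots> \<le> (\<integral>x. f x \<partial>\<K> y)"
          using f g(1) k(1) radon_kernel[OF y]
          by (intro integral_mono test_functions_integrable[OF subordinate_test_functions])
             (auto simp: radon_space)
        finally show ?thesis by simp
      qed
      have "topspace X - D \<subseteq> (\<Union>k\<le>m. E k - C k)"
      proof
        fix y assume y: "y \<in> topspace X - D"
        then obtain k where "k \<le> m" "y \<in> E k" using E_cover by auto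
        moreover have "y \<notin> C k" if "k \<le> m" for k using y that by (auto simp: D_def)
        ultimately show "y \<in> (\<Union>k\<le>m. E k - C k)" by auto
      qed
      then have "measure N (topspace X - D) \<le> measure N (\<Union>k\<le>m. E k - C k)"
        using Es Cs radon_sets[OF N] by (intro N.finite_measure_mono) auto
      also have "\<dots> \<le> (\<Sum>k\<le>m. measure N (E k - C k))"
        using Es Cs radon_sets[OF N] by (intro N.finite_measure_subadditive_finite) auto
      also have "\<dots> \<le> (\<Sum>k\<le>m. \<eta> / (real m + 1))" using C(3) by (intro sum_mono) (simp add: less_imp_le)
      also have "\<dots> = \<eta>" by (simp add: field_simps)
      finally have small: "measure N (topspace X - D) \<le> \<eta>" .
      have tD: "topspace X - D \<in> sets N" using Ds sets.compl_sets[OF Ds] sp by simp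
      have f0: "0 \<le> (\<integral>x. f x \<partial>\<K> y)" if y: "y \<in> topspace X" for y
        using f(1) radon_space[OF radon_kernel[OF y]]
        by (intro Bochner_Integration.integral_nonneg_AE) (auto simp: subordinate_def Cc_pos_def)
      have intI: "integrable N (indicator (topspace X - D) :: _ \<Rightarrow> real)"
        using tD by (intro integrable_real_indicator) (auto simp: N.emeasure_eq_measure)
      note intF = intf[OF subordinate_test_functions[OF f(1)]]
      have "(\<integral>y. ?\<phi> y \<partial>N) \<le> (\<integral>y. (\<integral>x. f x \<partial>\<K> y) + 2 * \<eta> + c * indicator (topspace X - D) y \<partial>N)"
      proof (rule integral_mono[OF int])
        show "integrable N (\<lambda>y. (\<integral>x. f x \<partial>\<K> y) + 2 * \<eta> + c * indicator (topspace X - D) y)"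
          using intF intI by simp
        fix y assume "y \<in> space N"
        then show "?\<phi> y \<le> (\<integral>x. f x \<partial>\<K> y) + 2 * \<eta> + c * indicator (topspace X - D) y"
          using onD[of y] measure_kernel_le[of y U] f0[of y] \<eta> by (cases "y \<in> D") (auto simp: sp)
      qed
      also have "\<dots> = (\<integral>y. \<integral>x. f x \<partial>\<K> y \<partial>N) + 2 * \<eta> * measure N (topspace X) + c * measure N (topspace X - D)"
        using intF intI tD sets.sets_into_space[OF tD] by (simp add: sp Int_absorb2 mult.commute)
      also have "(\<integral>y. \<integral>x. f x \<partial>\<K> y \<partial>N) = (\<integral>x. f x \<partial>\<R> N)"
        by (rule integral_image[OF N subordinate_test_functions[OF f(1)], symmetric])
      also have "\<dots> \<le> measure (\<R> N) U"
        by (rule integral_subordinate_le[OF f(1) radon_image[OF N] U])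
      also have "c * measure N (topspace X - D) \<le> c * \<eta>" using small c_nonneg[OF False] by (rule mult_left_mono)
      finally show ?thesis by (simp add: algebra_simps)
    qed
    note * = this
    have pos: "0 < 2 * measure N (topspace X) + c + 1"
      using c_nonneg[OF False] by (simp add: add_nonneg_pos)
    show ?thesis
    proof (rule field_le_epsilon)
      fix e :: real assume e: "0 < e"
      let ?p = "2 * measure N (topspace X) + c"
      have "(\<integral>y. ?\<phi> y \<partial>N) \<le> measure (\<R> N) U + e / (?p + 1) * ?p" using *[of "e / (?p + 1)"] e pos by simp
      also have "e / (?p + 1) * ?p \<le> e" using e pos by (simp add: pos_divide_le_eq algebra_simps)
      finally show "(\<integral>y. ?\<phi> y \<partial>N) \<le> measure (\<R> N) U + e" by simp
    qed
  qed
qed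

text \<open>Measurability and the integral formula go through the Dynkin induction together, because
  complements and disjoint unions integrate the kernels of the previous sets. Complements use that
  all kernels have the same mass \<open>c\<close>.\<close>

proposition measure_image:
  assumes B: "B \<in> sets (borel_of X)"
  shows "(\<lambda>y. measure (\<K> y) B) \<in> borel_measurable (borel_of X)"
    and "radon X N \<Longrightarrow> measure (\<R> N) B = (\<integral>y. measure (\<K> y) B \<partial>N)"
proof -
  have Int_stable: "Int_stable {U. openin X U}" by (auto simp: Int_stable_def)
  let ?P = "\<lambda>B. (\<lambda>y. measure (\<K> y) B) \<in> borel_measurable (borel_of X) \<and>
      (\<forall>N. radon X N \<longrightarrow> measure (\<R> N) B = (\<integral>y. measure (\<K> y) B \<partial>N))"
  have "?P B"
    using Int_stable openin_Pow B[unfolded sets_borel_of]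
  proof (induction rule: sigma_sets_induct_disjoint)
    fix U assume "U \<in> {U. openin X U}"
    then show "?P U"
      using measurable_measure_kernel_open measure_image_open by auto
  next
    fix A assume A: "A \<in> sigma_sets (topspace X) {U. openin X U}" and
      IH: "?P A"
    have As: "A \<in> sets (borel_of X)" using A by (simp add: sets_borel_of)
    have compl: "measure M (topspace X - A) = measure M (topspace X) - measure M A" if M: "radon X M" for M
      using finite_measure.finite_measure_compl[OF radon_finite[OF M], of A] As
      by (simp add: radon_sets[OF M] radon_space[OF M])
    have k: "measure (\<K> y) (topspace X - A) = c - measure (\<K> y) A" if "y \<in> topspace X" for y
      using compl[OF radon_kernel[OF that]] measure_kernel_space[OF that] by simp
    have m: "(\<lambda>y. measure (\<K> y) (topspace X - A)) \<in> borel_measurable (borel_of X)"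
      by (subst measurable_cong[OF k]) (use IH in auto)
    have "measure (\<R> N) (topspace X - A) = (\<integral>y. measure (\<K> y) (topspace X - A) \<partial>N)" if N: "radon X N" for N
    proof -
      interpret N: finite_measure N by (rule radon_finite[OF N])
      have "measure (\<R> N) (topspace X) = (\<integral>y. measure (\<K> y) (topspace X) \<partial>N)"
        by (rule measure_image_open[OF N openin_topspace])
      also have "\<dots> = (\<integral>y. c \<partial>N)"
        by (intro Bochner_Integration.integral_cong) (auto simp: radon_space[OF N] measure_kernel_space)
      finally have "measure (\<R> N) (topspace X - A) = (\<integral>y. c \<partial>N) - (\<integral>y. measure (\<K> y) A \<partial>N)"
        using compl[OF radon_image[OF N]] IH N by simp
      also have "\<dots> = (\<integral>y. c - measure (\<K> y) A \<partial>N)"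
        using integrable_measure_kernel[OF N conjunct1[OF IH]] by simp
      also have "\<dots> = (\<integral>y. measure (\<K> y) (topspace X - A) \<partial>N)"
        by (intro Bochner_Integration.integral_cong) (auto simp: radon_space[OF N] k)
      finally show ?thesis .
    qed
    with m show "?P (topspace X - A)"
      by blast
  next
    fix A :: "nat \<Rightarrow> 'a set"
    assume A: "disjoint_family A" "range A \<subseteq> sigma_sets (topspace X) {U. openin X U}" and
      IH: "\<And>i. ?P (A i)"
    have As: "range A \<subseteq> sets (borel_of X)" using A by (simp add: sets_borel_of)
    have sums: "(\<lambda>i. measure M (A i)) sums measure M (\<Union>i. A i)" if M: "radon X M" for M
      using finite_measure.finite_measure_UNION[OF radon_finite[OF M], of A] As A(1)
      by (simp add: radon_sets[OF M])
    have k: "measure (\<K> y) (\<Union>i. A i) = (\<Sum>i. measure (\<K> y) (A i))" if "y \<in> topspace X" for y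
      using sums[OF radon_kernel[OF that]] by (simp add: sums_iff)
    have m: "(\<lambda>y. measure (\<K> y) (\<Union>i. A i)) \<in> borel_measurable (borel_of X)"
      by (subst measurable_cong[OF k]) (use IH in \<open>auto intro: borel_measurable_suminf\<close>)
    have "measure (\<R> N) (\<Union>i. A i) = (\<integral>y. measure (\<K> y) (\<Union>i. A i) \<partial>N)" if N: "radon X N" for N
    proof -
      note i = integrable_measure_kernel[OF N]
      have "(\<lambda>i. measure (\<R> N) (A i)) sums (\<integral>y. (\<Sum>i. measure (\<K> y) (A i)) \<partial>N)"
      proof -
        have eq: "measure (\<R> N) (A i) = (\<integral>y. measure (\<K> y) (A i) \<partial>N)" for i using IH N by blast
        show ?thesis
          unfolding eq
        proof (rule sums_integral)
          show "integrable N (\<lambda>y. measure (\<K> y) (A i))" for i using IH i by blast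
          show "AE y in N. summable (\<lambda>i. norm (measure (\<K> y) (A i)))"
            using sums_summable[OF sums[OF radon_kernel]] by (intro AE_I2) (simp add: radon_space[OF N])
          show "summable (\<lambda>i. \<integral>y. norm (measure (\<K> y) (A i)) \<partial>N)"
            using sums_summable[OF sums[OF radon_image[OF N]]] by (simp add: eq)
        qed
      qed
      also have "(\<integral>y. (\<Sum>i. measure (\<K> y) (A i)) \<partial>N) = (\<integral>y. measure (\<K> y) (\<Union>i. A i) \<partial>N)"
        by (intro Bochner_Integration.integral_cong) (auto simp: radon_space[OF N] k)
      finally show ?thesis by (rule sums_unique2[OF sums[OF radon_image[OF N]]])
    qed
    with m show "?P (\<Union>i. A i)"
      by blast
  next
    show "?P {}" by simp
  qed
  then show "(\<lambda>y. measure (\<K> y) B) \<in> borel_measurable (borel_of X)"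
    and "radon X N \<Longrightarrow> measure (\<R> N) B = (\<integral>y. measure (\<K> y) B \<partial>N)" by blast+
qed

end

section \<open>Restriction to a subset\<close>

lemma cintegral_indicator:
  assumes \<mu>: "complex_borel_measure X \<mu>" and B: "B \<in> sets (borel_of X)"
  shows "cintegral X \<mu> (indicator B) = \<mu> B"
proof -
  have "(\<integral>x. indicator B x \<partial>var_part X c \<mu>) = complex_of_real (measure (var_part X c \<mu>) B)" for c
  proof -
    interpret finite_measure "var_part X c \<mu>" by (rule finite_var_part[OF \<mu>])
    have B': "B \<in> sets (var_part X c \<mu>)" using B sets_var_part[OF \<mu>] by simp
    have "(\<integral>x. indicator B x \<partial>var_part X c \<mu>) = (\<integral>x. complex_of_real (indicator B x) \<partial>var_part X c \<mu>)"
      by (intro Bochner_Integration.integral_cong) (auto split: split_indicator)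
    also have "\<dots> = complex_of_real (\<integral>x. indicator B x \<partial>var_part X c \<mu>)" by simp
    also have "(\<integral>x. indicator B x \<partial>var_part X c \<mu>) = measure (var_part X c \<mu>) B"
      using sets.sets_into_space[OF B'] by (simp add: Int_absorb2)
    finally show ?thesis .
  qed
  then show ?thesis using complex_measure_decomposition[OF assms] by (simp add: cintegral_def)
qed

lemma cintegral_diff:
  assumes \<mu>: "complex_borel_measure X \<mu>" and "f \<in> bdd_borel X" "g \<in> bdd_borel X"
  shows "cintegral X \<mu> (\<lambda>x. f x - g x) = cintegral X \<mu> f - cintegral X \<mu> g"
  using bdd_borel_integrable[OF assms(2) finite_var_part[OF \<mu>] sets_var_part[OF \<mu>]]
    bdd_borel_integrable[OF assms(3) finite_var_part[OF \<mu>] sets_var_part[OF \<mu>]]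
  by (simp add: cintegral_def algebra_simps)

lemma cintegral_cong:
  assumes \<mu>: "complex_borel_measure X \<mu>" and "\<And>x. x \<in> topspace X \<Longrightarrow> f x = g x"
  shows "cintegral X \<mu> f = cintegral X \<mu> g"
proof -
  have "space (var_part X c \<mu>) = topspace X" for c
    using sets_eq_imp_space_eq[OF sets_var_part[OF \<mu>]] by simp
  then have "(\<integral>x. f x \<partial>var_part X c \<mu>) = (\<integral>x. g x \<partial>var_part X c \<mu>)" for c
    using assms(2) by (intro Bochner_Integration.integral_cong) auto
  then show ?thesis by (simp add: cintegral_def)
qed

lemma bdd_borel_indicator: "B \<in> sets (borel_of X) \<Longrightarrow> indicator B \<in> bdd_borel X"
  by (rule bdd_borelI[where c = 1]) (auto split: split_indicator)

lemma bdd_borel_diff: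
  assumes "f \<in> bdd_borel X" "g \<in> bdd_borel X"
  shows "(\<lambda>x. f x - g x) \<in> bdd_borel X"
proof -
  obtain c d where "\<And>x. x \<in> topspace X \<Longrightarrow> cmod (f x) \<le> c" "\<And>x. x \<in> topspace X \<Longrightarrow> cmod (g x) \<le> d"
    using assms unfolding bdd_borel_def by blast
  then have "cmod (f x - g x) \<le> c + d" if "x \<in> topspace X" for x
    using that by (meson add_mono norm_triangle_ineq4 order_trans)
  then show ?thesis
    using bdd_borel_measurable[OF assms(1)] bdd_borel_measurable[OF assms(2)]
    by (intro bdd_borelI[where c = "c + d"]) auto
qed

lemma bdd_borel_continuous:
  assumes "continuous_map X euclidean f" "bounded (f ` topspace X)"
  shows "f \<in> bdd_borel X"
  using assms borel_measurable_continuous_map[OF assms(1)] by (auto simp: bdd_borel_def bounded_iff)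

text \<open>
  Approximating a Borel set from inside by a compact set and from outside by an open set, a Urysohn
  function between the two is close to its indicator in \<open>L\<^sup>1\<close>.
\<close>

lemma cmeasures_eqI:
  assumes lc: "locally_compact_space X" and X: "Hausdorff_space X"
    and \<mu>: "\<mu> \<in> cmeasures X" and \<nu>: "\<nu> \<in> cmeasures X"
    and eq: "\<And>f. continuous_map X euclidean f \<Longrightarrow> bounded (f ` topspace X) \<Longrightarrow> cintegral X \<mu> f = cintegral X \<nu> f"
  shows "\<mu> = \<nu>"
proof
  fix B
  note c\<mu> = cmeasures_complex_borel_measure[OF \<mu>] and c\<nu> = cmeasures_complex_borel_measure[OF \<nu>]
  show "\<mu> B = \<nu> B"
  proof (cases "B \<in> sets (borel_of X)")
    case False
    then show ?thesis using c\<mu> c\<nu> by (simp add: complex_borel_measure_notin)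
  next
    case B: True
    define M where "M = add_measure (total_variation X \<mu>) (total_variation X \<nu>)"
    note r = radon_total_variation[OF X \<mu>] radon_total_variation[OF X \<nu>]
    have M: "radon X M" unfolding M_def by (intro radon_add_measure X r)
    interpret finite_measure M by (rule radon_finite[OF M])
    have dom: "cmod (\<mu> A) \<le> measure M A" "cmod (\<nu> A) \<le> measure M A" if A: "A \<in> sets (borel_of X)" for A
    proof -
      have "measure M A = measure (total_variation X \<mu>) A + measure (total_variation X \<nu>) A"
        unfolding M_def using A r by (intro measure_add_measure) (auto simp: radon_finite radon_sets)
      then show "cmod (\<mu> A) \<le> measure M A" "cmod (\<nu> A) \<le> measure M A"
        using cmod_le_total_variation[OF \<mu> A] cmod_le_total_variation[OF \<nu> A]
        by (auto intro: add_increasing add_increasing2)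
    qed
    have "cmod (\<mu> B - \<nu> B) \<le> 0 + \<epsilon>" if "\<epsilon> > 0" for \<epsilon>
    proof -
      \<comment> \<open>The gap \<open>U - C\<close> consists of two pieces of mass below
        \<open>\<epsilon> / 4\<close>, which costs \<open>\<epsilon> / 2\<close> for each of the two
        measures; \<open>M\<close> dominates both, so one function serves both.\<close>
      have e4: "\<epsilon> / 4 > 0" using \<open>\<epsilon> > 0\<close> by simp
      obtain C where C: "compactin X C" "C \<subseteq> B" "measure M (B - C) < \<epsilon> / 4"
        using radon_inner[OF M B e4] by blast
      have "topspace X - B \<in> sets (borel_of X)" using sets.compl_sets[OF B] by simp
      then obtain C' where C': "compactin X C'" "C' \<subseteq> topspace X - B" "measure M (topspace X - B - C') < \<epsilon> / 4"
        using radon_inner[OF M _ e4] by blast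
      have BX: "B \<subseteq> topspace X" using sets.sets_into_space[OF B] by simp
      define U where "U = topspace X - C'"
      have U: "openin X U" "C \<subseteq> U" "B \<subseteq> U"
        using compactin_imp_closedin[OF X C'(1)] C(2) C'(2) BX by (auto simp: U_def)
      obtain f where f: "f \<in> Cc_pos X" "\<And>x. x \<in> C \<Longrightarrow> f x = 1"
        "\<And>x. x \<in> topspace X \<Longrightarrow> 0 \<le> f x" "\<And>x. x \<in> topspace X \<Longrightarrow> f x \<le> indicator U x"
        using Urysohn_Cc_pos[OF lc X C(1) U(1,2)] by blast
      define g where "g x = complex_of_real (f x)" for x
      have "continuous_map X euclideanreal f" using f(1) by (simp add: Cc_pos_def)
      then have gc: "continuous_map X euclidean g"
        unfolding g_def by (intro continuous_map_compose[of X euclideanreal f euclidean complex_of_real, unfolded o_def])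
          (auto intro: continuous_intros)
      have gb: "bounded (g ` topspace X)"
        unfolding bounded_iff g_def using f(3,4)
        by (intro exI[of _ 1]) (fastforce split: split_indicator_asm intro: order_trans)
      note gB = bdd_borel_continuous[OF gc gb]
      note iB = bdd_borel_indicator[OF B]
      note d = bdd_borel_diff[OF iB gB]
      have meas: "B \<in> sets M" "C \<in> sets M" "C' \<in> sets M" "U \<in> sets M"
        using B borel_of_compact[OF X C(1)] borel_of_compact[OF X C'(1)] borel_of_open[OF U(1)]
        by (simp_all add: radon_sets[OF M])
      have "(\<integral>x. cmod (indicator B x - g x) \<partial>M) \<le> (\<integral>x. indicator (U - C) x \<partial>M)"
      proof (rule integral_mono)
        show "integrable M (\<lambda>x. cmod (indicator B x - g x))"
          using bdd_borel_integrable[OF d finite_measure_axioms radon_sets[OF M]] by simp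
        show "integrable M (indicator (U - C) :: _ \<Rightarrow> real)"
          using meas by (intro integrable_real_indicator) (auto simp: emeasure_eq_measure)
        fix x assume "x \<in> space M"
        then have x: "x \<in> topspace X" by (simp add: radon_space[OF M])
        have c: "cmod (1 - complex_of_real r) = \<bar>1 - r\<bar>" for r
          by (metis norm_of_real of_real_1 of_real_diff)
        show "cmod (indicator B x - g x) \<le> indicator (U - C) x"
          using f(2)[of x] f(3,4)[OF x] C(2) U(3) unfolding g_def
          by (auto simp: c split: split_indicator split_indicator_asm)
      qed
      also have "\<dots> = measure M (U - C)"
        using meas sets.sets_into_space[of "U - C" M] by (simp add: Int_absorb2)
      also have "U - C = (B - C) \<union> (topspace X - B - C')"
        using C(2) C'(2) BX by (auto simp: U_def)
      also have "measure M \<dots> \<le> measure M (B - C) + measure M (topspace X - B - C')"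
        using meas sets.top[of M] by (intro measure_Un_le) (auto simp: radon_space[OF M])
      also have "\<dots> \<le> \<epsilon> / 2" using C(3) C'(3) by simp
      finally have small: "(\<integral>x. cmod (indicator B x - g x) \<partial>M) \<le> \<epsilon> / 2" .
      have near: "cmod (\<rho> B - cintegral X \<rho> g) \<le> \<epsilon> / 2"
        if "complex_borel_measure X \<rho>" "\<And>A. A \<in> sets (borel_of X) \<Longrightarrow> cmod (\<rho> A) \<le> measure M A" for \<rho>
        using norm_cintegral_le[OF that(1) finite_measure_axioms radon_sets[OF M] that(2) d] small
          cintegral_diff[OF that(1) iB gB] cintegral_indicator[OF that(1) B] by simp
      have "cmod (\<mu> B - \<nu> B) \<le> cmod (\<mu> B - cintegral X \<mu> g) + cmod (\<nu> B - cintegral X \<nu> g)"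
        using norm_triangle_ineq4[of "\<mu> B - cintegral X \<mu> g" "\<nu> B - cintegral X \<nu> g"] eq[OF gc gb] by simp
      with near[OF c\<mu> dom(1)] near[OF c\<nu> dom(2)] show ?thesis by simp
    qed
    then have "cmod (\<mu> B - \<nu> B) \<le> 0" by (rule field_le_epsilon)
    then show ?thesis by simp
  qed
qed

section \<open>Measures on a Borel subset and their integrals\<close>

lemma sets_restrict_borel_of:
  assumes "H \<in> sets (borel_of X)" "sets M = sets (borel_of X)"
  shows "sets (restrict_space M H) = sets (borel_of (subtopology X H))"
proof -
  have "H \<inter> space M \<in> sets M" using assms sets.Int[of H M "space M"] sets.top[of M] by auto
  then show ?thesis
    using assms sets_restrict_space_iff[of H M] by (auto simp: sets_borel_of_subtopology)
qed

lemma measure_restrict_borel_of: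
  assumes "H \<in> sets (borel_of X)" "sets M = sets (borel_of X)" "B \<in> sets (borel_of (subtopology X H))"
  shows "emeasure (restrict_space M H) B = emeasure M B" "measure (restrict_space M H) B = measure M B"
proof -
  have "H \<inter> space M \<in> sets M" using assms sets.Int[of H M "space M"] sets.top[of M] by auto
  moreover have "B \<subseteq> H" using assms(1,3) by (simp add: sets_borel_of_subtopology)
  ultimately show "emeasure (restrict_space M H) B = emeasure M B" "measure (restrict_space M H) B = measure M B"
    by (simp_all add: emeasure_restrict_space measure_restrict_space)
qed

text \<open>A compact subset of a Borel set inside \<open>H\<close> is also compact in the subspace,
  so the same inner approximation works.\<close>

lemma radon_restrict_space:
  assumes H: "H \<in> sets (borel_of X)" and M: "radon X M"
  shows "radon (subtopology X H) (restrict_space M H)"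
proof -
  note st = sets_restrict_borel_of[OF H radon_sets[OF M]]
  note ms = measure_restrict_borel_of[OF H radon_sets[OF M]]
  interpret finite_measure M by (rule radon_finite[OF M])
  show ?thesis
    unfolding radon_def
  proof (intro conjI ballI allI impI)
    show "finite_measure (restrict_space M H)" 
      using ms(1)[of "space (restrict_space M H)"] sets.top[of "restrict_space M H"] st
      by (intro finite_measureI) simp
    show "sets (restrict_space M H) = sets (borel_of (subtopology X H))" by (rule st)
    fix E and \<epsilon> :: real assume E: "E \<in> sets (borel_of (subtopology X H))" and "\<epsilon> > 0"
    then have E': "E \<in> sets (borel_of X)" "E \<subseteq> H" using H by (auto simp: sets_borel_of_subtopology)
    obtain C where C: "compactin X C" "C \<subseteq> E" "measure M (E - C) < \<epsilon>"
      using radon_inner[OF M E'(1) \<open>\<epsilon> > 0\<close>] by blast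
    have "measure (restrict_space M H) (E - C) \<le> measure M (E - C)"
    proof (cases "E - C \<in> sets (borel_of (subtopology X H))")
      case False
      then show ?thesis using st by (simp add: measure_notin_sets)
    qed (simp add: ms)
    then show "\<exists>C. compactin (subtopology X H) C \<and> C \<subseteq> E \<and> measure (restrict_space M H) (E - C) < \<epsilon>"
      using C E'(2) by (intro exI[of _ C]) (auto simp: compactin_subtopology)
  qed
qed

lemma mrestrict_apply:
  "B \<in> sets (borel_of (subtopology X H)) \<Longrightarrow> mrestrict X H \<mu> B = \<mu> B"
  by (simp add: mrestrict_def)

lemma mrestrict_cmeasures:
  assumes X: "Hausdorff_space X" and H: "H \<in> sets (borel_of X)" and \<mu>: "\<mu> \<in> cmeasures X"
  shows "mrestrict X H \<mu> \<in> cmeasures (subtopology X H)"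
proof (rule cmeasures_dominated)
  note r = radon_total_variation[OF X \<mu>]
  show "Hausdorff_space (subtopology X H)" using X by (rule Hausdorff_space_subtopology)
  show "radon (subtopology X H) (restrict_space (total_variation X \<mu>) H)"
    by (rule radon_restrict_space[OF H r])
  have sub: "sets (borel_of (subtopology X H)) \<subseteq> sets (borel_of X)"
    by (auto simp: sets_borel_of_subtopology[OF H])
  show "complex_borel_measure (subtopology X H) (mrestrict X H \<mu>)"
    unfolding complex_borel_measure_def
  proof (intro conjI allI impI; (elim conjE)?)
    fix A :: "nat \<Rightarrow> 'a set" assume A: "range A \<subseteq> sets (borel_of (subtopology X H))" "disjoint_family A"
    then have "(\<lambda>n. \<mu> (A n)) sums \<mu> (\<Union>n. A n)"
      using sub by (intro complex_borel_measure_sums[OF cmeasures_complex_borel_measure[OF \<mu>]]) auto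
    moreover have "(\<Union>n. A n) \<in> sets (borel_of (subtopology X H))" using A by auto
    ultimately show "(\<lambda>n. mrestrict X H \<mu> (A n)) sums mrestrict X H \<mu> (\<Union>n. A n)"
      using A(1) by (simp add: mrestrict_apply image_subset_iff)
  qed (simp add: mrestrict_def)
  show "cmod (mrestrict X H \<mu> B) \<le> measure (restrict_space (total_variation X \<mu>) H) B"
    if "B \<in> sets (borel_of (subtopology X H))" for B
    using cmod_le_total_variation[OF \<mu>, of B] that sub measure_restrict_borel_of(2)[OF H radon_sets[OF r] that]
    by (auto simp: mrestrict_apply)
qed

lemma bdd_borel_extend:
  assumes H: "H \<in> sets (borel_of X)" and f: "f \<in> bdd_borel (subtopology X H)"
  shows "(\<lambda>x. indicator H x *\<^sub>R f x) \<in> bdd_borel X"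
proof -
  have HX: "H \<subseteq> topspace X" using sets.sets_into_space[OF H] by simp
  obtain c where c: "\<And>x. x \<in> H \<Longrightarrow> cmod (f x) \<le> c"
    using f HX unfolding bdd_borel_def by auto
  have "f \<in> borel_measurable (restrict_space (borel_of X) H)"
    using bdd_borel_measurable[OF f] measurable_cong_sets[OF sets_restrict_borel_of[OF H refl] refl, of "borel :: complex measure"]
    by simp
  then have "(\<lambda>x. indicator H x *\<^sub>R f x) \<in> borel_measurable (borel_of X)"
    using H HX by (subst (asm) borel_measurable_restrict_space_iff) (auto simp: Int_absorb2)
  then show ?thesis
    by (rule bdd_borelI[where c = "max 0 c"]) (auto split: split_indicator simp: c max.coboundedI2)
qed

text \<open>The coefficient \<open>c\<close> goes with \<open>var_part X (cnj c) \<mu>\<close>: the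
  values of \<open>\<mu>\<close> in direction \<open>c\<close> are detected by
  \<open>Re (cnj c * \<mu> A)\<close>.\<close>

definition jordan_coeffs :: "complex set" where
  "jordan_coeffs = {1, -1, \<i>, -\<i>}"

lemma jordan_decomposition:
  assumes \<mu>: "\<mu> \<in> cmeasures X"
  shows "\<mu> = (\<lambda>B. \<Sum>c\<in>jordan_coeffs. c * cmeas_of (var_part X (cnj c) \<mu>) B)"
proof
  fix B
  note c = cmeasures_complex_borel_measure[OF \<mu>]
  have ne: "(1::complex) \<noteq> -1" "(1::complex) \<noteq> \<i>" "(1::complex) \<noteq> -\<i>" "-1 \<noteq> \<i>" "-1 \<noteq> -\<i>" "\<i> \<noteq> -\<i>"
    by (auto simp: complex_eq_iff)
  have sum: "(\<Sum>c\<in>jordan_coeffs. g c) = g 1 + g (-1) + g \<i> + g (-\<i>)" for g :: "complex \<Rightarrow> complex"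
    unfolding jordan_coeffs_def using ne by (simp add: add.assoc)
  show "\<mu> B = (\<Sum>c\<in>jordan_coeffs. c * cmeas_of (var_part X (cnj c) \<mu>) B)"
  proof (cases "B \<in> sets (borel_of X)")
    case True
    show ?thesis unfolding sum using complex_measure_decomposition[OF c True]
      by (simp add: cmeas_of_def algebra_simps)
  next
    case False
    then show ?thesis
      using complex_borel_measure_notin[OF c False] sets_var_part[OF c]
      by (simp add: cmeas_of_def measure_notin_sets)
  qed
qed

text \<open>Since \<open>cmod c = 1\<close>, the variation parts are dominated by the total
  variation and inherit its regularity.\<close>

lemma radon_var_part:
  assumes X: "Hausdorff_space X" and \<mu>: "\<mu> \<in> cmeasures X" and c: "c \<in> jordan_coeffs"
  shows "radon X (var_part X (cnj c) \<mu>)"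
proof (rule radon_dominated[OF X radon_total_variation[OF X \<mu>]])
  note cm = cmeasures_complex_borel_measure[OF \<mu>]
  interpret TV: finite_measure "total_variation X \<mu>" by (rule finite_total_variation[OF cm])
  show "sets (var_part X (cnj c) \<mu>) = sets (borel_of X)" by (rule sets_var_part[OF cm])
  fix B assume B: "B \<in> sets (borel_of X)"
  show "emeasure (var_part X (cnj c) \<mu>) B \<le> emeasure (total_variation X \<mu>) B"
    unfolding emeasure_var_part[OF cm B]
  proof (rule SUP_least, safe)
    fix A assume A: "A \<in> sets (borel_of X)" "A \<subseteq> B"
    have "Re (cnj c * \<mu> A) \<le> cmod (cnj c * \<mu> A)" by (rule complex_Re_le_cmod)
    also have "\<dots> = cmod (\<mu> A)" using c by (auto simp: jordan_coeffs_def norm_mult)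
    also have "ennreal \<dots> \<le> emeasure (total_variation X \<mu>) A" by (rule emeasure_total_variation_ge[OF cm A(1)])
    also have "\<dots> \<le> emeasure (total_variation X \<mu>) B" using A B cm by (intro emeasure_mono) auto
    finally show "ennreal (Re (cnj c * \<mu> A)) \<le> emeasure (total_variation X \<mu>) B"
      by (meson ennreal_leI order_trans)
  qed
qed

lemma cintegral_jordan:
  assumes X: "Hausdorff_space X" and \<mu>: "\<mu> \<in> cmeasures X" and f: "f \<in> bdd_borel X"
  shows "cintegral X \<mu> f = (\<Sum>c\<in>jordan_coeffs. c * (\<integral>x. f x \<partial>var_part X (cnj c) \<mu>))"
proof (rule cintegral_linear_combination[OF cmeasures_complex_borel_measure[OF \<mu>] _ _ _ f])
  show "finite_measure (var_part X (cnj c) \<mu>)" "sets (var_part X (cnj c) \<mu>) = sets (borel_of X)" for c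
    using finite_var_part[OF cmeasures_complex_borel_measure[OF \<mu>]]
      sets_var_part[OF cmeasures_complex_borel_measure[OF \<mu>]] by simp_all
  show "\<mu> B = (\<Sum>c\<in>jordan_coeffs. c * complex_of_real (measure (var_part X (cnj c) \<mu>) B))" for B
    using fun_cong[OF jordan_decomposition[OF \<mu>], of B] by (simp add: cmeas_of_def)
qed

text \<open>The restrictions of the Jordan parts of \<open>\<mu>\<close> represent the restricted
  measure, and \<open>cintegral_linear_combination\<close> accepts any such representation; each
  part then obeys the ordinary rule for restricted measures.\<close>

lemma cintegral_mrestrict:
  assumes X: "Hausdorff_space X" and H: "H \<in> sets (borel_of X)" and \<mu>: "\<mu> \<in> cmeasures X"
    and f: "f \<in> bdd_borel (subtopology X H)"
  shows "cintegral (subtopology X H) (mrestrict X H \<mu>) f = cintegral X \<mu> (\<lambda>x. indicator H x *\<^sub>R f x)"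
proof -
  note rv = radon_var_part[OF X \<mu>]
  note rr = radon_restrict_space[OF H rv]
  have "cintegral (subtopology X H) (mrestrict X H \<mu>) f
    = (\<Sum>c\<in>jordan_coeffs. c * (\<integral>x. f x \<partial>restrict_space (var_part X (cnj c) \<mu>) H))"
  proof (rule cintegral_linear_combination[OF _ _ _ _ f])
    show "complex_borel_measure (subtopology X H) (mrestrict X H \<mu>)"
      by (intro cmeasures_complex_borel_measure mrestrict_cmeasures X H \<mu>)
    show "finite_measure (restrict_space (var_part X (cnj c) \<mu>) H)"
      "sets (restrict_space (var_part X (cnj c) \<mu>) H) = sets (borel_of (subtopology X H))" if "c \<in> jordan_coeffs" for c
      using radon_finite[OF rr[OF that]] radon_sets[OF rr[OF that]] by auto
    show "mrestrict X H \<mu> B = (\<Sum>c\<in>jordan_coeffs. c * complex_of_real (measure (restrict_space (var_part X (cnj c) \<mu>) H) B))"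
      if B: "B \<in> sets (borel_of (subtopology X H))" for B
      using fun_cong[OF jordan_decomposition[OF \<mu>], of B] B
        measure_restrict_borel_of(2)[OF H radon_sets[OF rv] B]
      by (simp add: cmeas_of_def mrestrict_apply)
  qed
  also have "\<dots> = (\<Sum>c\<in>jordan_coeffs. c * (\<integral>x. indicator H x *\<^sub>R f x \<partial>var_part X (cnj c) \<mu>))"
  proof (intro sum.cong refl)
    fix c assume c: "c \<in> jordan_coeffs"
    have "H \<inter> space (var_part X (cnj c) \<mu>) \<in> sets (var_part X (cnj c) \<mu>)"
      using H sets.top[of "var_part X (cnj c) \<mu>"] by (auto simp: radon_sets[OF rv[OF c]])
    then show "c * (\<integral>x. f x \<partial>restrict_space (var_part X (cnj c) \<mu>) H)
      = c * (\<integral>x. indicator H x *\<^sub>R f x \<partial>var_part X (cnj c) \<mu>)"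
      by (simp add: integral_restrict_space)
  qed
  also have "\<dots> = cintegral X \<mu> (\<lambda>x. indicator H x *\<^sub>R f x)"
    by (rule cintegral_jordan[OF X \<mu> bdd_borel_extend[OF H f], symmetric])
  finally show ?thesis .
qed

text \<open>
  Unlike \<open>mrestrict X E \<mu>\<close> this is again a measure on \<open>X\<close>, so that it can be convolved in \<open>X\<close>.
\<close>

definition mcut :: "'a topology \<Rightarrow> 'a set \<Rightarrow> 'a cmeas \<Rightarrow> 'a cmeas" where
  "mcut X E \<mu> = (\<lambda>B. if B \<in> sets (borel_of X) then \<mu> (B \<inter> E) else 0)"

lemma measure_cut:
  assumes M: "radon X M" and E: "E \<in> sets (borel_of X)" and B: "B \<in> sets (borel_of X)"
  shows "emeasure (density M (indicator E)) B = emeasure M (B \<inter> E)"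
    and "measure (density M (indicator E)) B = measure M (B \<inter> E)"
proof -
  show "emeasure (density M (indicator E)) B = emeasure M (B \<inter> E)"
    using emeasure_restricted[of E M B] E B by (simp add: radon_sets[OF M] Int_commute)
  then show "measure (density M (indicator E)) B = measure M (B \<inter> E)" by (simp add: measure_def)
qed

lemma radon_cut:
  assumes X: "Hausdorff_space X" and M: "radon X M" and E: "E \<in> sets (borel_of X)"
  shows "radon X (density M (indicator E))"
  using M E by (intro radon_dominated[OF X M])
    (auto simp: radon_sets measure_cut intro!: emeasure_mono)

lemma
  assumes X: "Hausdorff_space X" and \<mu>: "\<mu> \<in> cmeasures X" and E: "E \<in> sets (borel_of X)"
  shows mcut_cmeasures: "mcut X E \<mu> \<in> cmeasures X"
    and cmod_mcut_le: "B \<in> sets (borel_of X) \<Longrightarrow>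
      cmod (mcut X E \<mu> B) \<le> measure (density (total_variation X \<mu>) (indicator E)) B"
proof -
  note r = radon_total_variation[OF X \<mu>]
  show le: "cmod (mcut X E \<mu> B) \<le> measure (density (total_variation X \<mu>) (indicator E)) B"
    if "B \<in> sets (borel_of X)" for B
    using cmod_le_total_variation[OF \<mu>, of "B \<inter> E"] measure_cut(2)[OF r E that] that E
    by (simp add: mcut_def)
  have "complex_borel_measure X (mcut X E \<mu>)"
    unfolding complex_borel_measure_def
  proof (intro conjI allI impI; (elim conjE)?)
    fix A :: "nat \<Rightarrow> 'a set" assume A: "range A \<subseteq> sets (borel_of X)" "disjoint_family A"
    then have "(\<lambda>n. \<mu> (A n \<inter> E)) sums \<mu> (\<Union>n. A n \<inter> E)"
      using E by (intro complex_borel_measure_sums[OF cmeasures_complex_borel_measure[OF \<mu>]])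
        (auto intro: disjoint_family_subset[of A])
    moreover have "(\<Union>n. A n \<inter> E) = (\<Union>n. A n) \<inter> E" by auto
    moreover have "(\<Union>n. A n) \<in> sets (borel_of X)" using A by auto
    ultimately show "(\<lambda>n. mcut X E \<mu> (A n)) sums mcut X E \<mu> (\<Union>n. A n)"
      using A(1) by (simp add: mcut_def image_subset_iff)
  qed (simp add: mcut_def)
  then show "mcut X E \<mu> \<in> cmeasures X"
    by (rule cmeasures_dominated[OF X _ radon_cut[OF X r E] le])
qed

lemma mcut_split:
  assumes \<mu>: "\<mu> \<in> cmeasures X" and E: "E \<in> sets (borel_of X)"
  shows "(\<lambda>B. mcut X E \<mu> B + mcut X (topspace X - E) \<mu> B) = \<mu>"
proof
  fix B
  note c = cmeasures_complex_borel_measure[OF \<mu>]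
  show "mcut X E \<mu> B + mcut X (topspace X - E) \<mu> B = \<mu> B"
  proof (cases "B \<in> sets (borel_of X)")
    case True
    have "\<mu> ((B \<inter> E) \<union> (B \<inter> (topspace X - E))) = \<mu> (B \<inter> E) + \<mu> (B \<inter> (topspace X - E))"
      using True E sets.compl_sets[OF E] by (intro complex_borel_measure_Un[OF c]) auto
    moreover have "(B \<inter> E) \<union> (B \<inter> (topspace X - E)) = B" using sets.sets_into_space[OF True] by auto
    ultimately show ?thesis using True by (simp add: mcut_def)
  qed (simp add: mcut_def complex_borel_measure_notin[OF c])
qed

lemma mrestrict_mcut:
  assumes "H \<in> sets (borel_of X)"
  shows "mrestrict X H (mcut X H \<mu>) = mrestrict X H \<mu>"
  by (auto simp: mrestrict_def mcut_def sets_borel_of_subtopology[OF assms] Int_absorb2 intro!: ext)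

text \<open>The cut measure is dominated by a density concentrated on \<open>E\<close>, under which
  \<open>f - g\<close> vanishes almost everywhere.\<close>

lemma cintegral_mcut:
  assumes X: "Hausdorff_space X" and \<mu>: "\<mu> \<in> cmeasures X" and E: "E \<in> sets (borel_of X)"
    and f: "f \<in> bdd_borel X" and g: "g \<in> bdd_borel X" and eq: "\<And>x. x \<in> E \<Longrightarrow> f x = g x"
  shows "cintegral X (mcut X E \<mu>) f = cintegral X (mcut X E \<mu>) g"
proof -
  let ?M = "density (total_variation X \<mu>) (indicator E)"
  note r = radon_total_variation[OF X \<mu>]
  note rc = radon_cut[OF X r E]
  have "cmod (cintegral X (mcut X E \<mu>) (\<lambda>x. f x - g x)) \<le> (\<integral>x. cmod (f x - g x) \<partial>?M)"
    by (intro norm_cintegral_le cmeasures_complex_borel_measure mcut_cmeasures X \<mu> E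
        radon_finite[OF rc] radon_sets[OF rc] cmod_mcut_le bdd_borel_diff f g)
  also have "\<dots> = (\<integral>x. 0 \<partial>?M)"
  proof (rule integral_cong_AE)
    have "AE x in ?M. x \<in> E"
      using E by (subst AE_density) (auto simp: radon_sets[OF r] intro!: borel_measurable_indicator split: split_indicator_asm)
    then show "AE x in ?M. cmod (f x - g x) = 0" by (rule AE_mp) (auto simp: eq)
  qed (use bdd_borel_measurable[OF bdd_borel_diff[OF f g]] in \<open>auto simp: measurable_cong_sets[OF radon_sets[OF rc] refl]\<close>)
  finally show ?thesis
    using cintegral_diff[OF cmeasures_complex_borel_measure[OF mcut_cmeasures[OF X \<mu> E]] f g] by simp
qed

section \<open>The total variation norm and supports\<close>

lemma tv_norm_add:
  assumes "complex_borel_measure X \<mu>" "complex_borel_measure X \<nu>"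
  shows "tv_norm X (\<lambda>B. \<mu> B + \<nu> B) \<le> tv_norm X \<mu> + tv_norm X \<nu>"
proof -
  note top = sets.top[of "borel_of X", simplified]
  have "emeasure (total_variation X (\<lambda>B. \<mu> B + \<nu> B)) (topspace X)
    \<le> emeasure (add_measure (total_variation X \<mu>) (total_variation X \<nu>)) (topspace X)"
  proof (rule emeasure_total_variation_le[OF complex_borel_measure_add[OF assms] _ _ top])
    fix B assume B: "B \<in> sets (borel_of X)"
    have "ennreal (cmod (\<mu> B + \<nu> B)) \<le> ennreal (cmod (\<mu> B)) + ennreal (cmod (\<nu> B))"
      by (simp flip: ennreal_plus add: norm_triangle_ineq ennreal_leI)
    also have "\<dots> \<le> emeasure (total_variation X \<mu>) B + emeasure (total_variation X \<nu>) B"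
      by (intro add_mono emeasure_total_variation_ge assms B)
    finally show "ennreal (cmod (\<mu> B + \<nu> B)) \<le> emeasure (add_measure (total_variation X \<mu>) (total_variation X \<nu>)) B"
      using assms B by (simp add: emeasure_add_measure)
  qed (use assms in simp)
  then show ?thesis using assms top by (simp add: tv_norm_def emeasure_add_measure)
qed

lemma tv_norm_zero: "tv_norm X (\<lambda>B. 0) = 0"
proof -
  have c: "complex_borel_measure X (\<lambda>B. 0)" by (simp add: complex_borel_measure_def)
  have "emeasure (total_variation X (\<lambda>B. 0)) (topspace X) \<le> emeasure (null_measure (borel_of X)) (topspace X)"
    using sets.top[of "borel_of X"] by (intro emeasure_total_variation_le[OF c]) auto
  then show ?thesis by (simp add: tv_norm_def)
qed

lemma tv_norm_zeroD:
  assumes \<mu>: "complex_borel_measure X \<mu>" and "tv_norm X \<mu> = 0"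
  shows "\<mu> B = 0"
proof (cases "B \<in> sets (borel_of X)")
  case True
  then have "emeasure (total_variation X \<mu>) B \<le> emeasure (total_variation X \<mu>) (topspace X)"
    using sets.sets_into_space[OF True] sets.top[of "borel_of X"] \<mu> by (intro emeasure_mono) auto
  then have "ennreal (cmod (\<mu> B)) \<le> 0"
    using emeasure_total_variation_ge[OF \<mu> True] assms(2) by (simp add: tv_norm_def)
  then show ?thesis by simp
qed (rule complex_borel_measure_notin[OF \<mu>])

text \<open>Off the support each point has a null open neighbourhood, but uncountably many of these
  may be needed. Inner regularity reduces the claim to compact subsets of \<open>U\<close>, which
  finitely many cover.\<close>

lemma msupp_null:
  assumes X: "Hausdorff_space X" and \<mu>: "\<mu> \<in> cmeasures X" and U: "openin X U" and disj: "U \<inter> msupp X \<mu> = {}"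
  shows "emeasure (total_variation X \<mu>) U = 0"
proof -
  note r = radon_total_variation[OF X \<mu>]
  interpret finite_measure "total_variation X \<mu>" by (rule radon_finite[OF r])
  note st = radon_sets[OF r]
  have "measure (total_variation X \<mu>) U \<le> 0 + \<epsilon>" if \<epsilon>: "\<epsilon> > 0" for \<epsilon>
  proof -
    obtain C where C: "compactin X C" "C \<subseteq> U" "measure (total_variation X \<mu>) (U - C) < \<epsilon>"
      using radon_inner[OF r borel_of_open[OF U] \<epsilon>] by blast
    let ?O = "{V. openin X V \<and> emeasure (total_variation X \<mu>) V = 0}"
    have "C \<subseteq> \<Union>?O"
    proof
      fix x assume "x \<in> C"
      then have "x \<in> topspace X" "x \<notin> msupp X \<mu>" using C(2) disj openin_subset[OF U] by auto
      then show "x \<in> \<Union>?O" by (auto simp: msupp_def)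
    qed
    then obtain \<F> where F: "finite \<F>" "\<F> \<subseteq> ?O" "C \<subseteq> \<Union>\<F>"
      using C(1)[unfolded compactin_def, THEN conjunct2, rule_format, of ?O] by auto
    have Fs: "\<F> \<subseteq> sets (total_variation X \<mu>)" using F(2) st by (auto intro: borel_of_open)
    have "emeasure (total_variation X \<mu>) (\<Union>V\<in>\<F>. V) \<le> (\<Sum>V\<in>\<F>. emeasure (total_variation X \<mu>) V)"
      using Fs F(1) by (intro emeasure_subadditive_finite) auto
    also have "\<dots> = 0" using F(2) by (intro sum.neutral) auto
    finally have "emeasure (total_variation X \<mu>) (\<Union>\<F>) = 0" by simp
    moreover have Cs: "C \<in> sets (total_variation X \<mu>)" using borel_of_compact[OF X C(1)] st by simp
    moreover have "\<Union>\<F> \<in> sets (total_variation X \<mu>)" using Fs F(1) by (intro sets.finite_Union) auto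
    ultimately have "emeasure (total_variation X \<mu>) C = 0" using F(3) by (metis emeasure_eq_0)
    then have "measure (total_variation X \<mu>) C = 0" by (simp add: measure_def)
    moreover have "measure (total_variation X \<mu>) (U - C) = measure (total_variation X \<mu>) U - measure (total_variation X \<mu>) C"
      using C(2) Cs borel_of_open[OF U] st by (intro finite_measure_Diff) auto
    ultimately show ?thesis using C(3) by simp
  qed
  then have "measure (total_variation X \<mu>) U \<le> 0" by (rule field_le_epsilon)
  then have "measure (total_variation X \<mu>) U = 0" by (intro antisym measure_nonneg)
  then show ?thesis by (simp add: emeasure_eq_measure)
qed

section \<open>Convolution as a double integral\<close>

lemma bdd_borel_cong:
  assumes "\<And>x. x \<in> topspace X \<Longrightarrow> f x = g x"
  shows "f \<in> bdd_borel X \<longleftrightarrow> g \<in> bdd_borel X"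
  using assms measurable_cong[of "borel_of X" f g borel] by (auto simp: bdd_borel_def)

lemma bdd_borel_linear_combination:
  assumes "\<And>i. i \<in> I \<Longrightarrow> f i \<in> bdd_borel X"
  shows "(\<lambda>x. \<Sum>i\<in>I. a i * f i x) \<in> bdd_borel X"
proof -
  obtain c where c: "\<And>i x. i \<in> I \<Longrightarrow> x \<in> topspace X \<Longrightarrow> cmod (f i x) \<le> c i"
    using assms unfolding bdd_borel_def by (simp add: Ball_def) metis
  have "cmod (\<Sum>i\<in>I. a i * f i x) \<le> (\<Sum>i\<in>I. cmod (a i) * c i)" if "x \<in> topspace X" for x
    using c that by (intro order_trans[OF norm_sum] sum_mono) (simp add: norm_mult mult_left_mono)
  moreover have "(\<lambda>x. \<Sum>i\<in>I. a i * f i x) \<in> borel_measurable (borel_of X)"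
    using bdd_borel_measurable[OF assms] by (intro borel_measurable_sum borel_measurable_times) auto
  ultimately show ?thesis by (rule bdd_borelI[rotated])
qed

lemma bdd_borel_subtopology:
  assumes H: "H \<in> sets (borel_of X)" and f: "f \<in> bdd_borel X"
  shows "f \<in> bdd_borel (subtopology X H)"
proof -
  have "f \<in> borel_measurable (restrict_space (borel_of X) H)"
    by (rule measurable_restrict_space1[OF bdd_borel_measurable[OF f]])
  then have "f \<in> borel_measurable (borel_of (subtopology X H))"
    using measurable_cong_sets[OF sets_restrict_borel_of[OF H refl] refl, of "borel :: complex measure"] by simp
  then show ?thesis using f by (auto simp: bdd_borel_def)
qed

lemma integral_indicator_complex:
  assumes "finite_measure M" "sets M = sets (borel_of X)" "S \<in> sets (borel_of X)"
  shows "(\<integral>x. indicator S x \<partial>M) = complex_of_real (measure M S)"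
  using cintegral_cmeas_of[OF assms(1,2) bdd_borel_indicator[OF assms(3)]]
    cintegral_indicator[OF complex_borel_measure_cmeas_of[OF assms(1,2)] assms(3)]
  by (simp add: cmeas_of_def)

context cone_map
begin

lemma
  assumes f: "f \<in> bdd_borel X"
  shows kernel_integral_bdd_borel: "(\<lambda>y. \<integral>x. f x \<partial>\<K> y) \<in> bdd_borel X"
    and integral_image_bdd_borel: "radon X N \<Longrightarrow> (\<integral>x. f x \<partial>\<R> N) = (\<integral>y. \<integral>x. f x \<partial>\<K> y \<partial>N)"
proof -
  have *: "(\<lambda>y. \<integral>x. f x \<partial>\<K> y) \<in> bdd_borel X \<and> (\<integral>x. f x \<partial>\<R> N) = (\<integral>y. \<integral>x. f x \<partial>\<K> y \<partial>N)"
    if N: "radon X N" for N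
    using integral_mixture[OF radon_finite[OF N] radon_sets[OF N] radon_finite[OF radon_image[OF N]]
        radon_sets[OF radon_image[OF N]] radon_finite[OF radon_kernel] radon_sets[OF radon_kernel]
        measure_kernel_le measure_image(1) measure_image(2)[OF _ N] f] by blast
  \<comment> \<open>The claim does not mention \<open>N\<close>, whereas
    \<open>integral_mixture\<close> asks for some measure; the null measure is always at
    hand.\<close>
  show "(\<lambda>y. \<integral>x. f x \<partial>\<K> y) \<in> bdd_borel X" using *[OF radon_null_measure] by blast
  show "radon X N \<Longrightarrow> (\<integral>x. f x \<partial>\<R> N) = (\<integral>y. \<integral>x. f x \<partial>\<K> y \<partial>N)" using * by blast
qed

lemma measure_image_pos:
  assumes \<mu>: "\<mu> \<in> pos_measures X" and B: "B \<in> sets (borel_of X)"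
  shows "measure (total_variation X (T \<mu>)) B = (\<integral>y. measure (\<K> y) B \<partial>total_variation X \<mu>)"
  using measure_image(2)[OF B radon_total_variation[OF Hausdorff pos_measures_cmeasures[OF \<mu>]]]
  by (simp add: cmeas_of_total_variation[OF \<mu>])

text \<open>For an open \<open>U\<close> around \<open>z\<close>, the points \<open>y\<close> with
  \<open>measure (\<K> y) U > 0\<close> form an open neighbourhood of \<open>v\<close>, which has
  positive mass because \<open>v\<close> is in the support. So the integral that computes the image
  mass of \<open>U\<close> is positive.\<close>

lemma msupp_imageI:
  assumes \<mu>: "\<mu> \<in> pos_measures X" and v: "v \<in> msupp X \<mu>" and z: "z \<in> msupp X (T (dirac X v))"
  shows "z \<in> msupp X (T \<mu>)"
  unfolding msupp_def
proof (intro CollectI conjI allI impI)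
  show "z \<in> topspace X" using z by (simp add: msupp_def)
  note r = radon_total_variation[OF Hausdorff pos_measures_cmeasures[OF \<mu>]]
  note rT = radon_total_variation[OF Hausdorff pos_measures_cmeasures[OF T_pos[OF \<mu>]]]
  interpret T: finite_measure "total_variation X (T \<mu>)" by (rule radon_finite[OF rT])
  fix U assume U: "openin X U \<and> z \<in> U"
  have vX: "v \<in> topspace X" using v by (simp add: msupp_def)
  interpret Kv: finite_measure "\<K> v" by (rule radon_finite[OF radon_kernel[OF vX]])
  let ?V = "{y\<in>topspace X. 0 < measure (\<K> y) U}"
  have V: "openin X ?V" using U openin_measure_kernel by blast
  have Us: "U \<in> sets (borel_of X)" using U by (simp add: borel_of_open)
  have "0 < emeasure (\<K> v) U" using z U unfolding msupp_def by blast
  then have "v \<in> ?V" using vX by (simp add: Kv.emeasure_eq_measure)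
  then have Vpos: "0 < emeasure (total_variation X \<mu>) ?V" using v V unfolding msupp_def by blast
  have "measure (total_variation X (T \<mu>)) U \<noteq> 0"
  proof
    assume "measure (total_variation X (T \<mu>)) U = 0"
    then have "(\<integral>y. measure (\<K> y) U \<partial>total_variation X \<mu>) = 0"
      using measure_image_pos[OF \<mu> Us] by simp
    then have "AE y in total_variation X \<mu>. measure (\<K> y) U = 0"
      using integrable_measure_kernel[OF r measure_image(1)[OF Us]]
      by (subst (asm) integral_nonneg_eq_0_iff_AE) auto
    then have "AE y in total_variation X \<mu>. y \<notin> ?V" by (rule AE_mp) auto
    then have "emeasure (total_variation X \<mu>) ?V = 0"
      using borel_of_open[OF V] AE_iff_null_sets[of ?V "total_variation X \<mu>"] radon_sets[OF r] by auto
    with Vpos show False by simp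
  qed
  then show "0 < emeasure (total_variation X (T \<mu>)) U"
    by (simp add: T.emeasure_eq_measure zero_less_measure_iff)
qed

text \<open>If \<open>z\<close> avoids the compact supports of all kernels over
  \<open>msupp X \<mu>\<close>, it is separated from each by open sets. Continuity into the Michael
  topology keeps the separation for nearby points, and compactness of \<open>msupp X \<mu>\<close>
  leaves one neighbourhood of \<open>z\<close> that is null for all these kernels, hence for the
  image.\<close>

lemma msupp_imageD:
  assumes \<mu>: "\<mu> \<in> pos_measures X" and comp: "compactin X (msupp X \<mu>)" and c: "c \<noteq> 0"
    and Scomp: "\<And>y. y \<in> topspace X \<Longrightarrow> compactin X (msupp X (T (dirac X y)))"
    and Scont: "continuous_map X (michael_topology X) (\<lambda>y. msupp X (T (dirac X y)))"
    and z: "z \<in> msupp X (T \<mu>)"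
  shows "\<exists>v\<in>msupp X \<mu>. z \<in> msupp X (T (dirac X v))"
proof (rule ccontr)
  let ?S = "\<lambda>y. msupp X (T (dirac X y))"
  assume neg: "\<not> (\<exists>v\<in>msupp X \<mu>. z \<in> ?S v)"
  have zX: "z \<in> topspace X" using z by (simp add: msupp_def)
  have CX: "msupp X \<mu> \<subseteq> topspace X" by (auto simp: msupp_def)
  have "\<exists>V N. openin X V \<and> openin X N \<and> ?S v \<subseteq> V \<and> z \<in> N \<and> V \<inter> N = {}" if v: "v \<in> msupp X \<mu>" for v
  proof -
    have "compactin X (?S v)" "compactin X {z}" "disjnt (?S v) {z}"
      using Scomp[of v] v CX neg zX by auto
    then show ?thesis
      using Hausdorff unfolding Hausdorff_space_compact_sets disjnt_def by (meson insert_subset)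
  qed
  then obtain V N where VN: "\<And>v. v \<in> msupp X \<mu> \<Longrightarrow> openin X (V v)" "\<And>v. v \<in> msupp X \<mu> \<Longrightarrow> openin X (N v)"
    "\<And>v. v \<in> msupp X \<mu> \<Longrightarrow> ?S v \<subseteq> V v" "\<And>v. v \<in> msupp X \<mu> \<Longrightarrow> z \<in> N v" "\<And>v. v \<in> msupp X \<mu> \<Longrightarrow> V v \<inter> N v = {}"
    by metis
  define G where "G v = {y\<in>topspace X. ?S y \<in> {C. compactin X C \<and> C \<inter> topspace X \<noteq> {} \<and> C \<subseteq> V v}}" for v
  have "openin X (G v)" if v: "v \<in> msupp X \<mu>" for v
    unfolding G_def
  proof (rule openin_continuous_map_preimage[OF Scont])
    show "openin (michael_topology X) {C. compactin X C \<and> C \<inter> topspace X \<noteq> {} \<and> C \<subseteq> V v}"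
      unfolding michael_topology_def using VN(1)[OF v] by (intro topology_generated_by_Basis) blast
  qed
  moreover have "v \<in> G v" if v: "v \<in> msupp X \<mu>" for v
  proof -
    have vX: "v \<in> topspace X" using v CX by auto
    note Tv = T_pos[OF dirac_pos_measures[OF Hausdorff vX]]
    \<comment> \<open>The sub-basic sets of the Michael topology contain non-empty sets only;
      supports are non-empty because the kernels have mass \<open>c \<noteq> 0\<close>.\<close>
    have "?S v \<inter> topspace X \<noteq> {}"
    proof
      assume "?S v \<inter> topspace X = {}"
      then have "emeasure (\<K> v) (topspace X) = 0"
        by (intro msupp_null Hausdorff pos_measures_cmeasures Tv) auto
      then show False using measure_kernel_space[OF vX] c by (simp add: measure_def)
    qed
    then show ?thesis using VN(3)[OF v] Scomp[OF vX] vX by (simp add: G_def)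
  qed
  then have "msupp X \<mu> \<subseteq> \<Union> (G ` msupp X \<mu>)" by blast
  ultimately have "\<exists>\<F>. finite \<F> \<and> \<F> \<subseteq> G ` msupp X \<mu> \<and> msupp X \<mu> \<subseteq> \<Union>\<F>"
    using comp[unfolded compactin_def, THEN conjunct2, rule_format, of "G ` msupp X \<mu>"] by blast
  then obtain F where F: "finite F" "F \<subseteq> msupp X \<mu>" "msupp X \<mu> \<subseteq> \<Union> (G ` F)"
    by (metis finite_subset_image)
  \<comment> \<open>The factor \<open>topspace X\<close> matters for empty \<open>F\<close>, where
    the intersection alone would be \<open>UNIV\<close>.\<close>
  define W where "W = topspace X \<inter> (\<Inter>v\<in>F. N v)"
  have "openin X W"
  proof (cases "F = {}")
    case True
    then show ?thesis by (simp add: W_def)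
  next
    case False
    then show ?thesis using F(1,2) VN(2) unfolding W_def by (intro openin_Int openin_Inter) auto
  qed
  have zW: "z \<in> W" using zX VN(4) F(2) by (auto simp: W_def)
  have K0: "measure (\<K> y) W = 0" if y: "y \<in> msupp X \<mu>" for y
  proof -
    obtain v where v: "v \<in> F" "y \<in> G v" using F(3) y by auto
    then have "?S y \<subseteq> V v" by (auto simp: G_def)
    moreover have "W \<subseteq> N v" using v(1) by (auto simp: W_def)
    ultimately have "W \<inter> ?S y = {}" using VN(5)[of v] v(1) F(2) by blast
    then have "emeasure (\<K> y) W = 0"
      using y CX by (intro msupp_null Hausdorff pos_measures_cmeasures T_pos dirac_pos_measures \<open>openin X W\<close>) auto
    then show ?thesis by (simp add: measure_def)
  qed
  note r = radon_total_variation[OF Hausdorff pos_measures_cmeasures[OF \<mu>]]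
  note rT = radon_total_variation[OF Hausdorff pos_measures_cmeasures[OF T_pos[OF \<mu>]]]
  interpret T: finite_measure "total_variation X (T \<mu>)" by (rule radon_finite[OF rT])
  have Ws: "W \<in> sets (borel_of X)" by (rule borel_of_open[OF \<open>openin X W\<close>])
  have op: "openin X (topspace X - msupp X \<mu>)" using compactin_imp_closedin[OF Hausdorff comp] by auto
  then have "emeasure (total_variation X \<mu>) (topspace X - msupp X \<mu>) = 0"
    by (intro msupp_null Hausdorff pos_measures_cmeasures \<mu>) auto
  then have "AE y in total_variation X \<mu>. y \<in> msupp X \<mu>"
    using borel_of_open[OF op]
    by (intro AE_I[where N = "topspace X - msupp X \<mu>"]) (auto simp: radon_sets[OF r] radon_space[OF r])
  then have "AE y in total_variation X \<mu>. measure (\<K> y) W = 0" by (rule AE_mp) (auto simp: K0)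
  then have "(\<integral>y. measure (\<K> y) W \<partial>total_variation X \<mu>) = 0" by (rule integral_eq_zero_AE)
  then have "emeasure (total_variation X (T \<mu>)) W = 0"
    using measure_image_pos[OF \<mu> Ws] by (simp add: T.emeasure_eq_measure)
  moreover have "0 < emeasure (total_variation X (T \<mu>)) W" using z zW \<open>openin X W\<close> unfolding msupp_def by blast
  ultimately show False by simp
qed

end

section \<open>Convolution with a fixed positive measure as a map on the cone\<close>

context semitopological_semihypergroup
begin

lemma dirac_pos: "x \<in> topspace X \<Longrightarrow> dirac X x \<in> pos_measures X"
  by (rule dirac_pos_measures[OF Hausdorff])

lemma cmeas_of_pos: "radon X M \<Longrightarrow> cmeas_of M \<in> pos_measures X"
  by (rule cmeas_of_pos_measures[OF Hausdorff])

lemma cone_map_left: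
  assumes "\<nu> \<in> pos_measures X" "\<And>x. x \<in> topspace X \<Longrightarrow> (dirac X x \<star> \<nu>) (topspace X) = complex_of_real c"
  shows "cone_map X (\<lambda>\<mu>. \<mu> \<star> \<nu>) c"
  by unfold_locales
    (use assms in \<open>auto simp: locally_compact Hausdorff positive add_left scale_left cone_continuous_left
      pos_measures_cmeasures[of _ X]\<close>)

lemma cone_map_right:
  assumes "\<mu> \<in> pos_measures X" "\<And>y. y \<in> topspace X \<Longrightarrow> (\<mu> \<star> dirac X y) (topspace X) = complex_of_real c"
  shows "cone_map X (\<lambda>\<nu>. \<mu> \<star> \<nu>) c"
  by unfold_locales
    (use assms in \<open>auto simp: locally_compact Hausdorff positive add_right scale_right cone_continuous_right
      pos_measures_cmeasures[of _ X]\<close>)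

lemma cone_map_left_dirac: "y \<in> topspace X \<Longrightarrow> cone_map X (\<lambda>\<mu>. \<mu> \<star> dirac X y) 1"
  by (rule cone_map_left) (auto simp: dirac_pos dirac_probability)

lemma cone_map_right_dirac: "x \<in> topspace X \<Longrightarrow> cone_map X (\<lambda>\<nu>. dirac X x \<star> \<nu>) 1"
  by (rule cone_map_right) (auto simp: dirac_pos dirac_probability)

abbreviation point_conv :: "'a \<Rightarrow> 'a \<Rightarrow> 'a measure" where
  "point_conv x y \<equiv> total_variation X (dirac X x \<star> dirac X y)"

lemma radon_point_conv: "x \<in> topspace X \<Longrightarrow> y \<in> topspace X \<Longrightarrow> radon X (point_conv x y)"
  by (intro radon_total_variation Hausdorff pos_measures_cmeasures positive dirac_pos)

lemma Re_dirac_conv: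
  assumes "x \<in> topspace X" "y \<in> topspace X"
  shows "Re ((dirac X x \<star> dirac X y) E) = measure (point_conv x y) E"
  using fun_cong[OF cmeas_of_total_variation[OF positive[OF dirac_pos dirac_pos]], OF assms, of E]
  by (metis Re_complex_of_real cmeas_of_def)

lemma pos_measures_eq:
  assumes "\<mu> \<in> pos_measures X"
  shows "\<mu> B = complex_of_real (measure (total_variation X \<mu>) B)"
  using fun_cong[OF cmeas_of_total_variation[OF assms], of B] by (simp add: cmeas_of_def)

text \<open>That all \<open>M \<star> p_y\<close> have the same mass is seen from the other factor:
  they are images of \<open>M\<close> under \<open>\<mu> \<mapsto> \<mu> \<star> p_y\<close>, whose
  kernels \<open>p_x \<star> p_y\<close> have mass \<open>1\<close>.\<close>

lemma cone_map_right_radon: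
  assumes M: "radon X M"
  shows "cone_map X (\<lambda>\<nu>. cmeas_of M \<star> \<nu>) (measure M (topspace X))"
proof (rule cone_map_right[OF cmeas_of_pos[OF M]])
  fix y assume y: "y \<in> topspace X"
  interpret cone_map X "\<lambda>\<mu>. \<mu> \<star> dirac X y" 1 by (rule cone_map_left_dirac[OF y])
  interpret M: finite_measure M by (rule radon_finite[OF M])
  have "measure (\<R> M) (topspace X) = (\<integral>x. measure (\<K> x) (topspace X) \<partial>M)"
    using sets.top[of "borel_of X"] by (intro measure_image(2) M) auto
  also have "\<dots> = (\<integral>x. 1 \<partial>M)"
    by (intro Bochner_Integration.integral_cong) (auto simp: radon_space[OF M] measure_kernel_space)
  also have "\<dots> = measure M (topspace X)" by (simp add: radon_space[OF M])
  finally show "(cmeas_of M \<star> dirac X y) (topspace X) = complex_of_real (measure M (topspace X))"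
    using pos_measures_eq[OF T_pos[OF cmeas_of_pos[OF M]], of "topspace X"] by simp
qed

lemma cone_map_left_radon:
  assumes N: "radon X N"
  shows "cone_map X (\<lambda>\<mu>. \<mu> \<star> cmeas_of N) (measure N (topspace X))"
proof (rule cone_map_left[OF cmeas_of_pos[OF N]])
  fix x assume x: "x \<in> topspace X"
  interpret cone_map X "\<lambda>\<nu>. dirac X x \<star> \<nu>" 1 by (rule cone_map_right_dirac[OF x])
  interpret N: finite_measure N by (rule radon_finite[OF N])
  have "measure (\<R> N) (topspace X) = (\<integral>y. measure (\<K> y) (topspace X) \<partial>N)"
    using sets.top[of "borel_of X"] by (intro measure_image(2) N) auto
  also have "\<dots> = (\<integral>y. 1 \<partial>N)"
    by (intro Bochner_Integration.integral_cong) (auto simp: radon_space[OF N] measure_kernel_space)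
  also have "\<dots> = measure N (topspace X)" by (simp add: radon_space[OF N])
  finally show "(dirac X x \<star> cmeas_of N) (topspace X) = complex_of_real (measure N (topspace X))"
    using pos_measures_eq[OF T_pos[OF cmeas_of_pos[OF N]], of "topspace X"] by simp
qed

lemma cmeasures_linear_combination:
  assumes "finite I" "\<And>i. i \<in> I \<Longrightarrow> \<mu> i \<in> cmeasures X"
  shows "(\<lambda>B. \<Sum>i\<in>I. a i * \<mu> i B) \<in> cmeasures X"
  using assms
proof (induction I rule: finite_induct)
  case empty
  then show ?case using pos_measures_cmeasures[OF pos_measures_zero[OF Hausdorff]] by simp
next
  case (insert i I)
  then show ?case using cmeasures_add[OF Hausdorff cmeasures_scale[OF Hausdorff]] by simp
qed

lemma zero_cmeasures: "(\<lambda>B. 0) \<in> cmeasures X"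
  by (rule pos_measures_cmeasures[OF pos_measures_zero[OF Hausdorff]])

lemma conv_zero_left: "\<nu> \<in> cmeasures X \<Longrightarrow> (\<lambda>B. 0) \<star> \<nu> = (\<lambda>B. 0)"
  using scale_left[OF zero_cmeasures, of \<nu> 0] by simp

lemma conv_zero_right: "\<nu> \<in> cmeasures X \<Longrightarrow> \<nu> \<star> (\<lambda>B. 0) = (\<lambda>B. 0)"
  using scale_right[OF _ zero_cmeasures, of \<nu> 0] by simp

lemma conv_sum_left:
  assumes "finite I" "\<And>i. i \<in> I \<Longrightarrow> \<mu> i \<in> cmeasures X" "\<nu> \<in> cmeasures X"
  shows "(\<lambda>B. \<Sum>i\<in>I. a i * \<mu> i B) \<star> \<nu> = (\<lambda>B. \<Sum>i\<in>I. a i * (\<mu> i \<star> \<nu>) B)"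
  using assms
proof (induction I rule: finite_induct)
  case empty
  then show ?case using conv_zero_left by simp
next
  case (insert i I)
  then show ?case
    using add_left[OF cmeasures_scale[OF Hausdorff, of "\<mu> i" "a i"] cmeasures_linear_combination[of I \<mu> a], of \<nu>]
      scale_left[of "\<mu> i" \<nu> "a i"] by simp
qed

lemma conv_sum_right:
  assumes "finite I" "\<And>i. i \<in> I \<Longrightarrow> \<mu> i \<in> cmeasures X" "\<nu> \<in> cmeasures X"
  shows "\<nu> \<star> (\<lambda>B. \<Sum>i\<in>I. a i * \<mu> i B) = (\<lambda>B. \<Sum>i\<in>I. a i * (\<nu> \<star> \<mu> i) B)"
  using assms
proof (induction I rule: finite_induct)
  case empty
  then show ?case using conv_zero_right by simp
next
  case (insert i I)
  then show ?case
    using add_right[OF cmeasures_scale[OF Hausdorff, of "\<mu> i" "a i"] cmeasures_linear_combination[of I \<mu> a], of \<nu>]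
      scale_right[of \<nu> "\<mu> i" "a i"] by simp
qed

lemma finite_jordan_coeffs: "finite jordan_coeffs"
  by (simp add: jordan_coeffs_def)

text \<open>For a positive part \<open>M\<close> of \<open>\<alpha>\<close>, disintegrating the
  first factor turns the inner integral into the integral of \<open>f\<close> against
  \<open>M \<star> p_y\<close>. As a function of \<open>y\<close> this is a kernel integral of
  \<open>\<nu> \<mapsto> M \<star> \<nu>\<close>, so it is Borel and can be integrated over the
  second factor. Bilinearity and the Jordan parts give the complex case.\<close>

lemma
  assumes \<alpha>: "\<alpha> \<in> cmeasures X" and \<beta>: "\<beta> \<in> cmeasures X" and f: "f \<in> bdd_borel X"
  shows conv_inner_bdd_borel: "(\<lambda>y. cintegral X \<alpha> (\<lambda>x. \<integral>t. f t \<partial>point_conv x y)) \<in> bdd_borel X"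
    and cintegral_conv: "cintegral X (\<alpha> \<star> \<beta>) f
      = cintegral X \<beta> (\<lambda>y. cintegral X \<alpha> (\<lambda>x. \<integral>t. f t \<partial>point_conv x y))"
proof -
  let ?J = jordan_coeffs
  define M where "M c = var_part X (cnj c) \<alpha>" for c
  define N where "N c = var_part X (cnj c) \<beta>" for c
  have M: "radon X (M c)" and N: "radon X (N c)" if "c \<in> ?J" for c
    using radon_var_part[OF Hausdorff] \<alpha> \<beta> that by (auto simp: M_def N_def)
  have pM: "cmeas_of (M c) \<in> cmeasures X" and pN: "cmeas_of (N c) \<in> cmeasures X" if "c \<in> ?J" for c
    using M N that by (auto intro: pos_measures_cmeasures cmeas_of_pos)
  define h where "h y = cintegral X \<alpha> (\<lambda>x. \<integral>t. f t \<partial>point_conv x y)" for y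
  define k where "k c y = (\<integral>t. f t \<partial>total_variation X (cmeas_of (M c) \<star> dirac X y))" for c y
  have h: "h y = (\<Sum>c\<in>?J. c * k c y)" if y: "y \<in> topspace X" for y
  proof -
    interpret cone_map X "\<lambda>\<mu>. \<mu> \<star> dirac X y" 1 by (rule cone_map_left_dirac[OF y])
    show ?thesis
      unfolding h_def k_def cintegral_jordan[OF Hausdorff \<alpha> kernel_integral_bdd_borel[OF f]] M_def[symmetric]
      by (intro sum.cong refl arg_cong2[of _ _ _ _ "(*)"] integral_image_bdd_borel[OF f M, symmetric])
  qed
  have kb: "k c \<in> bdd_borel X" if c: "c \<in> ?J" for c
  proof -
    interpret cone_map X "\<lambda>\<nu>. cmeas_of (M c) \<star> \<nu>" "measure (M c) (topspace X)" by (rule cone_map_right_radon[OF M[OF c]])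
    show ?thesis using kernel_integral_bdd_borel[OF f] unfolding k_def[abs_def] .
  qed
  have hb: "h \<in> bdd_borel X"
    using bdd_borel_linear_combination[of ?J k X "\<lambda>c. c", OF kb] bdd_borel_cong[of X h, OF h] by blast
  then show "(\<lambda>y. cintegral X \<alpha> (\<lambda>x. \<integral>t. f t \<partial>point_conv x y)) \<in> bdd_borel X" by (simp add: h_def[abs_def])
  define R where "R c d = total_variation X (cmeas_of (M c) \<star> cmeas_of (N d))" for c d
  have R: "radon X (R c d)" if "c \<in> ?J" "d \<in> ?J" for c d
    unfolding R_def using that M N by (intro radon_total_variation Hausdorff closed pM pN)
  have kR: "(\<integral>y. k c y \<partial>N d) = (\<integral>t. f t \<partial>R c d)" if c: "c \<in> ?J" and d: "d \<in> ?J" for c d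
  proof -
    interpret cone_map X "\<lambda>\<nu>. cmeas_of (M c) \<star> \<nu>" "measure (M c) (topspace X)" by (rule cone_map_right_radon[OF M[OF c]])
    show ?thesis using integral_image_bdd_borel[OF f N[OF d]] by (simp add: k_def R_def)
  qed
  have "cintegral X \<beta> h = (\<Sum>d\<in>?J. d * (\<integral>y. h y \<partial>N d))"
    unfolding N_def by (rule cintegral_jordan[OF Hausdorff \<beta> hb])
  also have "\<dots> = (\<Sum>d\<in>?J. d * (\<Sum>c\<in>?J. c * (\<integral>t. f t \<partial>R c d)))"
  proof (intro sum.cong refl arg_cong2[of _ _ _ _ "(*)"])
    fix d assume d: "d \<in> ?J"
    have "(\<integral>y. h y \<partial>N d) = (\<integral>y. (\<Sum>c\<in>?J. c * k c y) \<partial>N d)"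
      by (intro Bochner_Integration.integral_cong) (auto simp: radon_space[OF N[OF d]] h)
    also have "\<dots> = (\<Sum>c\<in>?J. c * (\<integral>y. k c y \<partial>N d))"
      using bdd_borel_integrable[OF kb radon_finite[OF N[OF d]] radon_sets[OF N[OF d]]]
      by (subst Bochner_Integration.integral_sum) auto
    also have "\<dots> = (\<Sum>c\<in>?J. c * (\<integral>t. f t \<partial>R c d))" using kR d by (intro sum.cong) auto
    finally show "(\<integral>y. h y \<partial>N d) = (\<Sum>c\<in>?J. c * (\<integral>t. f t \<partial>R c d))" .
  qed
  \<comment> \<open>Pairs are read as \<open>(d, c)\<close>: \<open>fst\<close> indexes the parts of
    \<open>\<beta>\<close>, \<open>snd\<close> those of \<open>\<alpha>\<close>.\<close>
  also have "\<dots> = (\<Sum>p\<in>?J \<times> ?J. (fst p * snd p) * (\<integral>t. f t \<partial>R (snd p) (fst p)))"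
    unfolding sum_distrib_left by (simp add: sum.cartesian_product mult.assoc case_prod_beta)
  also have "\<dots> = cintegral X (\<alpha> \<star> \<beta>) f"
  proof (rule cintegral_linear_combination[symmetric, OF _ _ _ _ f])
    show "complex_borel_measure X (\<alpha> \<star> \<beta>)" by (intro cmeasures_complex_borel_measure closed \<alpha> \<beta>)
    show "finite_measure (R (snd p) (fst p))" "sets (R (snd p) (fst p)) = sets (borel_of X)" if "p \<in> ?J \<times> ?J" for p
      using radon_finite[OF R] radon_sets[OF R] that by auto
    fix B
    have Req: "(cmeas_of (M c) \<star> cmeas_of (N d)) B = complex_of_real (measure (R c d) B)" if "c \<in> ?J" "d \<in> ?J" for c d
      unfolding R_def using that M N by (intro pos_measures_eq positive cmeas_of_pos)
    have "\<alpha> \<star> \<beta> = (\<lambda>B. \<Sum>c\<in>?J. c * cmeas_of (M c) B) \<star> (\<lambda>B. \<Sum>d\<in>?J. d * cmeas_of (N d) B)"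
      unfolding M_def N_def using jordan_decomposition[OF \<alpha>] jordan_decomposition[OF \<beta>] by simp
    also have "\<dots> = (\<lambda>B. \<Sum>d\<in>?J. d * ((\<lambda>B. \<Sum>c\<in>?J. c * cmeas_of (M c) B) \<star> cmeas_of (N d)) B)"
      by (intro conv_sum_right finite_jordan_coeffs pN cmeasures_linear_combination pM)
    also have "\<dots> = (\<lambda>B. \<Sum>d\<in>?J. d * (\<Sum>c\<in>?J. c * (cmeas_of (M c) \<star> cmeas_of (N d)) B))"
      using conv_sum_left[where a = "\<lambda>c. c", OF finite_jordan_coeffs pM pN]
      by (intro ext sum.cong refl) simp
    finally have "(\<alpha> \<star> \<beta>) B = (\<Sum>d\<in>?J. d * (\<Sum>c\<in>?J. c * (cmeas_of (M c) \<star> cmeas_of (N d)) B))" by simp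
    also have "\<dots> = (\<Sum>d\<in>?J. d * (\<Sum>c\<in>?J. c * complex_of_real (measure (R c d) B)))"
      using Req by simp
    also have "\<dots> = (\<Sum>p\<in>?J \<times> ?J. (fst p * snd p) * complex_of_real (measure (R (snd p) (fst p)) B))"
      unfolding sum_distrib_left by (simp add: sum.cartesian_product mult.assoc case_prod_beta)
    finally show "(\<alpha> \<star> \<beta>) B = (\<Sum>p\<in>?J \<times> ?J. (fst p * snd p) * complex_of_real (measure (R (snd p) (fst p)) B))" .
  qed
  finally show "cintegral X (\<alpha> \<star> \<beta>) f = cintegral X \<beta> (\<lambda>y. cintegral X \<alpha> (\<lambda>x. \<integral>t. f t \<partial>point_conv x y))"
    by (simp add: h_def[abs_def])
qed

text \<open>\<open>norm_cintegral_le\<close> is applied to each of the two integrals in turn. The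
  intermediate bound is the mass of \<open>S\<close> under \<open>A \<star> p_y\<close>, computed
  along the first factor and then integrated along the second.\<close>

lemma cmod_conv_le:
  assumes \<alpha>: "\<alpha> \<in> cmeasures X" and \<beta>: "\<beta> \<in> cmeasures X"
    and A: "radon X A" "\<And>B. B \<in> sets (borel_of X) \<Longrightarrow> cmod (\<alpha> B) \<le> measure A B"
    and B: "radon X B" "\<And>S. S \<in> sets (borel_of X) \<Longrightarrow> cmod (\<beta> S) \<le> measure B S"
    and S: "S \<in> sets (borel_of X)"
  shows "cmod ((\<alpha> \<star> \<beta>) S) \<le> measure (total_variation X (cmeas_of A \<star> cmeas_of B)) S"
proof -
  note iS = bdd_borel_indicator[OF S]
  define h where "h y = cintegral X \<alpha> (\<lambda>x. \<integral>t. indicator S t \<partial>point_conv x y)" for y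
  have hb: "h \<in> bdd_borel X" using conv_inner_bdd_borel[OF \<alpha> \<beta> iS] by (simp add: h_def[abs_def])
  interpret R: cone_map X "\<lambda>\<nu>. cmeas_of A \<star> \<nu>" "measure A (topspace X)" by (rule cone_map_right_radon[OF A(1)])
  have "(\<alpha> \<star> \<beta>) S = cintegral X \<beta> h"
    using cintegral_conv[OF \<alpha> \<beta> iS] cintegral_indicator[OF cmeasures_complex_borel_measure[OF closed[OF \<alpha> \<beta>]] S]
    by (simp add: h_def[abs_def])
  also have "cmod \<dots> \<le> (\<integral>y. cmod (h y) \<partial>B)"
    by (rule norm_cintegral_le[OF cmeasures_complex_borel_measure[OF \<beta>] radon_finite[OF B(1)] radon_sets[OF B(1)] B(2) hb])
  also have "\<dots> \<le> (\<integral>y. measure (R.\<K> y) S \<partial>B)"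
  proof (rule integral_mono)
    show "integrable B (\<lambda>y. cmod (h y))"
      using bdd_borel_integrable[OF hb radon_finite[OF B(1)] radon_sets[OF B(1)]] by simp
    show "integrable B (\<lambda>y. measure (R.\<K> y) S)"
      by (rule R.integrable_measure_kernel[OF B(1) R.measure_image(1)[OF S]])
    fix y assume "y \<in> space B"
    then have y: "y \<in> topspace X" by (simp add: radon_space[OF B(1)])
    interpret L: cone_map X "\<lambda>\<mu>. \<mu> \<star> dirac X y" 1 by (rule cone_map_left_dirac[OF y])
    have "cmod (h y) \<le> (\<integral>x. cmod (\<integral>t. indicator S t \<partial>L.\<K> x) \<partial>A)"
      unfolding h_def
      by (rule norm_cintegral_le[OF cmeasures_complex_borel_measure[OF \<alpha>] radon_finite[OF A(1)] radon_sets[OF A(1)]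
            A(2) L.kernel_integral_bdd_borel[OF iS]])
    also have "\<dots> = (\<integral>x. measure (L.\<K> x) S \<partial>A)"
    proof (rule Bochner_Integration.integral_cong[OF refl])
      fix x assume "x \<in> space A"
      then have "radon X (L.\<K> x)" by (intro L.radon_kernel) (simp add: radon_space[OF A(1)])
      then show "cmod (\<integral>t. indicator S t \<partial>L.\<K> x) = measure (L.\<K> x) S"
        by (simp add: integral_indicator_complex[OF radon_finite radon_sets S])
    qed
    also have "\<dots> = measure (R.\<K> y) S" by (rule L.measure_image(2)[OF S A(1), symmetric])
    finally show "cmod (h y) \<le> measure (R.\<K> y) S" .
  qed
  also have "\<dots> = measure (total_variation X (cmeas_of A \<star> cmeas_of B)) S"
    by (rule R.measure_image(2)[OF S B(1), symmetric])
  finally show ?thesis .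
qed

end

section \<open>Sub-semihypergroups\<close>

context semitopological_semihypergroup
begin

text \<open>The right-hand side satisfies the integral identity in \<open>sub_conv\<close> because
  integrals over \<open>H\<close> of restricted measures are integrals over \<open>X\<close> of cut
  ones; \<open>cmeasures_eqI\<close> on the locally compact subspace \<open>H\<close> makes the
  definite description unique.\<close>

lemma sub_conv_eq:
  assumes H: "closedin X H" and \<mu>: "\<mu> \<in> cmeasures X" and \<nu>: "\<nu> \<in> cmeasures X"
  shows "sub_conv X (\<star>) H (mrestrict X H \<mu>) (mrestrict X H \<nu>)
    = mrestrict X H (mcut X H \<mu> \<star> mcut X H \<nu>)"
proof -
  let ?Y = "subtopology X H"
  let ?\<rho> = "mrestrict X H (mcut X H \<mu> \<star> mcut X H \<nu>)"
  let ?I = "\<lambda>f. cintegral ?Y (mrestrict X H \<nu>) (\<lambda>y. cintegral ?Y (mrestrict X H \<mu>) (\<lambda>x.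
      cintegral ?Y (mrestrict X H (dirac X x \<star> dirac X y)) f))"
  note Hs = borel_of_closed[OF H]
  have HX: "H \<subseteq> topspace X" by (rule closedin_subset[OF H])
  have tY: "topspace ?Y = H" using HX by auto
  have hausY: "Hausdorff_space ?Y" by (rule Hausdorff_space_subtopology[OF Hausdorff])
  have lcY: "locally_compact_space ?Y" by (rule locally_compact_space_closed_subset[OF locally_compact H])
  note c\<mu> = mcut_cmeasures[OF Hausdorff \<mu> Hs] and c\<nu> = mcut_cmeasures[OF Hausdorff \<nu> Hs]
  have \<rho>: "?\<rho> \<in> cmeasures ?Y" by (intro mrestrict_cmeasures Hausdorff Hs closed c\<mu> c\<nu>)
  have int: "cintegral ?Y ?\<rho> f = ?I f"
    if f: "continuous_map ?Y euclidean f" "bounded (f ` H)" for f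
  proof -
    have fY: "f \<in> bdd_borel ?Y" using f tY by (metis bdd_borel_continuous)
    \<comment> \<open>Extension by zero is in general not continuous, which is why the
      disintegration is established for bounded Borel functions.\<close>
    define f0 where "f0 x = indicator H x *\<^sub>R f x" for x
    have f0: "f0 \<in> bdd_borel X" unfolding f0_def[abs_def] by (rule bdd_borel_extend[OF Hs fY])
    define F where "F x y = (\<integral>t. f0 t \<partial>point_conv x y)" for x y
    have inner: "cintegral ?Y (mrestrict X H (dirac X x \<star> dirac X y)) f = F x y"
      if "x \<in> topspace X" "y \<in> topspace X" for x y
    proof -
      note p = positive[OF dirac_pos dirac_pos, OF that]
      note r = radon_point_conv[OF that]
      have "cintegral ?Y (mrestrict X H (dirac X x \<star> dirac X y)) f = cintegral X (dirac X x \<star> dirac X y) f0"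
        unfolding f0_def[abs_def] by (rule cintegral_mrestrict[OF Hausdorff Hs pos_measures_cmeasures[OF p] fY])
      then show ?thesis
        using cintegral_cmeas_of[OF radon_finite[OF r] radon_sets[OF r] f0]
        by (simp add: F_def cmeas_of_total_variation[OF p])
    qed
    define h where "h y = cintegral X (mcut X H \<mu>) (\<lambda>x. F x y)" for y
    have Fb: "(\<lambda>x. F x y) \<in> bdd_borel X" if y: "y \<in> topspace X" for y
    proof -
      interpret cone_map X "\<lambda>\<mu>. \<mu> \<star> dirac X y" 1 by (rule cone_map_left_dirac[OF y])
      show ?thesis unfolding F_def by (rule kernel_integral_bdd_borel[OF f0])
    qed
    have hb: "h \<in> bdd_borel X"
      using conv_inner_bdd_borel[OF c\<mu> c\<nu> f0] by (simp add: h_def[abs_def] F_def)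
    have mid: "cintegral ?Y (mrestrict X H \<mu>) (\<lambda>x. cintegral ?Y (mrestrict X H (dirac X x \<star> dirac X y)) f) = h y"
      if y: "y \<in> H" for y
    proof -
      have yX: "y \<in> topspace X" using y HX by auto
      note cY = cmeasures_complex_borel_measure[OF mrestrict_cmeasures[OF Hausdorff Hs \<mu>]]
      have "cintegral ?Y (mrestrict X H \<mu>) (\<lambda>x. cintegral ?Y (mrestrict X H (dirac X x \<star> dirac X y)) f)
        = cintegral ?Y (mrestrict X H \<mu>) (\<lambda>x. F x y)"
        using inner yX HX by (intro cintegral_cong[OF cY]) (auto simp: tY)
      also have "\<dots> = cintegral ?Y (mrestrict X H (mcut X H \<mu>)) (\<lambda>x. F x y)"
        by (simp add: mrestrict_mcut[OF Hs])
      also have "\<dots> = cintegral X (mcut X H \<mu>) (\<lambda>x. indicator H x *\<^sub>R F x y)"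
        by (rule cintegral_mrestrict[OF Hausdorff Hs c\<mu> bdd_borel_subtopology[OF Hs Fb[OF yX]]])
      also have "\<dots> = h y"
        unfolding h_def
        by (rule cintegral_mcut[OF Hausdorff \<mu> Hs bdd_borel_extend[OF Hs bdd_borel_subtopology[OF Hs Fb[OF yX]]] Fb[OF yX]]) simp
      finally show ?thesis .
    qed
    note cY = cmeasures_complex_borel_measure[OF mrestrict_cmeasures[OF Hausdorff Hs \<nu>]]
    have "?I f = cintegral ?Y (mrestrict X H \<nu>) h"
      using mid by (intro cintegral_cong[OF cY]) (auto simp: tY)
    also have "\<dots> = cintegral ?Y (mrestrict X H (mcut X H \<nu>)) h"
      by (simp add: mrestrict_mcut[OF Hs])
    also have "\<dots> = cintegral X (mcut X H \<nu>) (\<lambda>y. indicator H y *\<^sub>R h y)"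
      by (rule cintegral_mrestrict[OF Hausdorff Hs c\<nu> bdd_borel_subtopology[OF Hs hb]])
    also have "\<dots> = cintegral X (mcut X H \<nu>) h"
      by (rule cintegral_mcut[OF Hausdorff \<nu> Hs bdd_borel_extend[OF Hs bdd_borel_subtopology[OF Hs hb]] hb]) simp
    also have "\<dots> = cintegral X (mcut X H \<mu> \<star> mcut X H \<nu>) f0"
      using cintegral_conv[OF c\<mu> c\<nu> f0] by (simp add: h_def[abs_def] F_def)
    also have "\<dots> = cintegral ?Y ?\<rho> f"
      unfolding f0_def[abs_def] by (rule cintegral_mrestrict[OF Hausdorff Hs closed[OF c\<mu> c\<nu>] fY, symmetric])
    finally show ?thesis by simp
  qed
  show ?thesis
    unfolding sub_conv_def
  proof (rule the_equality)
    show "?\<rho> \<in> cmeasures ?Y \<and> (\<forall>f. continuous_map ?Y euclidean f \<and> bounded (f ` H) \<longrightarrow>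
      cintegral ?Y ?\<rho> f = ?I f)"
      using \<rho> int by blast
    fix \<rho>' assume \<rho>': "\<rho>' \<in> cmeasures ?Y \<and> (\<forall>f. continuous_map ?Y euclidean f \<and> bounded (f ` H) \<longrightarrow>
      cintegral ?Y \<rho>' f = ?I f)"
    show "\<rho>' = ?\<rho>"
    proof (rule cmeasures_eqI[OF lcY hausY _ \<rho>])
      show "cintegral ?Y \<rho>' f = cintegral ?Y ?\<rho> f"
        if "continuous_map ?Y euclidean f" "bounded (f ` topspace ?Y)" for f
        using that \<rho>' int[of f] unfolding tY by simp
    qed (use \<rho>' in blast)
  qed
qed

lemma left_inverse_set_measure:
  "x \<in> topspace X \<Longrightarrow> left_inverse_set X (\<star>) x E = {y\<in>topspace X. 0 < measure (point_conv x y) E}"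
  by (auto simp: left_inverse_set_def Re_dirac_conv)

lemma right_inverse_set_measure:
  "y \<in> topspace X \<Longrightarrow> right_inverse_set X (\<star>) E y = {x\<in>topspace X. 0 < measure (point_conv x y) E}"
  by (auto simp: right_inverse_set_def Re_dirac_conv)

end

text \<open>Kernel masses are at most \<open>1\<close>, so the integrand is below the indicator of
  the set where it is positive. For convolution with a point mass that set is an inverse
  set.\<close>

lemma (in cone_map) measure_image_le_support:
  assumes N: "radon X N" and E: "E \<in> sets (borel_of X)" and c: "c \<le> 1"
  shows "{y\<in>topspace X. 0 < measure (\<K> y) E} \<in> sets (borel_of X)"
    and "measure (\<R> N) E \<le> measure N {y\<in>topspace X. 0 < measure (\<K> y) E}"
proof -
  let ?S = "{y\<in>topspace X. 0 < measure (\<K> y) E}"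
  interpret N: finite_measure N by (rule radon_finite[OF N])
  note m = measure_image(1)[OF E]
  have "{y\<in>space (borel_of X). 0 < measure (\<K> y) E} \<in> sets (borel_of X)"
    using m by measurable
  then show S: "?S \<in> sets (borel_of X)" by simp
  then have S': "?S \<in> sets N" by (simp add: radon_sets[OF N])
  have "measure (\<R> N) E = (\<integral>y. measure (\<K> y) E \<partial>N)" by (rule measure_image(2)[OF E N])
  also have "\<dots> \<le> (\<integral>y. indicator ?S y \<partial>N)"
  proof (rule integral_mono[OF integrable_measure_kernel[OF N m]])
    show "integrable N (indicator ?S :: _ \<Rightarrow> real)"
      using S' by (intro integrable_real_indicator) (auto simp: N.emeasure_eq_measure)
    fix y assume "y \<in> space N"
    then have y: "y \<in> topspace X" by (simp add: radon_space[OF N])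
    show "measure (\<K> y) E \<le> indicator ?S y"
      using measure_kernel_le[OF y, of E] c y measure_nonneg[of "\<K> y" E]
      by (auto split: split_indicator)
  qed
  also have "\<dots> = measure N ?S" using sets.sets_into_space[OF S'] by (simp add: Int_absorb2)
  finally show "measure (\<R> N) E \<le> measure N ?S" .
qed

context semitopological_semihypergroup
begin

text \<open>By \<open>cmod_conv_le\<close> the restriction of \<open>A \<star> B\<close> to
  \<open>H\<close> dominates that of \<open>\<alpha> \<star> \<beta>\<close>, and the total
  variation is the least dominating measure.\<close>

lemma tv_norm_mrestrict_conv_le:
  assumes H: "H \<in> sets (borel_of X)" and \<alpha>: "\<alpha> \<in> cmeasures X" and \<beta>: "\<beta> \<in> cmeasures X"
    and A: "radon X A" "\<And>B. B \<in> sets (borel_of X) \<Longrightarrow> cmod (\<alpha> B) \<le> measure A B"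
    and B: "radon X B" "\<And>S. S \<in> sets (borel_of X) \<Longrightarrow> cmod (\<beta> S) \<le> measure B S"
  shows "tv_norm (subtopology X H) (mrestrict X H (\<alpha> \<star> \<beta>))
    \<le> ennreal (measure (total_variation X (cmeas_of A \<star> cmeas_of B)) H)"
proof -
  let ?R = "total_variation X (cmeas_of A \<star> cmeas_of B)"
  have r: "radon X ?R"
    by (intro radon_total_variation Hausdorff pos_measures_cmeasures positive cmeas_of_pos A(1) B(1))
  interpret R: finite_measure ?R by (rule radon_finite[OF r])
  have tY: "topspace (subtopology X H) = H" using sets.sets_into_space[OF H] by auto
  have HY: "H \<in> sets (borel_of (subtopology X H))" using H by (simp add: sets_borel_of_subtopology)
  note cY = cmeasures_complex_borel_measure[OF mrestrict_cmeasures[OF Hausdorff H closed[OF \<alpha> \<beta>]]]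
  have "emeasure (total_variation (subtopology X H) (mrestrict X H (\<alpha> \<star> \<beta>))) H \<le> emeasure (restrict_space ?R H) H"
  proof (rule emeasure_total_variation_le[OF cY sets_restrict_borel_of[OF H radon_sets[OF r]] _ HY])
    fix S assume S: "S \<in> sets (borel_of (subtopology X H))"
    then have S': "S \<in> sets (borel_of X)" using H by (simp add: sets_borel_of_subtopology)
    have "ennreal (cmod ((\<alpha> \<star> \<beta>) S)) \<le> ennreal (measure ?R S)"
      by (intro ennreal_leI cmod_conv_le \<alpha> \<beta> A B S')
    also have "\<dots> = emeasure (restrict_space ?R H) S"
      unfolding measure_restrict_borel_of(1)[OF H radon_sets[OF r] S] by (rule R.emeasure_eq_measure[symmetric])
    finally show "ennreal (cmod (mrestrict X H (\<alpha> \<star> \<beta>) S)) \<le> emeasure (restrict_space ?R H) S"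
      unfolding mrestrict_apply[OF S] .
  qed
  then show ?thesis
    unfolding tv_norm_def tY measure_restrict_borel_of(1)[OF H radon_sets[OF r] HY] R.emeasure_eq_measure .
qed

text \<open>
  The integrands on the right of the next two bounds need not be measurable; the Lebesgue integral is
  then a lower integral, and dominating a measurable function from above is still enough.
\<close>

lemma tv_norm_conv_left_le:
  assumes H: "H \<in> sets (borel_of X)" and F: "F \<in> sets (borel_of X)" and G: "G \<in> sets (borel_of X)"
    and \<mu>: "\<mu> \<in> cmeasures X" and \<nu>: "\<nu> \<in> cmeasures X"
  shows "tv_norm (subtopology X H) (mrestrict X H (mcut X F \<mu> \<star> mcut X G \<nu>))
    \<le> (\<integral>\<^sup>+x\<in>F. emeasure (total_variation X \<nu>) (left_inverse_set X (\<star>) x H \<inter> G) \<partial>total_variation X \<mu>)"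
proof -
  note r\<mu> = radon_total_variation[OF Hausdorff \<mu>] and r\<nu> = radon_total_variation[OF Hausdorff \<nu>]
  let ?A = "density (total_variation X \<mu>) (indicator F)"
  let ?B = "density (total_variation X \<nu>) (indicator G)"
  have A: "radon X ?A" and B: "radon X ?B" by (intro radon_cut Hausdorff r\<mu> r\<nu> F G)+
  interpret V: finite_measure "total_variation X \<nu>" by (rule radon_finite[OF r\<nu>])
  interpret L: cone_map X "\<lambda>\<mu>. \<mu> \<star> cmeas_of ?B" "measure ?B (topspace X)" by (rule cone_map_left_radon[OF B])
  have "tv_norm (subtopology X H) (mrestrict X H (mcut X F \<mu> \<star> mcut X G \<nu>)) \<le> ennreal (measure (L.\<R> ?A) H)"
    by (intro tv_norm_mrestrict_conv_le H mcut_cmeasures Hausdorff \<mu> \<nu> F G A B cmod_mcut_le)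
  also have "measure (L.\<R> ?A) H = (\<integral>x. measure (L.\<K> x) H \<partial>?A)" by (rule L.measure_image(2)[OF H A])
  also have "ennreal \<dots> = (\<integral>\<^sup>+x. ennreal (measure (L.\<K> x) H) \<partial>?A)"
    using L.integrable_measure_kernel[OF A L.measure_image(1)[OF H]]
    by (intro nn_integral_eq_integral[symmetric]) auto
  also have "\<dots> = (\<integral>\<^sup>+x. indicator F x * ennreal (measure (L.\<K> x) H) \<partial>total_variation X \<mu>)"
    using L.measure_image(1)[OF H] F
    by (intro nn_integral_density) (auto simp: measurable_cong_sets[OF radon_sets[OF r\<mu>] refl])
  also have "\<dots> \<le> (\<integral>\<^sup>+x\<in>F. emeasure (total_variation X \<nu>) (left_inverse_set X (\<star>) x H \<inter> G) \<partial>total_variation X \<mu>)"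
  proof (rule nn_integral_mono)
    fix x assume "x \<in> space (total_variation X \<mu>)"
    then have x: "x \<in> topspace X" by (simp add: radon_space[OF r\<mu>])
    \<comment> \<open>The mass of \<open>H\<close> under \<open>p_x \<star> ?B\<close> is
      disintegrated once more, over the other factor; the kernel \<open>p_x \<star> p_y\<close>
      charges \<open>H\<close> exactly when \<open>y\<close> lies in the left inverse set.\<close>
    interpret R: cone_map X "\<lambda>\<nu>. dirac X x \<star> \<nu>" 1 by (rule cone_map_right_dirac[OF x])
    note S = R.measure_image_le_support[OF B H order_refl, folded left_inverse_set_measure[OF x]]
    have "measure (L.\<K> x) H \<le> measure (total_variation X \<nu>) (left_inverse_set X (\<star>) x H \<inter> G)"
      using S(2) measure_cut(2)[OF r\<nu> G S(1)] by simp
    then have "ennreal (measure (L.\<K> x) H) \<le> emeasure (total_variation X \<nu>) (left_inverse_set X (\<star>) x H \<inter> G)"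
      by (simp add: V.emeasure_eq_measure ennreal_leI)
    then show "indicator F x * ennreal (measure (L.\<K> x) H)
        \<le> emeasure (total_variation X \<nu>) (left_inverse_set X (\<star>) x H \<inter> G) * indicator F x"
      unfolding mult.commute[of _ "indicator F x"] by (rule mult_left_mono) simp
  qed
  finally show ?thesis .
qed

lemma tv_norm_conv_right_le:
  assumes H: "H \<in> sets (borel_of X)" and F: "F \<in> sets (borel_of X)"
    and \<mu>: "\<mu> \<in> cmeasures X" and \<nu>: "\<nu> \<in> cmeasures X"
  shows "tv_norm (subtopology X H) (mrestrict X H (mcut X F \<mu> \<star> \<nu>))
    \<le> (\<integral>\<^sup>+y. emeasure (total_variation X \<mu>) (right_inverse_set X (\<star>) H y \<inter> F) \<partial>total_variation X \<nu>)"
proof -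
  note r\<mu> = radon_total_variation[OF Hausdorff \<mu>] and r\<nu> = radon_total_variation[OF Hausdorff \<nu>]
  let ?A = "density (total_variation X \<mu>) (indicator F)"
  have A: "radon X ?A" by (intro radon_cut Hausdorff r\<mu> F)
  interpret V: finite_measure "total_variation X \<mu>" by (rule radon_finite[OF r\<mu>])
  interpret R: cone_map X "\<lambda>\<nu>. cmeas_of ?A \<star> \<nu>" "measure ?A (topspace X)" by (rule cone_map_right_radon[OF A])
  have "tv_norm (subtopology X H) (mrestrict X H (mcut X F \<mu> \<star> \<nu>))
      \<le> ennreal (measure (R.\<R> (total_variation X \<nu>)) H)"
    by (intro tv_norm_mrestrict_conv_le H mcut_cmeasures Hausdorff \<mu> \<nu> F A r\<nu> cmod_mcut_le cmod_le_total_variation)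
  also have "measure (R.\<R> (total_variation X \<nu>)) H = (\<integral>y. measure (R.\<K> y) H \<partial>total_variation X \<nu>)"
    by (rule R.measure_image(2)[OF H r\<nu>])
  also have "ennreal \<dots> = (\<integral>\<^sup>+y. ennreal (measure (R.\<K> y) H) \<partial>total_variation X \<nu>)"
    using R.integrable_measure_kernel[OF r\<nu> R.measure_image(1)[OF H]]
    by (intro nn_integral_eq_integral[symmetric]) auto
  also have "\<dots> \<le> (\<integral>\<^sup>+y. emeasure (total_variation X \<mu>) (right_inverse_set X (\<star>) H y \<inter> F) \<partial>total_variation X \<nu>)"
  proof (rule nn_integral_mono)
    fix y assume "y \<in> space (total_variation X \<nu>)"
    then have y: "y \<in> topspace X" by (simp add: radon_space[OF r\<nu>])
    interpret L: cone_map X "\<lambda>\<mu>. \<mu> \<star> dirac X y" 1 by (rule cone_map_left_dirac[OF y])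
    note S = L.measure_image_le_support[OF A H order_refl, folded right_inverse_set_measure[OF y]]
    have "measure (R.\<K> y) H \<le> measure (total_variation X \<mu>) (right_inverse_set X (\<star>) H y \<inter> F)"
      using S(2) measure_cut(2)[OF r\<mu> F S(1)] by simp
    then show "ennreal (measure (R.\<K> y) H) \<le> emeasure (total_variation X \<mu>) (right_inverse_set X (\<star>) H y \<inter> F)"
      by (simp add: V.emeasure_eq_measure ennreal_leI)
  qed
  finally show ?thesis .
qed

text \<open>
  With \<open>z\<close> in the intersection, \<open>e\<close> lies in the support of \<open>p\<^bsub>invol z\<^esub> * p\<^sub>x * p\<^sub>y\<close>; bracketing this product
  the other way yields \<open>w \<in> H\<close> with \<open>w = invol y\<close>.
\<close>

lemma sub_hypergroup_conv_null:
  assumes hyp: "hypergroup X (\<star>) e invol" and sub: "sub_hypergroup X (\<star>) invol H"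
    and x: "x \<in> H" and y: "y \<in> topspace X - H"
  shows "measure (point_conv x y) H = 0"
proof -
  interpret h: hypergroup X "(\<star>)" e invol by (rule hyp)
  have H: "closedin X H" and HH: "set_conv X (\<star>) H H \<subseteq> H" and inv: "invol ` H = H"
    using sub by (auto simp: sub_hypergroup_def)
  have HX: "H \<subseteq> topspace X" by (rule closedin_subset[OF H])
  have xX: "x \<in> topspace X" and yX: "y \<in> topspace X" using x y HX by auto
  have "H \<inter> msupp X (dirac X x \<star> dirac X y) = {}"
  proof (rule ccontr)
    assume "H \<inter> msupp X (dirac X x \<star> dirac X y) \<noteq> {}"
    then obtain z where z: "z \<in> H" "z \<in> msupp X (dirac X x \<star> dirac X y)" by auto
    let ?z = "invol z"
    have zX: "z \<in> topspace X" using z HX by auto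
    have zH: "?z \<in> H" using z(1) inv by blast
    then have z'X: "?z \<in> topspace X" using HX by auto
    interpret R: cone_map X "\<lambda>\<nu>. dirac X ?z \<star> \<nu>" 1 by (rule cone_map_right_dirac[OF z'X])
    interpret L: cone_map X "\<lambda>\<mu>. \<mu> \<star> dirac X y" 1 by (rule cone_map_left_dirac[OF yX])
    have "e \<in> msupp X (dirac X ?z \<star> dirac X z)" using h.identity_in_supp_iff[OF z'X zX] by simp
    then have "e \<in> msupp X (dirac X ?z \<star> (dirac X x \<star> dirac X y))"
      by (rule R.msupp_imageI[OF positive[OF dirac_pos[OF xX] dirac_pos[OF yX]] z(2)])
    also have "dirac X ?z \<star> (dirac X x \<star> dirac X y) = (dirac X ?z \<star> dirac X x) \<star> dirac X y"
      by (intro assoc[symmetric] pos_measures_cmeasures dirac_pos xX yX z'X)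
    finally have "\<exists>w\<in>msupp X (dirac X ?z \<star> dirac X x). e \<in> msupp X (dirac X w \<star> dirac X y)"
      by (intro L.msupp_imageD positive dirac_pos z'X xX dirac_compact_supp yX supp_continuous_left) auto
    then obtain w where w: "w \<in> msupp X (dirac X ?z \<star> dirac X x)" "e \<in> msupp X (dirac X w \<star> dirac X y)"
      by blast
    have wH: "w \<in> H" using w(1) HH zH x by (auto simp: set_conv_def)
    then have "w = invol y" using w(2) h.identity_in_supp_iff[OF _ yX] HX by auto
    then have "y = invol w" using h.invol_invol[OF yX] by simp
    then have "y \<in> H" using wH inv by blast
    with y show False by simp
  qed
  note p = positive[OF dirac_pos[OF xX] dirac_pos[OF yX]]
  note r = radon_point_conv[OF xX yX]
  interpret P: finite_measure "point_conv x y" by (rule radon_finite[OF r])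
  let ?U = "topspace X - msupp X (dirac X x \<star> dirac X y)"
  have U: "openin X ?U" using compactin_imp_closedin[OF Hausdorff dirac_compact_supp[OF xX yX]] by auto
  have "emeasure (point_conv x y) ?U = 0"
    by (intro msupp_null Hausdorff pos_measures_cmeasures p U) auto
  then have U0: "measure (point_conv x y) ?U = 0" by (simp add: measure_def)
  have "measure (point_conv x y) H \<le> measure (point_conv x y) ?U"
    using \<open>H \<inter> msupp X (dirac X x \<star> dirac X y) = {}\<close> HX borel_of_open[OF U]
    by (intro P.finite_measure_mono) (auto simp: radon_sets[OF r])
  with U0 show ?thesis using measure_nonneg[of "point_conv x y" H] by linarith
qed

lemma mcut_null:
  assumes H: "closedin X H" and \<mu>: "\<mu> \<in> cmeasures X" and supp: "msupp X \<mu> \<subseteq> H"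
  shows "emeasure (total_variation X \<mu>) (topspace X - H) = 0" "mcut X (topspace X - H) \<mu> = (\<lambda>B. 0)"
proof -
  have op: "openin X (topspace X - H)" using H by auto
  note r = radon_total_variation[OF Hausdorff \<mu>]
  show null: "emeasure (total_variation X \<mu>) (topspace X - H) = 0"
    by (rule msupp_null[OF Hausdorff \<mu> op]) (use supp in auto)
  show "mcut X (topspace X - H) \<mu> = (\<lambda>B. 0)"
  proof
    fix B show "mcut X (topspace X - H) \<mu> B = 0"
    proof (cases "B \<in> sets (borel_of X)")
      case True
      have s: "B \<inter> (topspace X - H) \<in> sets (borel_of X)" using True borel_of_open[OF op] by auto
      have "emeasure (total_variation X \<mu>) (B \<inter> (topspace X - H)) = 0"
        using emeasure_mono[of "B \<inter> (topspace X - H)" "topspace X - H" "total_variation X \<mu>"] null borel_of_open[OF op]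
        by (simp add: radon_sets[OF r])
      then show ?thesis using cmod_le_total_variation[OF \<mu> s] True by (simp add: measure_def mcut_def)
    qed (simp add: mcut_def)
  qed
qed

text \<open>Splitting \<open>\<mu>\<close> first and \<open>\<nu>\<close> only against the part of
  \<open>\<mu>\<close> on \<open>H\<close> leaves two error terms, one for each integral in (1). The
  second involves \<open>\<mu>\<close> off \<open>H\<close> only, so it vanishes in the situation of
  (2).\<close>

lemma conv_mcut_split:
  assumes H: "closedin X H" and \<mu>: "\<mu> \<in> cmeasures X" and \<nu>: "\<nu> \<in> cmeasures X"
  shows "(\<lambda>B. mrestrict X H (\<mu> \<star> \<nu>) B - sub_conv X (\<star>) H (mrestrict X H \<mu>) (mrestrict X H \<nu>) B)
    = (\<lambda>B. mrestrict X H (mcut X H \<mu> \<star> mcut X (topspace X - H) \<nu>) B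
        + mrestrict X H (mcut X (topspace X - H) \<mu> \<star> \<nu>) B)"
proof
  fix B
  note Hs = borel_of_closed[OF H]
  have Hc: "topspace X - H \<in> sets (borel_of X)" using sets.compl_sets[OF Hs] by simp
  note m = mcut_cmeasures[OF Hausdorff]
  have "\<mu> \<star> \<nu> = (\<lambda>B. (mcut X H \<mu> \<star> \<nu>) B + (mcut X (topspace X - H) \<mu> \<star> \<nu>) B)"
    using add_left[OF m[OF \<mu> Hs] m[OF \<mu> Hc] \<nu>] by (simp add: mcut_split[OF \<mu> Hs])
  moreover have "mcut X H \<mu> \<star> \<nu>
      = (\<lambda>B. (mcut X H \<mu> \<star> mcut X H \<nu>) B + (mcut X H \<mu> \<star> mcut X (topspace X - H) \<nu>) B)"
    using add_right[OF m[OF \<nu> Hs] m[OF \<nu> Hc] m[OF \<mu> Hs]] by (simp add: mcut_split[OF \<nu> Hs])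
  ultimately show "mrestrict X H (\<mu> \<star> \<nu>) B - sub_conv X (\<star>) H (mrestrict X H \<mu>) (mrestrict X H \<nu>) B
      = mrestrict X H (mcut X H \<mu> \<star> mcut X (topspace X - H) \<nu>) B
        + mrestrict X H (mcut X (topspace X - H) \<mu> \<star> \<nu>) B"
    unfolding sub_conv_eq[OF H \<mu> \<nu>] by (simp add: mrestrict_def)
qed

end

theorem theorem3p4:
  fixes X :: "'a topology"
    and conv :: "'a cmeas \<Rightarrow> 'a cmeas \<Rightarrow> 'a cmeas"  (infixl "\<star>" 70)
    and H :: "'a set" and \<mu> \<nu> :: "'a cmeas"
  assumes "semitopological_semihypergroup X (\<star>)"
    and "sub_semihypergroup X (\<star>) H"
    and "\<mu> \<in> cmeasures X" and "\<nu> \<in> cmeasures X"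
  shows
    "(let diff = (\<lambda>B. mrestrict X H (\<mu> \<star> \<nu>) B
                       - sub_conv X (\<star>) H (mrestrict X H \<mu>) (mrestrict X H \<nu>) B)
      in
        tv_norm (subtopology X H) diff
          \<le> (\<integral>\<^sup>+y. emeasure (total_variation X \<mu>)
                   (right_inverse_set X (\<star>) H y \<inter> (topspace X - H)) \<partial>total_variation X \<nu>)
            + (\<integral>\<^sup>+x. emeasure (total_variation X \<nu>)
                   (left_inverse_set X (\<star>) x H \<inter> (topspace X - H)) \<partial>total_variation X \<mu>)
        \<and> (msupp X \<mu> \<subseteq> H \<longrightarrow>
             tv_norm (subtopology X H) diff
               \<le> (\<integral>\<^sup>+y\<in>H. emeasure (total_variation X \<nu>)
                     (left_inverse_set X (\<star>) y H \<inter> (topspace X - H)) \<partial>total_variation X \<mu>)))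
     \<and> (msupp X \<mu> \<subseteq> H \<and> msupp X \<nu> \<subseteq> H \<longrightarrow>
           mrestrict X H (\<mu> \<star> \<nu>) = sub_conv X (\<star>) H (mrestrict X H \<mu>) (mrestrict X H \<nu>))
     \<and> (\<forall>e invol. hypergroup X (\<star>) e invol \<and> sub_hypergroup X (\<star>) invol H \<and> msupp X \<mu> \<subseteq> H \<longrightarrow>
           mrestrict X H (\<mu> \<star> \<nu>) = sub_conv X (\<star>) H (mrestrict X H \<mu>) (mrestrict X H \<nu>))"
proof -
  interpret semitopological_semihypergroup X conv by (rule assms(1))
  note \<mu> = assms(3) and \<nu> = assms(4)
  have H: "closedin X H" using assms(2) by (simp add: sub_semihypergroup_def)
  note Hs = borel_of_closed[OF H]
  have Hc: "topspace X - H \<in> sets (borel_of X)" using sets.compl_sets[OF Hs] by simp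
  let ?Y = "subtopology X H"
  let ?D1 = "mrestrict X H (mcut X H \<mu> \<star> mcut X (topspace X - H) \<nu>)"
  let ?D2 = "mrestrict X H (mcut X (topspace X - H) \<mu> \<star> \<nu>)"
  let ?L = "\<lambda>x. emeasure (total_variation X \<nu>) (left_inverse_set X (\<star>) x H \<inter> (topspace X - H))"
  let ?R = "\<lambda>y. emeasure (total_variation X \<mu>) (right_inverse_set X (\<star>) H y \<inter> (topspace X - H))"
  let ?eq = "mrestrict X H (\<mu> \<star> \<nu>) = sub_conv X (\<star>) H (mrestrict X H \<mu>) (mrestrict X H \<nu>)"
  define diff where "diff = (\<lambda>B. mrestrict X H (\<mu> \<star> \<nu>) B
    - sub_conv X (\<star>) H (mrestrict X H \<mu>) (mrestrict X H \<nu>) B)"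
  have D: "diff = (\<lambda>B. ?D1 B + ?D2 B)" unfolding diff_def by (rule conv_mcut_split[OF H \<mu> \<nu>])
  have c1: "complex_borel_measure ?Y ?D1" and c2: "complex_borel_measure ?Y ?D2"
    by (intro cmeasures_complex_borel_measure mrestrict_cmeasures Hausdorff Hs closed mcut_cmeasures \<mu> \<nu> Hc)+
  have cD: "complex_borel_measure ?Y diff" unfolding D by (rule complex_borel_measure_add[OF c1 c2])
  have n1: "tv_norm ?Y ?D1 \<le> (\<integral>\<^sup>+x\<in>H. ?L x \<partial>total_variation X \<mu>)"
    by (rule tv_norm_conv_left_le[OF Hs Hs Hc \<mu> \<nu>])
  have n2: "tv_norm ?Y ?D2 \<le> (\<integral>\<^sup>+y. ?R y \<partial>total_variation X \<nu>)"
    by (rule tv_norm_conv_right_le[OF Hs Hc \<mu> \<nu>])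
  have sum: "tv_norm ?Y diff \<le> tv_norm ?Y ?D1 + tv_norm ?Y ?D2"
    unfolding D by (rule tv_norm_add[OF c1 c2])
  \<comment> \<open>The first error term is bounded by an integral over \<open>H\<close>, as (2)
    requires; for (1) it is enlarged to the whole space.\<close>
  have 1: "tv_norm ?Y diff \<le> (\<integral>\<^sup>+y. ?R y \<partial>total_variation X \<nu>) + (\<integral>\<^sup>+x. ?L x \<partial>total_variation X \<mu>)"
  proof -
    have "(\<integral>\<^sup>+x\<in>H. ?L x \<partial>total_variation X \<mu>) \<le> (\<integral>\<^sup>+x. ?L x \<partial>total_variation X \<mu>)"
      by (intro nn_integral_mono) (auto split: split_indicator)
    then show ?thesis
      using sum n1 n2 by (subst add.commute) (meson add_mono order_trans)
  qed
  have 2: "tv_norm ?Y diff \<le> (\<integral>\<^sup>+x\<in>H. ?L x \<partial>total_variation X \<mu>)" if supp: "msupp X \<mu> \<subseteq> H"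
  proof -
    have "?D2 = (\<lambda>B. 0)" using mcut_null(2)[OF H \<mu> supp] conv_zero_left[OF \<nu>] by (simp add: mrestrict_def)
    then show ?thesis using sum n1 tv_norm_zero[of ?Y] by simp
  qed
  have eqI: ?eq
    if supp: "msupp X \<mu> \<subseteq> H" and L0: "\<And>x. x \<in> H \<Longrightarrow> ?L x = 0"
  proof -
    have "(\<integral>\<^sup>+x\<in>H. ?L x \<partial>total_variation X \<mu>) = (\<integral>\<^sup>+x. 0 \<partial>total_variation X \<mu>)"
      using L0 by (intro nn_integral_cong) (auto split: split_indicator)
    then have "tv_norm ?Y diff = 0" using 2[OF supp] by simp
    then have "diff B = 0" for B by (rule tv_norm_zeroD[OF cD])
    then show ?thesis unfolding diff_def by (intro ext) (metis eq_iff_diff_eq_0)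
  qed
  have 3: ?eq
    if supp: "msupp X \<mu> \<subseteq> H" "msupp X \<nu> \<subseteq> H"
  proof (rule eqI[OF supp(1)])
    fix x
    have "?L x \<le> emeasure (total_variation X \<nu>) (topspace X - H)"
      using Hc radon_sets[OF radon_total_variation[OF Hausdorff \<nu>]] by (intro emeasure_mono) auto
    then show "?L x = 0" using mcut_null(1)[OF H \<nu> supp(2)] by simp
  qed
  have 4: ?eq
    if hyp: "hypergroup X (\<star>) e invol" "sub_hypergroup X (\<star>) invol H" and supp: "msupp X \<mu> \<subseteq> H" for e invol
  proof (rule eqI[OF supp])
    fix x assume x: "x \<in> H"
    then have "x \<in> topspace X" using closedin_subset[OF H] by auto
    then have "left_inverse_set X (\<star>) x H \<inter> (topspace X - H) = {}"
      using sub_hypergroup_conv_null[OF hyp x] by (auto simp: left_inverse_set_measure)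
    then show "?L x = 0" by simp
  qed
  show ?thesis
    unfolding Let_def diff_def[symmetric] using 1 2 3 4 by blast
qed

end
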